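(* Let $\phi:\mathbb{Z}\to\mathbb{C}$ have admissible support and be such that $\sup_{\xi}|\hat\phi(\xi)|=1$. Let $m=m_\phi$, $\xi_1,\dots,\xi_R$, $\alpha_1,\dots,\alpha_R$ and $\beta_1,\dots,\beta_R$ be the constants associated to $\phi$ as defined in the context. Suppose additionally that $$m>2\quad\text{or}\quad \Re(\beta_q)>0\ \text{ for all } q=1,2,\dots,R.$$ Then there exists a compact set $K\subseteq\mathbb{R}$ such that, for every natural number $n$, the supremum of $|\phi^{(n)}|$ is attained on $$\left(\bigcup_{q=1}^{R}(\alpha_q n+ Kn^{1/m})\right)\cap\mathbb{Z},$$ and $$\phi^{(n)}(x)=\sum_{q=1}^{R}n^{-1/m}e^{-ix\xi_q}\hat{\phi}(\xi_q)^n H_m^{\beta_q}\left(\frac{x-\alpha_qn}{n^{1/m}}\right)+o(n^{-1/m})$$ as $n\to\infty$, uniformly for $x\in\mathbb{Z}$.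
   Context: A function $\phi:\mathbb{Z}\to\mathbb{C}$ has admissible support if its support is finite and consists of more than one point. The convolution powers are $\phi^{(1)}=\phi$ and $\phi^{(n)}(x)=\sum_{y\in\mathbb{Z}}\phi^{(n-1)}(x-y)\phi(y)$ for $n\ge 2$. The Fourier transform is $\hat{\phi}(\xi)=\sum_{x\in\mathbb{Z}}\phi(x)e^{ix\xi}$, $\xi\in\mathbb{R}$. Natural numbers are the positive integers. Constants associated to $\phi$ (with admissible support and $\sup_\xi|\hat\phi(\xi)|=1$): let $\Omega=\{\xi'\in(-\pi,\pi]:|\hat\phi(\xi')|=1\}$, which is a finite set. For each $\xi_0\in\Omega$, the Taylor expansion about $\xi=0$ (principal branch of $\log$) has the form $$\log\left(\frac{\hat\phi(\xi+\xi_0)}{\hat\phi(\xi_0)}\right)=i\alpha\xi-\beta\xi^{m}+o(\xi^{m})\quad(\xi\to0),$$ where $m=m(\xi_0)\geq 2$ is an integer, $\alpha=\alpha(\xi_0)\in\mathbb{R}$ and $\beta=\beta(\xi_0)\in\mathbb{C}$ is non-zero with $\Re(\beta)\ge 0$ (and $\Re(\beta)=0$ whenever $m(\xi_0)$ is odd). Set $m_\phi=\max_{\xi_0\in\Omega}m(\xi_0)$, let $\xi_1,\dots,\xi_R$ be the distinct points of $\Omega$ with $m(\xi_q)=m_\phi$, and put $\alpha_q=\alpha(\xi_q)$, $\beta_q=\beta(\xi_q)$ for $q=1,\dots,R$. For an integer $m\ge2$ and non-zero $\beta\in\mathbb{C}$ with $\Re(\beta)\ge0$ (with $m$ even if $\Re(\beta)>0$),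 $H_m^{\beta}:\mathbb{R}\to\mathbb{C}$ is defined by the (convergent) improper Riemann integral $H_m^{\beta}(x)=\frac{1}{2\pi}\int_{\mathbb{R}}e^{-ixu}e^{-\beta u^m}\,du$. For a real number $a$ and $t>0$, $a+Kt=\{a+kt:k\in K\}$. *)

theory Defs
  imports "HOL-Analysis.Analysis" "HOL-Library.Landau_Symbols"
begin

definition admissible_support :: "(int \<Rightarrow> complex) \<Rightarrow> bool" where
  "admissible_support \<phi> \<longleftrightarrow> finite {x. \<phi> x \<noteq> 0} \<and> card {x. \<phi> x \<noteq> 0} > 1"

(* Convolution powers are only considered for exponents n \<ge> 1; the value at 0 is the
   convolution unit. *)
fun conv_power :: "(int \<Rightarrow> complex) \<Rightarrow> nat \<Rightarrow> int \<Rightarrow> complex" where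
  "conv_power \<phi> 0 = (\<lambda>x. if x = 0 then 1 else 0)"
| "conv_power \<phi> (Suc 0) = \<phi>"
| "conv_power \<phi> (Suc (Suc n)) = (\<lambda>x. \<Sum>\<^sub>\<infinity>y. conv_power \<phi> (Suc n) (x - y) * \<phi> y)"

definition fourier :: "(int \<Rightarrow> complex) \<Rightarrow> real \<Rightarrow> complex" where
  "fourier \<phi> \<xi> = (\<Sum>\<^sub>\<infinity>x. \<phi> x * exp (\<i> * of_int x * of_real \<xi>))"

definition Omega :: "(int \<Rightarrow> complex) \<Rightarrow> real set" where
  "Omega \<phi> = {\<xi>\<in>{-pi<..pi}. cmod (fourier \<phi> \<xi>) = 1}"

definition log_expansion ::
    "(int \<Rightarrow> complex) \<Rightarrow> real \<Rightarrow> nat \<Rightarrow> real \<Rightarrow> complex \<Rightarrow> bool" where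
  "log_expansion \<phi> \<xi>0 m \<alpha> \<beta> \<longleftrightarrow>
     m \<ge> 2 \<and> \<beta> \<noteq> 0 \<and> Re \<beta> \<ge> 0 \<and> (odd m \<longrightarrow> Re \<beta> = 0) \<and>
     (\<lambda>\<xi>. Ln (fourier \<phi> (\<xi> + \<xi>0) / fourier \<phi> \<xi>0)
            - (\<i> * of_real \<alpha> * of_real \<xi> - \<beta> * of_real \<xi> ^ m))
       \<in> o[at 0](\<lambda>\<xi>. of_real \<xi> ^ m)"

(* For \<xi>0 in Omega, the triple (m, \<alpha>, \<beta>) is uniquely determined by the expansion, as the
   linear coefficient is purely imaginary and \<beta> \<xi>^m is the first non-zero term of order at
   least 2. *)
definition expansion_data :: "(int \<Rightarrow> complex) \<Rightarrow> real \<Rightarrow> nat \<times> real \<times> complex" where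
  "expansion_data \<phi> \<xi>0 = (THE (m, \<alpha>, \<beta>). log_expansion \<phi> \<xi>0 m \<alpha> \<beta>)"

definition m_at :: "(int \<Rightarrow> complex) \<Rightarrow> real \<Rightarrow> nat" where
  "m_at \<phi> \<xi>0 = fst (expansion_data \<phi> \<xi>0)"

definition alpha_at :: "(int \<Rightarrow> complex) \<Rightarrow> real \<Rightarrow> real" where
  "alpha_at \<phi> \<xi>0 = fst (snd (expansion_data \<phi> \<xi>0))"

definition beta_at :: "(int \<Rightarrow> complex) \<Rightarrow> real \<Rightarrow> complex" where
  "beta_at \<phi> \<xi>0 = snd (snd (expansion_data \<phi> \<xi>0))"

definition m_max :: "(int \<Rightarrow> complex) \<Rightarrow> nat" where
  "m_max \<phi> = Max (m_at \<phi> ` Omega \<phi>)"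

(* The set of the points \<xi>_1, ..., \<xi>_R. The index q is replaced by the point \<xi>_q itself, so
   \<alpha>_q and \<beta>_q are the values of alpha_at and beta_at at that point. *)
definition max_points :: "(int \<Rightarrow> complex) \<Rightarrow> real set" where
  "max_points \<phi> = {\<xi>\<in>Omega \<phi>. m_at \<phi> \<xi> = m_max \<phi>}"

(* The improper integral over the real line: the limit of integrals over compact intervals
   [a, b] with the two end points tending to -\<infinity> and \<infinity> independently. It need not converge
   absolutely when Re \<beta> = 0. *)
definition H :: "nat \<Rightarrow> complex \<Rightarrow> real \<Rightarrow> complex" where
  "H m \<beta> x = 1 / (2 * of_real pi) *
     Lim (at_bot \<times>\<^sub>F at_top)
       (\<lambda>(a, b). integral {a..b}
          (\<lambda>u. exp (- \<i> * of_real x * of_real u) * exp (- \<beta> * of_real u ^ m)))"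

end

theory Submission
  imports Defs "HOL-Complex_Analysis.Complex_Analysis"
begin

text \<open>
  Write F for the Fourier transform of \<phi>. Orthogonality of the characters gives
  2 \<pi> \<phi>^(n)(x) = \<integral> F(\<xi>)^n e^(-ix\<xi>) d\<xi> over any interval of length 2 \<pi>
  (conv_power_integral). Since |F| \<le> 1, and |F| = 1 only at the finitely many points of \<Omega>,
  everything outside small intervals around \<Omega> is exponentially small (conv_power_peaks). It
  remains to study one such interval.
  
  Around \<xi>0 \<in> \<Omega> the symbol is F(\<xi>0) exp(i \<alpha> t + t^m h(t)) with h holomorphic and
  h(0) = -\<beta> (expansion_exists). Here m is finite because otherwise |F| would be 1 on an interval,
  which a trigonometric polynomial with at least two frequencies cannot satisfy. With \<nu> = n^(1/m)
  the contribution of the interval is, up to a factor of modulus one, the integral of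
  exp((\<nu> t)^m h(t) + i s t) with s = \<alpha> n - x. On the scale t = u / \<nu> the integrand converges to
  exp(-\<beta> u^m + i (s / \<nu>) u), uniformly for bounded u, and this is the integrand of H. All that is
  needed is that the parts |u| \<ge> A of both integrals are small, uniformly in n and in s, when A is
  large. If Re \<beta> > 0 the integrand itself decays. If Re \<beta> = 0 there is only oscillation, and
  the estimate must not see the arbitrary linear term i s t; van der Corput's second derivative test
  is insensitive to it and gives the rate A^(-(m-2)/2) (two_sided_tail). This tends to 0 exactly when
  m > 2, which is where the dichotomy in the hypothesis of the theorem comes from. With A = 1 the
  same bound shows that a point of \<Omega> with smaller m contributes only O(n^(-1/m)), which is
  negligible against the points with maximal m (local_asymptotics, peak_asymptotics).
  
  For the place of the maximum, H(y) \<rightarrow> 0 as |y| \<rightarrow> \<infinity> (H_decay), so the asymptotic formula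
  makes \<phi>^(n)(x) much smaller than n^(-1/m) as soon as x is far from all \<alpha>_q n on the scale
  n^(1/m). On the other hand the supremum is at least a constant times n^(-1/m): several main terms
  may interfere at a given x, but averaging against e^(ix\<xi>0) with Fejer weights over a window of
  length comparable to n^(1/m) isolates a single one of them (conv_power_lower_bound). Hence the
  maximum is eventually attained near some \<alpha>_q n, and the finitely many remaining n only enlarge
  the compact set.
\<close>

section \<open>Van der Corput estimates for complex phases\<close>

text \<open>
  Integration by parts: exp \<psi> is the derivative of exp \<psi> / \<psi>' plus exp \<psi> \<psi>'' / \<psi>'^2, and the
  latter is dominated by the derivative of -2 / Im \<psi>'. The damping Re \<psi> stays inside the complex
  phase; the domination of Re \<psi>'' by Im \<psi>'' takes the place of a bound on the variation of the
  amplitude exp (Re \<psi>).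
\<close>

lemma van_der_corput_first:
  fixes \<psi> \<psi>' \<psi>'' :: "real \<Rightarrow> complex"
  assumes ab: "a \<le> b"
    and d1: "\<And>t. t \<in> {a..b} \<Longrightarrow> (\<psi> has_vector_derivative \<psi>' t) (at t)"
    and d2: "\<And>t. t \<in> {a..b} \<Longrightarrow> (\<psi>' has_vector_derivative \<psi>'' t) (at t)"
    and Re: "\<And>t. t \<in> {a..b} \<Longrightarrow> Re (\<psi> t) \<le> 0"
    and dom: "\<And>t. t \<in> {a..b} \<Longrightarrow> \<bar>Re (\<psi>'' t)\<bar> \<le> Im (\<psi>'' t)"
    and "\<kappa> > 0" and lam: "\<And>t. t \<in> {a..b} \<Longrightarrow> \<kappa> \<le> Im (\<psi>' t)"
  shows "cmod (integral {a..b} (\<lambda>t. exp (\<psi> t))) \<le> 4 / \<kappa>"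
proof -
  have nz: "\<psi>' t \<noteq> 0" "Im (\<psi>' t) > 0" if "t \<in> {a..b}" for t
    using lam[OF that] \<open>\<kappa> > 0\<close> by auto
  define R where "R = (\<lambda>t. exp (\<psi> t) * \<psi>'' t / (\<psi>' t)\<^sup>2)"
  have "((\<lambda>t. exp (\<psi> t) / \<psi>' t) has_vector_derivative (exp (\<psi> t) - R t)) (at t within {a..b})"
    if t: "t \<in> {a..b}" for t
  proof -
    have e: "((\<lambda>t. exp (\<psi> t)) has_vector_derivative (\<psi>' t * exp (\<psi> t))) (at t within {a..b})"
      using field_vector_diff_chain_within[OF has_vector_derivative_at_within[OF d1[OF t]]
          has_field_derivative_at_within[OF DERIV_exp]]
      by (simp add: o_def)
    have i: "((\<lambda>t. inverse (\<psi>' t)) has_vector_derivative (\<psi>'' t * (- inverse (\<psi>' t ^ 2)))) (at t within {a..b})"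
      using field_vector_diff_chain_within[OF has_vector_derivative_at_within[OF d2[OF t]]
          has_field_derivative_at_within[OF DERIV_inverse[OF nz(1)[OF t]]]]
      by (simp add: o_def numeral_2_eq_2)
    show ?thesis
      using has_vector_derivative_mult[OF e i] nz[OF t]
      by (simp add: R_def field_simps power2_eq_square)
  qed
  from fundamental_theorem_of_calculus[OF ab this]
  have ftc: "((\<lambda>t. exp (\<psi> t) - R t) has_integral (exp (\<psi> b) / \<psi>' b - exp (\<psi> a) / \<psi>' a)) {a..b}"
    by simp
  have "continuous_on {a..b} \<psi>"
    by (blast intro: continuous_at_imp_continuous_on has_vector_derivative_continuous d1)
  then have "continuous_on {a..b} (\<lambda>t. exp (\<psi> t))" by (intro continuous_intros)
  then have ie: "(\<lambda>t. exp (\<psi> t)) integrable_on {a..b}" by (rule integrable_continuous_real)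
  have iR: "R integrable_on {a..b}"
    using integrable_diff[OF ie has_integral_integrable[OF ftc]] by simp
  \<comment> \<open>An explicit antiderivative of a majorant of the error term R.\<close>
  have "((\<lambda>t. - 2 / Im (\<psi>' t)) has_vector_derivative (2 * Im (\<psi>'' t) / (Im (\<psi>' t))\<^sup>2)) (at t within {a..b})"
    if t: "t \<in> {a..b}" for t
  proof -
    have "((\<lambda>t. Im (\<psi>' t)) has_vector_derivative (Im (\<psi>'' t))) (at t within {a..b})"
      by (rule bounded_linear.has_vector_derivative[OF bounded_linear_Im has_vector_derivative_at_within[OF d2[OF t]]])
    then have "((\<lambda>t. Im (\<psi>' t)) has_field_derivative (Im (\<psi>'' t))) (at t within {a..b})"
      by (simp add: has_real_derivative_iff_has_vector_derivative)
    from DERIV_cmult[OF DERIV_inverse'[OF this], of "- 2"]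
    have "((\<lambda>t. - 2 / Im (\<psi>' t)) has_field_derivative (2 * Im (\<psi>'' t) / (Im (\<psi>' t))\<^sup>2)) (at t within {a..b})"
      using nz(2)[OF t] by (simp add: power2_eq_square divide_inverse mult_ac)
    then show ?thesis by (simp add: has_real_derivative_iff_has_vector_derivative)
  qed
  from fundamental_theorem_of_calculus[OF ab this]
  have g: "((\<lambda>t. 2 * Im (\<psi>'' t) / (Im (\<psi>' t))\<^sup>2) has_integral (2 / Im (\<psi>' a) - 2 / Im (\<psi>' b))) {a..b}"
    by simp
  have "cmod (R t) \<le> 2 * Im (\<psi>'' t) / (Im (\<psi>' t))\<^sup>2" if t: "t \<in> {a..b}" for t
  proof -
    have "cmod (\<psi>'' t) \<le> 2 * Im (\<psi>'' t)" using cmod_le[of "\<psi>'' t"] dom[OF t] by auto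
    moreover have "(Im (\<psi>' t))\<^sup>2 \<le> (cmod (\<psi>' t))\<^sup>2"
      using abs_Im_le_cmod[of "\<psi>' t"] by (metis abs_ge_zero power2_abs power_mono)
    moreover have "cmod (exp (\<psi> t)) \<le> 1" using Re[OF t] by simp
    moreover have "Im (\<psi>'' t) \<ge> 0" using dom[OF t] by linarith
    ultimately show ?thesis unfolding R_def using nz[OF t]
      by (auto simp: norm_mult norm_divide norm_power intro!: frac_le mult_le_one
           order_trans[OF mult_right_mono[of "exp (Re (\<psi> t))" 1]])
  qed
  then have "cmod (integral {a..b} R) \<le> 2 / Im (\<psi>' a) - 2 / Im (\<psi>' b)"
    using integral_norm_bound_integral[OF iR has_integral_integrable[OF g]] integral_unique[OF g] by simp
  moreover have "2 / Im (\<psi>' a) \<le> 2 / \<kappa>" using lam[of a] ab \<open>\<kappa> > 0\<close> by (intro frac_le) auto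
  moreover have "2 / Im (\<psi>' b) \<ge> 0" using nz(2)[of b] ab by auto
  ultimately have 1: "cmod (integral {a..b} R) \<le> 2 / \<kappa>" by linarith
  have bd: "cmod (exp (\<psi> t) / \<psi>' t) \<le> 1 / \<kappa>" if t: "t \<in> {a..b}" for t
    using Re[OF t] lam[OF t] abs_Im_le_cmod[of "\<psi>' t"] \<open>\<kappa> > 0\<close>
    by (auto simp: norm_divide intro!: frac_le)
  have "integral {a..b} (\<lambda>t. exp (\<psi> t)) = (exp (\<psi> b) / \<psi>' b - exp (\<psi> a) / \<psi>' a) + integral {a..b} R"
    using integral_unique[OF has_integral_add[OF ftc integrable_integral[OF iR]]] by simp
  also have "cmod \<dots> \<le> (1 / \<kappa> + 1 / \<kappa>) + 2 / \<kappa>"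
    using bd[of a] bd[of b] ab 1 by (intro norm_triangle_mono) (auto intro: order_trans[OF norm_triangle_ineq4])
  finally show ?thesis by simp
qed

text \<open>
  From a on, Im \<psi>' grows at least with slope \<mu>. The first interval of length 1 / sqrt \<mu> is estimated
  trivially; beyond it Im \<psi>' \<ge> sqrt \<mu>, so the first derivative test applies.
\<close>

lemma van_der_corput_second_half:
  fixes \<psi> \<psi>' \<psi>'' :: "real \<Rightarrow> complex"
  assumes ab: "a \<le> b"
    and d1: "\<And>t. t \<in> {a..b} \<Longrightarrow> (\<psi> has_vector_derivative \<psi>' t) (at t)"
    and d2: "\<And>t. t \<in> {a..b} \<Longrightarrow> (\<psi>' has_vector_derivative \<psi>'' t) (at t)"
    and Re: "\<And>t. t \<in> {a..b} \<Longrightarrow> Re (\<psi> t) \<le> 0"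
    and dom: "\<And>t. t \<in> {a..b} \<Longrightarrow> \<bar>Re (\<psi>'' t)\<bar> \<le> Im (\<psi>'' t)"
    and "\<mu> > 0" and mu: "\<And>t. t \<in> {a..b} \<Longrightarrow> \<mu> \<le> Im (\<psi>'' t)"
    and a0: "Im (\<psi>' a) \<ge> 0"
  shows "cmod (integral {a..b} (\<lambda>t. exp (\<psi> t))) \<le> 5 / sqrt \<mu>"
proof -
  define d where "d = 1 / sqrt \<mu>"
  have "d > 0" using \<open>\<mu> > 0\<close> by (simp add: d_def)
  have cont: "continuous_on {a..b} \<psi>"
    by (blast intro: continuous_at_imp_continuous_on has_vector_derivative_continuous d1)
  then have "continuous_on {a..b} (\<lambda>t. exp (\<psi> t))" by (intro continuous_intros)
  then have ie: "(\<lambda>t. exp (\<psi> t)) integrable_on {a..b}" by (rule integrable_continuous_real)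
  have short: "cmod (integral {a..c} (\<lambda>t. exp (\<psi> t))) \<le> d" if "a \<le> c" "c \<le> b" "c \<le> a + d" for c
  proof -
    have "(\<lambda>t. exp (\<psi> t)) integrable_on {a..c}"
      using ie by (rule integrable_on_subinterval) (use that in auto)
    then have "cmod (integral {a..c} (\<lambda>t. exp (\<psi> t))) \<le> integral {a..c} (\<lambda>t. 1)"
      using Re that by (intro integral_norm_bound_integral) auto
    then show ?thesis using that by simp
  qed
  show ?thesis
  proof (cases "a + d \<le> b")
    case False
    then show ?thesis using short[of b] ab \<open>d > 0\<close> \<open>\<mu> > 0\<close>
      by (auto simp: d_def intro: order_trans divide_right_mono)
  next
    case True
    have lam: "sqrt \<mu> \<le> Im (\<psi>' t)" if t: "t \<in> {a+d..b}" for t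
    proof -
      have ta: "a < t" using t \<open>d > 0\<close> by auto
      have "((\<lambda>t. Im (\<psi>' t)) has_field_derivative (Im (\<psi>'' u))) (at u)" if "u \<in> {a..b}" for u
        using bounded_linear.has_vector_derivative[OF bounded_linear_Im d2[OF that]]
        by (simp add: has_real_derivative_iff_has_vector_derivative)
      then obtain z where z: "a < z" "z < t" "Im (\<psi>' t) - Im (\<psi>' a) = (t - a) * Im (\<psi>'' z)"
        using MVT2[OF ta, of "\<lambda>t. Im (\<psi>' t)" "\<lambda>t. Im (\<psi>'' t)"] t by auto
      have "sqrt \<mu> = d * \<mu>" using \<open>\<mu> > 0\<close> by (simp add: d_def real_div_sqrt)
      also have "\<dots> \<le> (t - a) * Im (\<psi>'' z)"
        using t z mu[of z] \<open>\<mu> > 0\<close> \<open>d > 0\<close> by (intro mult_mono) auto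
      finally show ?thesis using z a0 by simp
    qed
    have "cmod (integral {a+d..b} (\<lambda>t. exp (\<psi> t))) \<le> 4 / sqrt \<mu>"
      by (rule van_der_corput_first[where \<psi>'=\<psi>' and \<psi>''=\<psi>''])
        (use True \<open>d > 0\<close> d1 d2 Re dom lam \<open>\<mu> > 0\<close> in auto)
    moreover have "cmod (integral {a..a+d} (\<lambda>t. exp (\<psi> t))) \<le> 1 / sqrt \<mu>"
      using short[of "a+d"] True \<open>d > 0\<close> by (simp add: d_def)
    ultimately have "cmod (integral {a..a+d} (\<lambda>t. exp (\<psi> t)) + integral {a+d..b} (\<lambda>t. exp (\<psi> t)))
        \<le> 1 / sqrt \<mu> + 4 / sqrt \<mu>"
      by (intro norm_triangle_mono)
    moreover have "integral {a..a+d} (\<lambda>t. exp (\<psi> t)) + integral {a+d..b} (\<lambda>t. exp (\<psi> t)) =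
        integral {a..b} (\<lambda>t. exp (\<psi> t))"
      by (rule Henstock_Kurzweil_Integration.integral_combine[OF _ True ie]) (use \<open>d > 0\<close> in simp)
    ultimately show ?thesis by simp
  qed
qed

text \<open>
  The increasing function Im \<psi>' changes sign at most once. Right of the sign change the previous
  lemma applies, left of it its reflection t \<mapsto> -t.
\<close>

lemma van_der_corput_second_pos:
  fixes \<psi> \<psi>' \<psi>'' :: "real \<Rightarrow> complex"
  assumes ab: "a \<le> b"
    and d1: "\<And>t. t \<in> {a..b} \<Longrightarrow> (\<psi> has_vector_derivative \<psi>' t) (at t)"
    and d2: "\<And>t. t \<in> {a..b} \<Longrightarrow> (\<psi>' has_vector_derivative \<psi>'' t) (at t)"
    and Re: "\<And>t. t \<in> {a..b} \<Longrightarrow> Re (\<psi> t) \<le> 0"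
    and dom: "\<And>t. t \<in> {a..b} \<Longrightarrow> \<bar>Re (\<psi>'' t)\<bar> \<le> Im (\<psi>'' t)"
    and "\<mu> > 0" and mu: "\<And>t. t \<in> {a..b} \<Longrightarrow> \<mu> \<le> Im (\<psi>'' t)"
  shows "cmod (integral {a..b} (\<lambda>t. exp (\<psi> t))) \<le> 10 / sqrt \<mu>"
proof -
  have cont: "continuous_on {a..b} \<psi>" "continuous_on {a..b} \<psi>'"
    by (blast intro: continuous_at_imp_continuous_on has_vector_derivative_continuous d1 d2)+
  then have "continuous_on {a..b} (\<lambda>t. exp (\<psi> t))" by (intro continuous_intros)
  then have ie: "(\<lambda>t. exp (\<psi> t)) integrable_on {a..b}" by (rule integrable_continuous_real)
  have right: "cmod (integral {c..b} (\<lambda>t. exp (\<psi> t))) \<le> 5 / sqrt \<mu>"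
    if "a \<le> c" "c \<le> b" "Im (\<psi>' c) \<ge> 0" for c
    by (rule van_der_corput_second_half[where \<psi>'=\<psi>' and \<psi>''=\<psi>'']) (use assms that in auto)
  have left: "cmod (integral {a..c} (\<lambda>t. exp (\<psi> t))) \<le> 5 / sqrt \<mu>"
    if "a \<le> c" "c \<le> b" "Im (\<psi>' c) \<le> 0" for c
  proof -
    have u: "(uminus has_vector_derivative -1) (at t)" for t :: real
      by (auto intro!: derivative_eq_intros)
    have r1: "((\<lambda>t. \<psi> (- t)) has_vector_derivative (- \<psi>' (- t))) (at t)" if "t \<in> {-c..-a}" for t
      using vector_diff_chain_at[OF u d1[of "-t"]] that \<open>c \<le> b\<close> by (simp add: o_def)
    have r2: "((\<lambda>t. - \<psi>' (- t)) has_vector_derivative (\<psi>'' (- t))) (at t)" if "t \<in> {-c..-a}" for t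
      using has_vector_derivative_minus[OF vector_diff_chain_at[OF u d2[of "-t"]]] that \<open>c \<le> b\<close>
      by (simp add: o_def)
    have "cmod (integral {-c..-a} (\<lambda>t. exp (\<psi> (- t)))) \<le> 5 / sqrt \<mu>"
      by (rule van_der_corput_second_half[OF _ r1 r2]) (use assms that in auto)
    moreover have "integral {-c..-a} (\<lambda>t. exp (\<psi> (- t))) = integral {a..c} (\<lambda>t. exp (\<psi> t))"
      using Henstock_Kurzweil_Integration.integral_reflect_real[of c a "\<lambda>t. exp (\<psi> t)"] by simp
    ultimately show ?thesis by simp
  qed
  have p: "5 / sqrt \<mu> \<le> 10 / sqrt \<mu>" using \<open>\<mu> > 0\<close> by (simp add: divide_right_mono)
  consider "Im (\<psi>' a) \<ge> 0" | "Im (\<psi>' b) \<le> 0" | "Im (\<psi>' a) \<le> 0" "0 \<le> Im (\<psi>' b)" by linarith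
  then show ?thesis
  proof cases
    case 1 then show ?thesis using right[of a] ab p by force
  next
    case 2 then show ?thesis using left[of b] ab p by force
  next
    case 3
    have "continuous_on {a..b} (\<lambda>t. Im (\<psi>' t))" using cont(2) by (intro continuous_intros)
    from IVT'[OF 3 ab this] obtain c where c: "a \<le> c" "c \<le> b" "Im (\<psi>' c) = 0" by auto
    have "integral {a..b} (\<lambda>t. exp (\<psi> t)) =
      integral {a..c} (\<lambda>t. exp (\<psi> t)) + integral {c..b} (\<lambda>t. exp (\<psi> t))"
      using Henstock_Kurzweil_Integration.integral_combine[OF c(1,2) ie] by simp
    also have "cmod \<dots> \<le> 5 / sqrt \<mu> + 5 / sqrt \<mu>"
      using left[of c] right[of c] c by (intro norm_triangle_mono) auto
    finally show ?thesis by simp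
  qed
qed

text \<open>
  The bound depends only on the second derivative of the phase, so it is uniform over all
  perturbations of \<psi> by i s t with s real. The case \<sigma> = -1 follows by complex conjugation.
\<close>

lemma van_der_corput_second:
  fixes \<psi> \<psi>' \<psi>'' :: "real \<Rightarrow> complex"
  assumes ab: "a \<le> b"
    and d1: "\<And>t. t \<in> {a..b} \<Longrightarrow> (\<psi> has_vector_derivative \<psi>' t) (at t)"
    and d2: "\<And>t. t \<in> {a..b} \<Longrightarrow> (\<psi>' has_vector_derivative \<psi>'' t) (at t)"
    and Re: "\<And>t. t \<in> {a..b} \<Longrightarrow> Re (\<psi> t) \<le> 0"
    and sigma: "\<sigma> = 1 \<or> \<sigma> = -1"
    and dom: "\<And>t. t \<in> {a..b} \<Longrightarrow> \<bar>Re (\<psi>'' t)\<bar> \<le> \<sigma> * Im (\<psi>'' t)"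
    and "\<mu> > 0" and mu: "\<And>t. t \<in> {a..b} \<Longrightarrow> \<mu> \<le> \<sigma> * Im (\<psi>'' t)"
  shows "cmod (integral {a..b} (\<lambda>t. exp (\<psi> t))) \<le> 10 / sqrt \<mu>"
proof (cases "\<sigma> = 1")
  case True
  show ?thesis by (rule van_der_corput_second_pos[OF ab d1 d2]) (use assms True in auto)
next
  case False
  have "cmod (integral {a..b} (\<lambda>t. exp (cnj (\<psi> t)))) \<le> 10 / sqrt \<mu>"
    by (rule van_der_corput_second_pos[where \<psi>'="\<lambda>t. cnj (\<psi>' t)" and \<psi>''="\<lambda>t. cnj (\<psi>'' t)"])
      (use assms False in \<open>auto intro: has_vector_derivative_cnj\<close>)
  moreover have "integral {a..b} (\<lambda>t. exp (cnj (\<psi> t))) = cnj (integral {a..b} (\<lambda>t. exp (\<psi> t)))"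
    by (simp add: integral_cnj exp_cnj)
  ultimately show ?thesis by simp
qed

section \<open>Tails of the local integrals\<close>

text \<open>
  The decay in A of the part |u| \<ge> A of the integral of exp (-\<beta> u^m + i s u): damping if Re \<beta> > 0
  (1 / A is far from optimal but suffices), oscillation otherwise. For m = 2 and Re \<beta> = 0 the rate
  is constant.
\<close>

definition tail_rate :: "nat \<Rightarrow> complex \<Rightarrow> real \<Rightarrow> real" where
  "tail_rate m \<beta> A = (if Re \<beta> > 0 then 1 / A else 1 / sqrt (A ^ (m - 2)))"

lemma tail_rate_pos: "A > 0 \<Longrightarrow> tail_rate m \<beta> A > 0"
  by (simp add: tail_rate_def)

lemma tail_rate_one: "tail_rate m \<beta> 1 = 1"
  by (simp add: tail_rate_def)

lemma tail_rate_tendsto_0: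
  assumes "m > 2 \<or> Re \<beta> > 0"
  shows "(tail_rate m \<beta> \<longlongrightarrow> 0) at_top"
proof (cases "Re \<beta> > 0")
  case True
  have "((\<lambda>A::real. 1 / A) \<longlongrightarrow> 0) at_top" by real_asymp
  then show ?thesis using True by (simp add: tail_rate_def[abs_def])
next
  case False
  then have "0 < m - 2" using assms by auto
  then have "filterlim (\<lambda>A::real. A ^ (m - 2)) at_top at_top"
    by (intro filterlim_pow_at_top filterlim_ident)
  then have "filterlim (\<lambda>A::real. sqrt (A ^ (m - 2))) at_top at_top"
    by (rule filterlim_compose[OF sqrt_at_top])
  then have "((\<lambda>A::real. inverse (sqrt (A ^ (m - 2)))) \<longlongrightarrow> 0) at_top"
    by (rule filterlim_compose[OF tendsto_inverse_0_at_top filterlim_ident, of "\<lambda>_. _", simplified]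
        tendsto_inverse_0_at_top)
  then show ?thesis using False by (simp add: tail_rate_def[abs_def] divide_inverse)
qed

text \<open>
  The local data at a point where |F| = 1: after removal of the constant and the linear term, the
  logarithm of the symbol is t^m h(t) with h(0) = -\<beta>, and |F| \<le> 1 says that its real part is
  nonpositive on the real axis. The constraints on Re \<beta> are consequences.
\<close>

locale boundary_phase =
  fixes m :: nat and \<beta> :: complex and h :: "complex \<Rightarrow> complex" and r :: real
  assumes m_ge_2: "2 \<le> m" and beta_nonzero: "\<beta> \<noteq> 0" and r_pos: "0 < r"
    and holo: "h holomorphic_on ball 0 r" and h_0: "h 0 = - \<beta>"
    and Re_nonpos: "\<And>t. \<bar>t\<bar> < r \<Longrightarrow> Re (of_real t ^ m * h (of_real t)) \<le> 0"
begin

text \<open>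
  Parametrised by \<nu> = n^(1/m) instead of n, so that n t^m = (\<nu> t)^m and u = \<nu> t is the natural
  variable.
\<close>

definition phase :: "real \<Rightarrow> real \<Rightarrow> complex \<Rightarrow> complex" where
  "phase \<nu> s z = (of_real \<nu> * z) ^ m * h z + \<i> * of_real s * z"

lemma isCont_h_0: "isCont h 0"
  using holo r_pos by (metis centre_in_ball continuous_on_interior holomorphic_on_imp_continuous_on interior_ball)

lemma Re_h_nonpos: "0 < t \<Longrightarrow> t < r \<Longrightarrow> Re (h (of_real t)) \<le> 0"
  using Re_nonpos[of t] zero_less_power[of t m]
  by (simp flip: of_real_power add: mult_le_0_iff del: zero_less_power zero_le_power)

lemma Re_phase_nonpos:
  assumes "\<bar>t\<bar> < r" "0 \<le> \<nu>" shows "Re (phase \<nu> s (of_real t)) \<le> 0"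
proof -
  have "Re (phase \<nu> s (of_real t)) = \<nu> ^ m * Re (of_real t ^ m * h (of_real t))"
    by (simp add: phase_def power_mult_distrib mult.assoc flip: of_real_power)
  then show ?thesis using Re_nonpos[OF assms(1)] assms(2) by (simp add: mult_nonneg_nonpos)
qed

lemma tendsto_h_0: "((\<lambda>t. h (of_real t)) \<longlongrightarrow> - \<beta>) (at (0::real) within S)"
proof -
  have "isCont (\<lambda>t::real. h (of_real t)) 0"
    by (rule continuous_within_compose3[where g=h and f=of_real, simplified]) (use isCont_h_0 in auto)
  then show ?thesis using h_0 by (auto simp: isCont_def intro: tendsto_within_subset)
qed

lemma Re_beta_nonneg: "0 \<le> Re \<beta>"
proof -
  have "((\<lambda>t. Re (h (of_real t))) \<longlongrightarrow> Re (- \<beta>)) (at_right (0::real))"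
    by (intro tendsto_intros tendsto_h_0)
  moreover have "\<forall>\<^sub>F t in at_right (0::real). Re (h (of_real t)) \<le> 0"
    using eventually_at_right_less r_pos Re_h_nonpos
    by (auto simp: eventually_at_right_field intro!: exI[of _ r])
  ultimately show ?thesis by (auto dest: tendsto_upperbound)
qed

lemma Re_beta_odd: "odd m \<Longrightarrow> Re \<beta> = 0"
proof -
  assume "odd m"
  have "((\<lambda>t. Re (h (of_real t))) \<longlongrightarrow> Re (- \<beta>)) (at_left (0::real))"
    by (intro tendsto_intros tendsto_h_0)
  moreover have "Re (h (of_real t)) \<ge> 0" if "- r < t" "t < 0" for t
  proof -
    have "t ^ m < 0" using that \<open>odd m\<close> m_ge_2 by (simp add: power_less_zero_eq)
    moreover have "t ^ m * Re (h (of_real t)) \<le> 0"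
      using Re_nonpos[of t] that by (simp flip: of_real_power)
    ultimately show ?thesis by (meson mult_neg_neg not_le)
  qed
  then have "\<forall>\<^sub>F t in at_left (0::real). Re (h (of_real t)) \<ge> 0"
    using r_pos by (auto simp: eventually_at_left_field intro!: exI[of _ "-r"])
  ultimately have "0 \<le> Re (- \<beta>)" by (auto dest: tendsto_lowerbound)
  with Re_beta_nonneg show "Re \<beta> = 0" by simp
qed

text \<open>
  The substitution t \<mapsto> -t stays inside the class of boundary phases, so that estimates are needed
  only for positive t.
\<close>

lemma reflect: "boundary_phase m ((-1) ^ m * \<beta>) (\<lambda>z. (-1) ^ m * h (- z)) r"
proof
  have "h \<circ> uminus holomorphic_on ball 0 r"
    by (rule holomorphic_on_compose_gen[OF _ holo]) (auto intro: holomorphic_intros)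
  then show "(\<lambda>z. (-1) ^ m * h (- z)) holomorphic_on ball 0 r"
    by (intro holomorphic_intros) (simp add: o_def)
  show "Re (of_real t ^ m * ((-1) ^ m * h (- of_real t))) \<le> 0" if "\<bar>t\<bar> < r" for t
    using Re_nonpos[of "-t"] that by (simp add: power_minus[of "of_real t"] mult_ac)
qed (use m_ge_2 beta_nonzero r_pos h_0 in auto)

lemma Re_beta_reflect: "Re ((-1) ^ m * \<beta>) = Re \<beta>"
  using Re_beta_odd by (cases "even m") auto

lemma phase_reflect:
  "boundary_phase.phase m (\<lambda>z. (-1) ^ m * h (- z)) \<nu> s z = phase \<nu> (- s) (- z)"
  unfolding phase_def boundary_phase.phase_def[OF reflect]
  by (simp add: power_mult_distrib power_minus[of "of_real \<nu> * z"])

text \<open>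
  The second derivative of the phase factors as \<nu>^m z^(m-2) times a function that does not depend on
  \<nu> and s, named curvature below. Its value at 0 is -m (m-1) \<beta>.
\<close>

definition phase' :: "real \<Rightarrow> real \<Rightarrow> complex \<Rightarrow> complex" where
  "phase' \<nu> s z = of_real \<nu> ^ m * (of_nat m * z ^ (m - 1) * h z + z ^ m * deriv h z) + \<i> * of_real s"

definition curvature :: "complex \<Rightarrow> complex" where
  "curvature z = of_nat (m * (m - 1)) * h z + 2 * of_nat m * z * deriv h z + z ^ 2 * deriv (deriv h) z"

lemma phase_deriv:
  assumes "z \<in> ball 0 r"
  shows "(phase \<nu> s has_field_derivative phase' \<nu> s z) (at z)"
    and "(phase' \<nu> s has_field_derivative (of_real \<nu> ^ m * z ^ (m - 2) * curvature z)) (at z)"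
proof -
  have [derivative_intros]: "(h has_field_derivative deriv h z) (at z)"
    by (rule holomorphic_derivI[OF holo open_ball assms])
  have "deriv h holomorphic_on ball 0 r" using holo by (intro holomorphic_deriv) auto
  then have [derivative_intros]: "(deriv h has_field_derivative deriv (deriv h) z) (at z)"
    by (rule holomorphic_derivI[OF _ open_ball assms])
  obtain j where m: "m = Suc (Suc j)" using m_ge_2 by (metis add_2_eq_Suc le_Suc_ex)
  show "(phase \<nu> s has_field_derivative phase' \<nu> s z) (at z)"
    unfolding phase_def[abs_def] phase'_def power_mult_distrib
    by (rule derivative_eq_intros refl)+ (simp add: m algebra_simps)
  show "(phase' \<nu> s has_field_derivative (of_real \<nu> ^ m * z ^ (m - 2) * curvature z)) (at z)"
    unfolding phase'_def[abs_def] curvature_def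
    by (rule derivative_eq_intros refl)+ (simp add: m algebra_simps power2_eq_square)
qed

lemma isCont_curvature: "isCont curvature 0"
proof -
  have 1: "deriv h holomorphic_on ball 0 r" by (rule holomorphic_deriv[OF holo open_ball])
  have 2: "deriv (deriv h) holomorphic_on ball 0 r" by (rule holomorphic_deriv[OF 1 open_ball])
  have "isCont f 0" if "f holomorphic_on ball 0 r" for f
    using that r_pos by (metis centre_in_ball continuous_on_interior holomorphic_on_imp_continuous_on interior_ball)
  with 1 2 have "isCont (deriv h) 0" "isCont (deriv (deriv h)) 0" by auto
  then show ?thesis unfolding curvature_def[abs_def] by (intro continuous_intros isCont_h_0)
qed

lemma continuous_on_phase:
  assumes "\<And>t. t \<in> S \<Longrightarrow> \<bar>t\<bar> < r"
  shows "continuous_on S (\<lambda>t. exp (phase \<nu> s (of_real t)))"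
proof -
  have "continuous_on S (\<lambda>t. h (of_real t))"
    by (rule continuous_on_compose2[OF holomorphic_on_imp_continuous_on[OF holo]])
      (use assms in \<open>auto intro: continuous_intros\<close>)
  then show ?thesis unfolding phase_def by (intro continuous_intros)
qed

text \<open>
  Near 0 the integrand is at most exp (-c (\<nu> t)^m), hence at most 1 / (c (\<nu> t)^2) where \<nu> t \<ge> 1.
\<close>

lemma right_tail_damped:
  assumes "Re \<beta> > 0"
  obtains \<delta> C where "0 < \<delta>" "\<delta> < r" "0 < C"
    "\<And>\<nu> A b s. 0 < \<nu> \<Longrightarrow> 1 \<le> A \<Longrightarrow> A / \<nu> \<le> b \<Longrightarrow> b \<le> \<delta> \<Longrightarrow>
       cmod (integral {A / \<nu>..b} (\<lambda>t. exp (phase \<nu> s (of_real t)))) \<le> C / A / \<nu>"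
proof -
  define c where "c = Re \<beta> / 2"
  have c: "c > 0" using assms by (simp add: c_def)
  obtain \<delta>0 where \<delta>0: "\<delta>0 > 0" "\<And>z. cmod z < \<delta>0 \<Longrightarrow> cmod (h z - h 0) < c"
    using isCont_h_0 c by (auto simp: continuous_at_eps_delta dist_norm)
  define \<delta> where "\<delta> = min (\<delta>0 / 2) (r / 2)"
  have \<delta>: "0 < \<delta>" "\<delta> < r" "\<delta> < \<delta>0" using \<delta>0 r_pos by (auto simp: \<delta>_def)
  have Re_h: "Re (h (of_real t)) \<le> - c" if "\<bar>t\<bar> \<le> \<delta>" for t
  proof -
    have "cmod (h (of_real t) - h 0) < c" using \<delta>0(2)[of "of_real t"] that \<delta> by simp
    then have "\<bar>Re (h (of_real t) - h 0)\<bar> < c" using abs_Re_le_cmod order_le_less_trans by blast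
    then show ?thesis by (simp add: h_0 c_def abs_if split: if_splits)
  qed
  have "cmod (integral {A / \<nu>..b} (\<lambda>t. exp (phase \<nu> s (of_real t)))) \<le> 1 / c / A / \<nu>"
    if \<nu>: "0 < \<nu>" and A: "1 \<le> A" and b: "A / \<nu> \<le> b" "b \<le> \<delta>" for \<nu> A b s
  proof -
    have pos: "A / \<nu> > 0" using A \<nu> by simp
    have ptw: "cmod (exp (phase \<nu> s (of_real t))) \<le> 1 / (c * \<nu>\<^sup>2) * (1 / t\<^sup>2)" if t: "t \<in> {A / \<nu>..b}" for t
    proof -
      have t0: "t > 0" using t pos by auto
      have x: "1 \<le> \<nu> * t" using t A \<nu> by (auto simp: field_simps)
      have "(\<nu> * t)\<^sup>2 \<le> (\<nu> * t) ^ m" using x m_ge_2 by (intro power_increasing)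
      then have "c * (\<nu> * t)\<^sup>2 \<le> c * (\<nu> * t) ^ m" using c by simp
      also have "\<dots> \<le> - Re (phase \<nu> s (of_real t))"
        using mult_left_mono[OF Re_h[of t], of "(\<nu> * t) ^ m"] t t0 b x
        by (simp add: phase_def mult_ac flip: of_real_power of_real_mult)
      finally have *: "c * (\<nu> * t)\<^sup>2 \<le> - Re (phase \<nu> s (of_real t))" .
      have p: "0 < c * (\<nu> * t)\<^sup>2" using c \<nu> t0 by simp
      have "c * (\<nu> * t)\<^sup>2 \<le> exp (c * (\<nu> * t)\<^sup>2)" using exp_ge_add_one_self[of "c * (\<nu> * t)\<^sup>2"] by linarith
      then have "exp (- (c * (\<nu> * t)\<^sup>2)) \<le> 1 / (c * (\<nu> * t)\<^sup>2)"
        using le_imp_inverse_le[OF _ p] by (simp only: exp_minus inverse_eq_divide)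
      moreover have "exp (Re (phase \<nu> s (of_real t))) \<le> exp (- (c * (\<nu> * t)\<^sup>2))" using * by simp
      ultimately have "exp (Re (phase \<nu> s (of_real t))) \<le> 1 / (c * (\<nu> * t)\<^sup>2)"
        by (rule order_trans[rotated])
      then show ?thesis by (simp add: power_mult_distrib mult.assoc)
    qed
    have "((\<lambda>t. - 1 / t) has_vector_derivative (1 / t\<^sup>2)) (at t within {A / \<nu>..b})" if "t \<in> {A / \<nu>..b}" for t
      using that pos unfolding has_real_derivative_iff_has_vector_derivative[symmetric]
      by (auto intro!: derivative_eq_intros simp: power2_eq_square)
    from fundamental_theorem_of_calculus[OF b(1) this]
    have i: "((\<lambda>t. 1 / t\<^sup>2) has_integral (\<nu> / A - 1 / b)) {A / \<nu>..b}" by simp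
    then have i: "((\<lambda>t. 1 / (c * \<nu>\<^sup>2) * (1 / t\<^sup>2)) has_integral (1 / (c * \<nu>\<^sup>2) * (\<nu> / A - 1 / b))) {A / \<nu>..b}"
      by (rule has_integral_mult_right)
    have "(\<lambda>t. exp (phase \<nu> s (of_real t))) integrable_on {A / \<nu>..b}"
      by (intro integrable_continuous_real continuous_on_phase) (use pos b \<delta> in auto)
    then have "cmod (integral {A / \<nu>..b} (\<lambda>t. exp (phase \<nu> s (of_real t)))) \<le> 1 / (c * \<nu>\<^sup>2) * (\<nu> / A - 1 / b)"
      using integral_norm_bound_integral[OF _ has_integral_integrable[OF i] ptw] integral_unique[OF i] by simp
    also have "\<dots> \<le> 1 / (c * \<nu>\<^sup>2) * (\<nu> / A)"
      using pos b c by (intro mult_left_mono) auto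
    also have "\<dots> = 1 / c / A / \<nu>" using \<nu> by (simp add: power2_eq_square)
    finally show ?thesis .
  qed
  then show ?thesis using that[of \<delta> "1 / c"] \<delta> c by simp
qed

text \<open>
  For purely imaginary \<beta> the curvature is close to the nonzero imaginary number -m (m-1) \<beta> near 0,
  so its imaginary part keeps its sign and dominates the real part. On t \<ge> A / \<nu> the second
  derivative of the phase is therefore at least of order \<nu>^m (A / \<nu>)^(m-2) = \<nu>^2 A^(m-2).
\<close>

lemma right_tail_oscillating:
  assumes "Re \<beta> = 0"
  obtains \<delta> C where "0 < \<delta>" "\<delta> < r" "0 < C"
    "\<And>\<nu> A b s. 0 < \<nu> \<Longrightarrow> 1 \<le> A \<Longrightarrow> A / \<nu> \<le> b \<Longrightarrow> b \<le> \<delta> \<Longrightarrow>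
       cmod (integral {A / \<nu>..b} (\<lambda>t. exp (phase \<nu> s (of_real t)))) \<le> C / sqrt (A ^ (m - 2)) / \<nu>"
proof -
  define M where "M = real (m * (m - 1))"
  have M: "M > 0" using m_ge_2 by (simp add: M_def)
  define \<sigma> where "\<sigma> = - sgn (Im \<beta>)"
  have Im0: "Im \<beta> \<noteq> 0" using beta_nonzero assms by (auto simp: complex_eq_iff)
  have \<sigma>: "\<sigma> = 1 \<or> \<sigma> = -1" using Im0 by (auto simp: \<sigma>_def sgn_if)
  define c where "c = M * \<bar>Im \<beta>\<bar> / 2"
  have c: "c > 0" using M Im0 by (simp add: c_def)
  obtain \<delta>0 where \<delta>0: "\<delta>0 > 0" "\<And>z. cmod z < \<delta>0 \<Longrightarrow> cmod (curvature z - curvature 0) < c"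
    using isCont_curvature c by (auto simp: continuous_at_eps_delta dist_norm)
  define \<delta> where "\<delta> = min (\<delta>0 / 2) (r / 2)"
  have \<delta>: "0 < \<delta>" "\<delta> < r" "\<delta> < \<delta>0" using \<delta>0 r_pos by (auto simp: \<delta>_def)
  have curv0: "curvature 0 = of_real M * (- \<beta>)" by (simp add: curvature_def M_def h_0)
  have curv: "\<bar>Re (curvature (of_real t))\<bar> \<le> \<sigma> * Im (curvature (of_real t))"
    "c \<le> \<sigma> * Im (curvature (of_real t))" if "\<bar>t\<bar> \<le> \<delta>" for t
  proof -
    have *: "cmod (curvature (of_real t) - curvature 0) < c" using \<delta>0(2)[of "of_real t"] that \<delta> by simp
    have "\<bar>Re (curvature (of_real t) - curvature 0)\<bar> < c"
      using * abs_Re_le_cmod order_le_less_trans by blast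
    moreover have "\<bar>Im (curvature (of_real t) - curvature 0)\<bar> < c"
      using * abs_Im_le_cmod order_le_less_trans by blast
    then have "\<bar>\<sigma> * (Im (curvature (of_real t)) - Im (curvature 0))\<bar> < c"
      using \<sigma> by (auto simp: abs_mult)
    moreover have "\<sigma> * Im (curvature 0) = 2 * c"
      using Im0 by (auto simp: curv0 c_def \<sigma>_def sgn_if)
    moreover have "Re (curvature 0) = 0" using assms by (simp add: curv0)
    ultimately show "\<bar>Re (curvature (of_real t))\<bar> \<le> \<sigma> * Im (curvature (of_real t))"
      "c \<le> \<sigma> * Im (curvature (of_real t))"
      by (simp_all add: right_diff_distrib abs_less_iff abs_le_iff)
  qed
  have "cmod (integral {A / \<nu>..b} (\<lambda>t. exp (phase \<nu> s (of_real t)))) \<le> 10 / sqrt c / sqrt (A ^ (m - 2)) / \<nu>"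
    if \<nu>: "0 < \<nu>" and A: "1 \<le> A" and b: "A / \<nu> \<le> b" "b \<le> \<delta>" for \<nu> A b s
  proof -
    have pos: "A / \<nu> > 0" using A \<nu> by simp
    define \<mu> where "\<mu> = \<nu> ^ m * (A / \<nu>) ^ (m - 2) * c"
    have "\<nu> ^ m = \<nu> ^ (m - 2) * \<nu>\<^sup>2" using m_ge_2
      by (metis le_add_diff_inverse2 power_add)
    then have \<mu>_eq: "\<mu> = \<nu>\<^sup>2 * A ^ (m - 2) * c" using \<nu> by (simp add: \<mu>_def power_divide)
    have fac: "of_real \<nu> ^ m * of_real t ^ (m - 2) * curvature (of_real t) = of_real (\<nu> ^ m * t ^ (m - 2)) * curvature (of_real t)" for t
      by simp
    have "cmod (integral {A / \<nu>..b} (\<lambda>t. exp (phase \<nu> s (of_real t)))) \<le> 10 / sqrt \<mu>"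
    proof (rule van_der_corput_second[OF b(1), where \<sigma>=\<sigma>])
      fix t assume t: "t \<in> {A / \<nu>..b}"
      then have t': "0 < t" "\<bar>t\<bar> \<le> \<delta>" "of_real t \<in> ball (0::complex) r" using pos b \<delta> by auto
      show "((\<lambda>t. phase \<nu> s (of_real t)) has_vector_derivative phase' \<nu> s (of_real t)) (at t)"
        by (rule has_vector_derivative_real_field[OF phase_deriv(1)[OF t'(3)]])
      show "((\<lambda>t. phase' \<nu> s (of_real t)) has_vector_derivative
          of_real \<nu> ^ m * of_real t ^ (m - 2) * curvature (of_real t)) (at t)"
        by (rule has_vector_derivative_real_field[OF phase_deriv(2)[OF t'(3)]])
      show "Re (phase \<nu> s (of_real t)) \<le> 0" using Re_phase_nonpos[of t \<nu>] t' \<delta> \<nu> by simp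
      have q: "\<nu> ^ m * t ^ (m - 2) \<ge> 0" using \<nu> t' by simp
      show "\<bar>Re (of_real \<nu> ^ m * of_real t ^ (m - 2) * curvature (of_real t))\<bar>
          \<le> \<sigma> * Im (of_real \<nu> ^ m * of_real t ^ (m - 2) * curvature (of_real t))"
        unfolding fac using mult_left_mono[OF curv(1)[OF t'(2)] q]
        by (simp only: times_complex.sel Re_complex_of_real Im_complex_of_real abs_mult power_abs
            abs_of_pos[OF \<nu>] abs_of_pos[OF t'(1)]
            mult_zero_left diff_zero add_0_right mult.left_commute)
      have "(A / \<nu>) ^ (m - 2) \<le> t ^ (m - 2)" using t pos by (intro power_mono) auto
      then have "\<mu> \<le> \<nu> ^ m * t ^ (m - 2) * c" unfolding \<mu>_def using \<nu> c
        by (intro mult_right_mono mult_left_mono) auto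
      also have "\<dots> \<le> \<nu> ^ m * t ^ (m - 2) * (\<sigma> * Im (curvature (of_real t)))"
        using mult_left_mono[OF curv(2)[OF t'(2)] q] by simp
      finally show "\<mu> \<le> \<sigma> * Im (of_real \<nu> ^ m * of_real t ^ (m - 2) * curvature (of_real t))"
        unfolding fac by (simp add: mult_ac del: of_real_mult of_real_power)
    qed (use \<sigma> c A \<nu> in \<open>auto simp: \<mu>_eq\<close>)
    also have "sqrt \<mu> = \<nu> * sqrt (A ^ (m - 2)) * sqrt c"
      using \<nu> by (simp add: \<mu>_eq real_sqrt_mult)
    finally show ?thesis by (simp add: mult_ac)
  qed
  then show ?thesis using that[of \<delta> "10 / sqrt c"] \<delta> c by simp
qed

lemma right_tail:
  obtains \<delta> C where "0 < \<delta>" "\<delta> < r" "0 < C"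
    "\<And>\<nu> A b s. 0 < \<nu> \<Longrightarrow> 1 \<le> A \<Longrightarrow> A / \<nu> \<le> b \<Longrightarrow> b \<le> \<delta> \<Longrightarrow>
       cmod (integral {A / \<nu>..b} (\<lambda>t. exp (phase \<nu> s (of_real t)))) \<le> C * tail_rate m \<beta> A / \<nu>"
proof (cases "Re \<beta> > 0")
  case True
  from right_tail_damped[OF True] obtain \<delta> C where *: "0 < \<delta>" "\<delta> < r" "0 < C"
    "\<And>\<nu> A b s. 0 < \<nu> \<Longrightarrow> 1 \<le> A \<Longrightarrow> A / \<nu> \<le> b \<Longrightarrow> b \<le> \<delta> \<Longrightarrow>
       cmod (integral {A / \<nu>..b} (\<lambda>t. exp (phase \<nu> s (of_real t)))) \<le> C / A / \<nu>"
    by blast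
  show ?thesis using that[OF *(1-3)] *(4) True by (simp add: tail_rate_def)
next
  case False
  then have "Re \<beta> = 0" using Re_beta_nonneg by simp
  from right_tail_oscillating[OF this] obtain \<delta> C where *: "0 < \<delta>" "\<delta> < r" "0 < C"
    "\<And>\<nu> A b s. 0 < \<nu> \<Longrightarrow> 1 \<le> A \<Longrightarrow> A / \<nu> \<le> b \<Longrightarrow> b \<le> \<delta> \<Longrightarrow>
       cmod (integral {A / \<nu>..b} (\<lambda>t. exp (phase \<nu> s (of_real t)))) \<le> C / sqrt (A ^ (m - 2)) / \<nu>"
    by blast
  show ?thesis using that[OF *(1-3)] *(4) False by (simp add: tail_rate_def)
qed

lemma tail_rate_reflect: "tail_rate m ((-1) ^ m * \<beta>) = tail_rate m \<beta>"
  unfolding tail_rate_def[abs_def] Re_beta_reflect ..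

lemma two_sided_tail:
  obtains \<delta> C where "0 < \<delta>" "\<delta> < r" "0 < C"
    "\<And>\<nu> A b s. 0 < \<nu> \<Longrightarrow> 1 \<le> A \<Longrightarrow> A / \<nu> \<le> b \<Longrightarrow> b \<le> \<delta> \<Longrightarrow>
       cmod (integral {A / \<nu>..b} (\<lambda>t. exp (phase \<nu> s (of_real t)))) \<le> C * tail_rate m \<beta> A / \<nu> \<and>
       cmod (integral {- b..- (A / \<nu>)} (\<lambda>t. exp (phase \<nu> s (of_real t)))) \<le> C * tail_rate m \<beta> A / \<nu>"
proof -
  interpret refl: boundary_phase m "(-1) ^ m * \<beta>" "\<lambda>z. (-1) ^ m * h (- z)" r by (rule reflect)
  obtain \<delta>1 C1 where 1: "0 < \<delta>1" "\<delta>1 < r" "0 < C1"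
    "\<And>\<nu> A b s. 0 < \<nu> \<Longrightarrow> 1 \<le> A \<Longrightarrow> A / \<nu> \<le> b \<Longrightarrow> b \<le> \<delta>1 \<Longrightarrow>
       cmod (integral {A / \<nu>..b} (\<lambda>t. exp (phase \<nu> s (of_real t)))) \<le> C1 * tail_rate m \<beta> A / \<nu>"
    using right_tail by blast
  obtain \<delta>2 C2 where 2: "0 < \<delta>2" "\<delta>2 < r" "0 < C2"
    "\<And>\<nu> A b s. 0 < \<nu> \<Longrightarrow> 1 \<le> A \<Longrightarrow> A / \<nu> \<le> b \<Longrightarrow> b \<le> \<delta>2 \<Longrightarrow>
       cmod (integral {A / \<nu>..b} (\<lambda>t. exp (refl.phase \<nu> s (of_real t)))) \<le> C2 * tail_rate m ((-1) ^ m * \<beta>) A / \<nu>"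
    using refl.right_tail by blast
  show ?thesis
  proof (rule that[of "min \<delta>1 \<delta>2" "C1 + C2"])
    fix \<nu> A b s :: real assume *: "0 < \<nu>" "1 \<le> A" "A / \<nu> \<le> b" "b \<le> min \<delta>1 \<delta>2"
    have T: "0 \<le> tail_rate m \<beta> A" using tail_rate_pos[of A] * by (simp add: less_imp_le)
    have "integral {- b..- (A / \<nu>)} (\<lambda>t. exp (phase \<nu> s (of_real t))) =
        integral {A / \<nu>..b} (\<lambda>t. exp (refl.phase \<nu> (- s) (of_real t)))"
      using Henstock_Kurzweil_Integration.integral_reflect_real[of b "A / \<nu>" "\<lambda>t. exp (refl.phase \<nu> (- s) (of_real t))"]
      by (simp add: phase_reflect)
    moreover have "C1 * tail_rate m \<beta> A / \<nu> \<le> (C1 + C2) * tail_rate m \<beta> A / \<nu>"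
       "C2 * tail_rate m \<beta> A / \<nu> \<le> (C1 + C2) * tail_rate m \<beta> A / \<nu>"
      using T 1(3) 2(3) *(1) by (auto intro!: divide_right_mono mult_right_mono)
    ultimately show "cmod (integral {A / \<nu>..b} (\<lambda>t. exp (phase \<nu> s (of_real t)))) \<le> (C1 + C2) * tail_rate m \<beta> A / \<nu> \<and>
       cmod (integral {- b..- (A / \<nu>)} (\<lambda>t. exp (phase \<nu> s (of_real t)))) \<le> (C1 + C2) * tail_rate m \<beta> A / \<nu>"
      using 1(4)[of \<nu> A b s] 2(4)[of \<nu> A b "- s"] * by (auto simp: tail_rate_reflect)
  qed (use 1 2 in auto)
qed

end

section \<open>The limit profile H and local asymptotics\<close>

lemma integral_scale:
  fixes f :: "real \<Rightarrow> complex"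
  assumes "\<nu> > 0"
  shows "integral {a / \<nu>..b / \<nu>} (\<lambda>t. f (\<nu> * t)) = integral {a..b} f / of_real \<nu>"
proof -
  have "(\<lambda>x. x / \<nu>) ` {a..b} = {a / \<nu>..b / \<nu>}"
  proof (intro equalityI subsetI)
    fix x assume "x \<in> {a / \<nu>..b / \<nu>}"
    then show "x \<in> (\<lambda>x. x / \<nu>) ` {a..b}" using assms
      by (intro image_eqI[of _ _ "x * \<nu>"]) (auto simp: field_simps)
  qed (use assms in \<open>auto simp: divide_right_mono\<close>)
  then show ?thesis using integral_stretch_real[of \<nu> a b f] assms
    by (simp add: scaleR_conv_of_real divide_inverse mult.commute)
qed

text \<open>
  A Cauchy criterion for the improper integral, with a rate: uniform smallness of all tail pieces gives
  convergence with the two end points moving independently.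
\<close>

lemma improper_integral_limit:
  fixes f :: "real \<Rightarrow> complex"
  assumes cont: "continuous_on UNIV f"
    and tails: "\<And>A B. 1 \<le> A \<Longrightarrow> A \<le> B \<Longrightarrow> cmod (integral {A..B} f) \<le> E A \<and> cmod (integral {- B..- A} f) \<le> E A"
    and E: "(E \<longlongrightarrow> 0) at_top"
  obtains L where "((\<lambda>(a, b). integral {a..b} f) \<longlongrightarrow> L) (at_bot \<times>\<^sub>F at_top)"
    and "\<And>A. 1 \<le> A \<Longrightarrow> cmod (L - integral {- A..A} f) \<le> 2 * E A"
proof -
  have int: "f integrable_on {a..b}" for a b
    by (intro integrable_continuous_real continuous_on_subset[OF cont]) auto
  have close: "cmod (integral {a..b} f - integral {- A..A} f) \<le> 2 * E A" if "1 \<le> A" "a \<le> - A" "A \<le> b" for a b A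
  proof -
    have 1: "integral {a..-A} f + integral {-A..b} f = integral {a..b} f"
      by (rule Henstock_Kurzweil_Integration.integral_combine[OF _ _ int]) (use that in auto)
    have 2: "integral {-A..A} f + integral {A..b} f = integral {-A..b} f"
      by (rule Henstock_Kurzweil_Integration.integral_combine[OF _ _ int]) (use that in auto)
    have "integral {a..b} f - integral {- A..A} f = integral {a..-A} f + integral {A..b} f"
      unfolding 1[symmetric] 2[symmetric] by simp
    also have "cmod \<dots> \<le> E A + E A"
      using tails[of A b] tails[of A "- a"] that by (intro norm_triangle_mono) auto
    finally show ?thesis by simp
  qed
  define X where "X = (\<lambda>k::nat. integral {- real k..real k} f)"
  have ex: "\<exists>A\<ge>1. E A < e" if "e > 0" for e
  proof -
    have "\<forall>\<^sub>F A in at_top. 1 \<le> A \<and> E A < e"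
      using order_tendstoD(2)[OF E that] eventually_ge_at_top[of 1] by eventually_elim auto
    from eventually_happens'[OF trivial_limit_at_top_linorder this] show ?thesis by blast
  qed
  have "Cauchy X"
  proof (rule metric_CauchyI)
    fix e :: real assume "0 < e"
    then obtain A where A: "A \<ge> 1" "E A < e / 4" using ex[of "e / 4"] by auto
    have "dist (X i) (X j) < e" if "i \<ge> nat \<lceil>A\<rceil>" "j \<ge> nat \<lceil>A\<rceil>" for i j
    proof -
      have "cmod (X i - integral {- A..A} f) \<le> 2 * E A" "cmod (X j - integral {- A..A} f) \<le> 2 * E A"
        unfolding X_def using that A by (intro close; linarith)+
      then show ?thesis using A(2) norm_triangle_ineq4[of "X i - integral {- A..A} f" "X j - integral {- A..A} f"]
        by (simp add: dist_norm)
    qed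
    then show "\<exists>M. \<forall>m\<ge>M. \<forall>n\<ge>M. dist (X m) (X n) < e" by blast
  qed
  then obtain L where L: "X \<longlonglongrightarrow> L" by (meson Cauchy_convergent convergent_def)
  have LA: "cmod (L - integral {- A..A} f) \<le> 2 * E A" if "1 \<le> A" for A
  proof (rule tendsto_upperbound)
    show "((\<lambda>k. cmod (X k - integral {- A..A} f)) \<longlonglongrightarrow> cmod (L - integral {- A..A} f))"
      by (intro tendsto_intros L)
    show "\<forall>\<^sub>F k in sequentially. cmod (X k - integral {- A..A} f) \<le> 2 * E A"
      using eventually_ge_at_top[of "nat \<lceil>A\<rceil>"]
      by eventually_elim (use that in \<open>unfold X_def, intro close; linarith\<close>)
  qed simp
  have "((\<lambda>(a, b). integral {a..b} f) \<longlongrightarrow> L) (at_bot \<times>\<^sub>F at_top)"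
  proof (rule tendstoI)
    fix e :: real assume "0 < e"
    then obtain A where A: "A \<ge> 1" "E A < e / 4" using ex[of "e / 4"] by auto
    have "\<forall>\<^sub>F x in at_bot \<times>\<^sub>F at_top. fst x \<le> - A \<and> A \<le> snd x"
      by (intro eventually_prodI eventually_le_at_bot eventually_ge_at_top)
    then show "\<forall>\<^sub>F x in at_bot \<times>\<^sub>F at_top. dist (case x of (a, b) \<Rightarrow> integral {a..b} f) L < e"
    proof eventually_elim
      case (elim x)
      then show ?case
        using close[of A "fst x" "snd x"] LA[of A] A
          norm_triangle_ineq4[of "integral {fst x..snd x} f - integral {- A..A} f" "L - integral {- A..A} f"]
        by (simp add: dist_norm split_beta)
    qed
  qed
  with LA show ?thesis using that by blast
qed

text \<open>
  The exponential is 1-Lipschitz on the closed left half plane.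
\<close>

lemma cmod_exp_diff_le:
  assumes "Re w \<le> 0" "Re z \<le> 0"
  shows "cmod (exp w - exp z) \<le> cmod (w - z)"
proof -
  have "cmod (exp w - exp z) \<le> 1 * cmod (w - z)"
    by (rule field_differentiable_bound[where S="{z. Re z \<le> 0}" and f'=exp])
      (use assms in \<open>auto intro: convex_halfspace_Re_le has_field_derivative_at_within[OF DERIV_exp]\<close>)
  then show ?thesis by simp
qed

context boundary_phase
begin

definition kernel :: "real \<Rightarrow> real \<Rightarrow> complex" where
  "kernel y u = exp (- \<i> * of_real y * of_real u) * exp (- \<beta> * of_real u ^ m)"

lemma H_eq: "H m \<beta> y = 1 / (2 * of_real pi) * Lim (at_bot \<times>\<^sub>F at_top) (\<lambda>(a, b). integral {a..b} (kernel y))"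
  by (simp add: H_def kernel_def[abs_def])

lemma continuous_on_kernel: "continuous_on S (kernel y)"
  unfolding kernel_def[abs_def] by (intro continuous_intros)

lemma Re_model_nonpos: "Re (- \<beta> * of_real t ^ m) \<le> 0"
proof (cases "even m")
  case True
  then show ?thesis using Re_beta_nonneg by (simp flip: of_real_power add: zero_le_even_power)
next
  case False
  then show ?thesis using Re_beta_odd by (simp flip: of_real_power)
qed

lemma model: "boundary_phase m \<beta> (\<lambda>_. - \<beta>) 1"
proof
  show "Re (of_real t ^ m * - \<beta>) \<le> 0" for t
    using Re_model_nonpos[of t] by (simp add: mult.commute)
qed (use m_ge_2 beta_nonzero in auto)

text \<open>
  The integral defining H is itself of the form studied above, with constant h. Its tails over
  arbitrarily long intervals [A, B] are brought into the fixed neighbourhood of 0 by choosing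
  \<nu> proportional to B.
\<close>

lemma kernel_tail:
  obtains C where "C > 0"
    "\<And>A B y. 1 \<le> A \<Longrightarrow> A \<le> B \<Longrightarrow> cmod (integral {A..B} (kernel y)) \<le> C * tail_rate m \<beta> A \<and>
       cmod (integral {- B..- A} (kernel y)) \<le> C * tail_rate m \<beta> A"
proof -
  interpret model: boundary_phase m \<beta> "\<lambda>_. - \<beta>" 1 by (rule model)
  obtain \<delta> C where *: "0 < \<delta>" "\<delta> < 1" "0 < C"
    "\<And>\<nu> A b s. 0 < \<nu> \<Longrightarrow> 1 \<le> A \<Longrightarrow> A / \<nu> \<le> b \<Longrightarrow> b \<le> \<delta> \<Longrightarrow>
       cmod (integral {A / \<nu>..b} (\<lambda>t. exp (model.phase \<nu> s (of_real t)))) \<le> C * tail_rate m \<beta> A / \<nu> \<and>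
       cmod (integral {- b..- (A / \<nu>)} (\<lambda>t. exp (model.phase \<nu> s (of_real t)))) \<le> C * tail_rate m \<beta> A / \<nu>"
    using model.two_sided_tail by blast
  show ?thesis
  proof (rule that[OF *(3)])
    fix A B y :: real assume AB: "1 \<le> A" "A \<le> B"
    \<comment> \<open>With this scale the interval [A, B] becomes [A / \<nu>, \<delta>].\<close>
    define \<nu> where "\<nu> = B / \<delta>"
    have \<nu>: "\<nu> > 0" and B: "B / \<nu> = \<delta>" using AB *(1) by (auto simp: \<nu>_def)
    have k: "(\<lambda>t. exp (model.phase \<nu> (- y * \<nu>) (of_real t))) = (\<lambda>t. kernel y (\<nu> * t))"
      by (simp add: fun_eq_iff model.phase_def kernel_def mult_exp_exp algebra_simps)
    have "A / \<nu> \<le> \<delta>" unfolding B[symmetric] using AB \<nu> by (simp add: divide_right_mono)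
    then show "cmod (integral {A..B} (kernel y)) \<le> C * tail_rate m \<beta> A \<and>
       cmod (integral {- B..- A} (kernel y)) \<le> C * tail_rate m \<beta> A"
      using *(4)[of \<nu> A \<delta> "- y * \<nu>"] AB \<nu> unfolding k unfolding B[symmetric]
      using integral_scale[OF \<nu>, of A B "kernel y"] integral_scale[OF \<nu>, of "- B" "- A" "kernel y"]
      by (simp add: norm_divide divide_le_cancel)
  qed
qed

lemma H_truncation:
  assumes "m > 2 \<or> Re \<beta> > 0"
  obtains C where "C > 0"
    "\<And>A y. 1 \<le> A \<Longrightarrow> cmod (2 * of_real pi * H m \<beta> y - integral {- A..A} (kernel y)) \<le> C * tail_rate m \<beta> A"
proof -
  obtain C where C: "C > 0"
    "\<And>A B y. 1 \<le> A \<Longrightarrow> A \<le> B \<Longrightarrow> cmod (integral {A..B} (kernel y)) \<le> C * tail_rate m \<beta> A \<and>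
       cmod (integral {- B..- A} (kernel y)) \<le> C * tail_rate m \<beta> A"
    using kernel_tail by blast
  have E: "((\<lambda>A. C * tail_rate m \<beta> A) \<longlongrightarrow> 0) at_top"
    using tendsto_mult_right_zero[OF tail_rate_tendsto_0[OF assms]] by blast
  show ?thesis
  proof (rule that[of "2 * C"])
    fix A y :: real assume "1 \<le> A"
    obtain L where L: "((\<lambda>(a, b). integral {a..b} (kernel y)) \<longlongrightarrow> L) (at_bot \<times>\<^sub>F at_top)"
      "cmod (L - integral {- A..A} (kernel y)) \<le> 2 * (C * tail_rate m \<beta> A)"
      using improper_integral_limit[OF continuous_on_kernel C(2) E] \<open>1 \<le> A\<close> by metis
    have "Lim (at_bot \<times>\<^sub>F at_top) (\<lambda>(a, b). integral {a..b} (kernel y)) = L"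
      using L(1) by (intro tendsto_Lim) (auto simp: prod_filter_eq_bot)
    then have "2 * of_real pi * H m \<beta> y = L" unfolding H_eq by simp
    with L(2) show "cmod (2 * of_real pi * H m \<beta> y - integral {- A..A} (kernel y)) \<le> 2 * C * tail_rate m \<beta> A"
      by simp
  qed (use C in auto)
qed

text \<open>
  Integration by parts against exp (-i y u); the bound is far from optimal in A, but A is fixed when
  y tends to infinity.
\<close>

lemma truncated_kernel_bound:
  assumes "A > 0" "y \<noteq> 0"
  shows "cmod (integral {- A..A} (kernel y)) \<le> (2 + 2 * A * (cmod \<beta> * m * A ^ (m - 1))) / \<bar>y\<bar>"
proof -
  define g where "g = (\<lambda>u::real. exp (- \<beta> * of_real u ^ m))"
  define e where "e = (\<lambda>u::real. exp (- \<i> * of_real y * of_real u) / (- \<i> * of_real y))"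
  define g' where "g' = (\<lambda>u::real. - \<beta> * (of_nat m * of_real u ^ (m - 1)) * g u)"
  have e: "(e has_vector_derivative exp (- \<i> * of_real y * of_real u)) (at u within S)" for u S
  proof -
    have "((\<lambda>z. exp (- \<i> * of_real y * z) / (- \<i> * of_real y)) has_field_derivative exp (- \<i> * of_real y * of_real u)) (at (of_real u))"
      using assms by (auto intro!: derivative_eq_intros)
    from has_vector_derivative_real_field[OF this] show ?thesis by (simp add: e_def[abs_def])
  qed
  have g: "(g has_vector_derivative g' u) (at u within S)" for u S
  proof -
    have "((\<lambda>z. exp (- \<beta> * z ^ m)) has_field_derivative g' u) (at (of_real u))"
      unfolding g'_def g_def by (rule derivative_eq_intros refl)+ simp
    from has_vector_derivative_real_field[OF this] show ?thesis by (simp add: g_def[abs_def])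
  qed
  have cmod_g: "cmod (g u) \<le> 1" for u using Re_model_nonpos[of u] by (simp add: g_def)
  have cmod_e: "cmod (e u) = 1 / \<bar>y\<bar>" for u by (simp add: e_def norm_divide norm_mult)
  have k: "kernel y u = exp (- \<i> * of_real y * of_real u) * g u" for u by (simp add: kernel_def g_def)
  have "((\<lambda>u. e u * g' u + kernel y u) has_integral (e A * g A - e (- A) * g (- A))) {- A..A}"
    unfolding k by (rule fundamental_theorem_of_calculus[OF _ has_vector_derivative_mult[OF e g]]) (use assms in auto)
  moreover have ieg: "(\<lambda>u. e u * g' u) integrable_on {- A..A}"
    unfolding e_def g'_def g_def using assms by (intro integrable_continuous_real continuous_intros) auto
  ultimately have "((\<lambda>u. (e u * g' u + kernel y u) - e u * g' u) has_integral
      (e A * g A - e (- A) * g (- A)) - integral {- A..A} (\<lambda>u. e u * g' u)) {- A..A}"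
    by (intro has_integral_diff integrable_integral)
  then have "integral {- A..A} (kernel y) = (e A * g A - e (- A) * g (- A)) - integral {- A..A} (\<lambda>u. e u * g' u)"
    by (simp add: integral_unique)
  also have "cmod \<dots> \<le> cmod (e A * g A) + cmod (e (- A) * g (- A)) + cmod (integral {- A..A} (\<lambda>u. e u * g' u))"
    by (rule order_trans[OF norm_triangle_ineq4 add_right_mono[OF norm_triangle_ineq4]])
  also have "cmod (e A * g A) \<le> 1 / \<bar>y\<bar>"
    using cmod_g[of A] by (simp add: norm_mult cmod_e divide_right_mono)
  also have "cmod (e (- A) * g (- A)) \<le> 1 / \<bar>y\<bar>"
    using cmod_g[of "- A"] by (simp add: norm_mult cmod_e divide_right_mono)
  also have "cmod (integral {- A..A} (\<lambda>u. e u * g' u)) \<le> integral {- A..A} (\<lambda>u. cmod \<beta> * m * A ^ (m - 1) / \<bar>y\<bar>)"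
  proof (rule integral_norm_bound_integral[OF ieg])
    fix u assume "u \<in> {- A..A}"
    then have "\<bar>u\<bar> ^ (m - 1) \<le> A ^ (m - 1)" by (intro power_mono) auto
    then have "cmod \<beta> * (m * \<bar>u\<bar> ^ (m - 1)) * cmod (g u) \<le> cmod \<beta> * (m * A ^ (m - 1)) * 1"
      using cmod_g[of u] assms by (intro mult_mono) auto
    then have "cmod (g' u) \<le> cmod \<beta> * m * A ^ (m - 1)"
      by (simp add: g'_def norm_mult norm_power mult.assoc)
    then show "cmod (e u * g' u) \<le> cmod \<beta> * m * A ^ (m - 1) / \<bar>y\<bar>"
      by (simp add: norm_mult cmod_e divide_right_mono)
  qed auto
  finally show ?thesis using assms by (simp add: add_divide_distrib mult_ac)
qed

text \<open>
  Truncate at a large A, independent of y, and let y tend to infinity in the truncated integral.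
\<close>

lemma H_decay:
  assumes "m > 2 \<or> Re \<beta> > 0" "\<epsilon> > 0"
  obtains M where "M > 0" "\<And>y. \<bar>y\<bar> > M \<Longrightarrow> cmod (H m \<beta> y) \<le> \<epsilon>"
proof -
  obtain C where C: "C > 0"
    "\<And>A y. 1 \<le> A \<Longrightarrow> cmod (2 * of_real pi * H m \<beta> y - integral {- A..A} (kernel y)) \<le> C * tail_rate m \<beta> A"
    using H_truncation[OF assms(1)] by blast
  have lim: "((\<lambda>A. C * tail_rate m \<beta> A) \<longlongrightarrow> 0) at_top"
    using tendsto_mult_right_zero[OF tail_rate_tendsto_0[OF assms(1)]] by blast
  have "\<forall>\<^sub>F A in at_top. 1 \<le> A \<and> C * tail_rate m \<beta> A < \<epsilon>"
    by (rule eventually_conj[OF eventually_ge_at_top order_tendstoD(2)[OF lim assms(2)]])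
  then obtain A where A: "1 \<le> A" "C * tail_rate m \<beta> A < \<epsilon>"
    using eventually_happens'[OF trivial_limit_at_top_linorder] by blast
  define B where "B = 2 + 2 * A * (cmod \<beta> * m * A ^ (m - 1))"
  have B: "B > 0" using A by (simp add: B_def add_pos_nonneg)
  show ?thesis
  proof (rule that[of "B / \<epsilon>"])
    fix y assume y: "\<bar>y\<bar> > B / \<epsilon>"
    have y0: "\<bar>y\<bar> > 0" using y B assms(2) by (meson divide_pos_pos less_trans)
    have "B / \<bar>y\<bar> \<le> \<epsilon>" using y y0 assms(2) by (simp add: field_simps)
    then have "cmod (integral {- A..A} (kernel y)) \<le> \<epsilon>"
      using truncated_kernel_bound[of A y] A y0 by (simp add: B_def)
    then have "cmod (2 * of_real pi * H m \<beta> y) \<le> \<epsilon> + \<epsilon>"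
      using C(2)[OF A(1), of y] A(2)
        norm_triangle_ineq2[of "2 * of_real pi * H m \<beta> y" "integral {- A..A} (kernel y)"] by linarith
    moreover have "2 * cmod (H m \<beta> y) \<le> cmod (2 * of_real pi * H m \<beta> y)"
      using pi_gt3 by (simp add: norm_mult mult_right_mono)
    ultimately show "cmod (H m \<beta> y) \<le> \<epsilon>" by simp
  qed (use B assms in auto)
qed

lemma integral_split:
  assumes "0 < a" "a \<le> \<delta>" "\<delta> < r"
  shows "integral {- \<delta>..\<delta>} (\<lambda>t. exp (phase \<nu> s (of_real t))) =
    integral {- \<delta>..- a} (\<lambda>t. exp (phase \<nu> s (of_real t))) +
    integral {- a..a} (\<lambda>t. exp (phase \<nu> s (of_real t))) +
    integral {a..\<delta>} (\<lambda>t. exp (phase \<nu> s (of_real t)))"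
proof -
  let ?f = "\<lambda>t. exp (phase \<nu> s (of_real t))"
  have int: "?f integrable_on {x..y}" if "- \<delta> \<le> x" "y \<le> \<delta>" for x y
    by (intro integrable_continuous_real continuous_on_phase) (use that assms in auto)
  have "integral {-\<delta>..-a} ?f + integral {-a..\<delta>} ?f = integral {-\<delta>..\<delta>} ?f"
    by (rule Henstock_Kurzweil_Integration.integral_combine) (use assms int in auto)
  moreover have "integral {-a..a} ?f + integral {a..\<delta>} ?f = integral {-a..\<delta>} ?f"
    by (rule Henstock_Kurzweil_Integration.integral_combine) (use assms int in auto)
  ultimately show ?thesis by (simp add: add.assoc)
qed

text \<open>
  On |t| \<le> 1 / \<nu> the integrand is bounded by 1, and the rest is the tail with A = 1.
\<close>

lemma local_bound:
  obtains \<delta>0 C where "0 < \<delta>0" "\<delta>0 < r" "C > 0"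
    "\<And>\<delta> \<nu> s. 0 < \<delta> \<Longrightarrow> \<delta> \<le> \<delta>0 \<Longrightarrow> 0 < \<nu> \<Longrightarrow>
      cmod (integral {- \<delta>..\<delta>} (\<lambda>t. exp (phase \<nu> s (of_real t)))) \<le> C / \<nu>"
proof -
  obtain \<delta>0 C where *: "0 < \<delta>0" "\<delta>0 < r" "0 < C"
    "\<And>\<nu> A b s. 0 < \<nu> \<Longrightarrow> 1 \<le> A \<Longrightarrow> A / \<nu> \<le> b \<Longrightarrow> b \<le> \<delta>0 \<Longrightarrow>
       cmod (integral {A / \<nu>..b} (\<lambda>t. exp (phase \<nu> s (of_real t)))) \<le> C * tail_rate m \<beta> A / \<nu> \<and>
       cmod (integral {- b..- (A / \<nu>)} (\<lambda>t. exp (phase \<nu> s (of_real t)))) \<le> C * tail_rate m \<beta> A / \<nu>"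
    using two_sided_tail by blast
  show ?thesis
  proof (rule that[of \<delta>0 "2 * C + 2"])
    fix \<delta> \<nu> s :: real assume \<delta>: "0 < \<delta>" "\<delta> \<le> \<delta>0" and \<nu>: "0 < \<nu>"
    let ?f = "\<lambda>t. exp (phase \<nu> s (of_real t))"
    have trivial: "cmod (integral {- a..a} ?f) \<le> 2 * a" if "0 < a" "a \<le> \<delta>0" for a
    proof -
      have "cmod (integral {- a..a} ?f) \<le> integral {- a..a} (\<lambda>t. 1)"
      proof (rule integral_norm_bound_integral)
        show "?f integrable_on {- a..a}"
          by (intro integrable_continuous_real continuous_on_phase) (use that * in auto)
        show "cmod (?f t) \<le> 1" if "t \<in> {- a..a}" for t
          using Re_phase_nonpos[of t \<nu> s] that \<open>a \<le> \<delta>0\<close> *(2) \<nu> by auto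
      qed auto
      then show ?thesis using that by simp
    qed
    show "cmod (integral {- \<delta>..\<delta>} ?f) \<le> (2 * C + 2) / \<nu>"
    proof (cases "1 / \<nu> \<le> \<delta>")
      case True
      have "cmod (integral {- \<delta>..\<delta>} ?f) \<le> C / \<nu> + 2 * (1 / \<nu>) + C / \<nu>"
        unfolding integral_split[of "1 / \<nu>" \<delta>, OF _ True order_le_less_trans[OF \<delta>(2) *(2)], simplified, OF \<nu>]
        using *(4)[of \<nu> 1 \<delta> s] True \<delta> \<nu> trivial[of "1 / \<nu>"]
        by (intro norm_triangle_mono) (auto simp: tail_rate_one)
      then show ?thesis by (simp add: add_divide_distrib)
    next
      case False
      then have "cmod (integral {- \<delta>..\<delta>} ?f) \<le> 2 * (1 / \<nu>)" using trivial[OF \<delta>] by simp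
      also have "\<dots> \<le> (2 * C + 2) / \<nu>" using \<nu> *(3) by (simp add: divide_right_mono)
      finally show ?thesis .
    qed
  qed (use * in auto)
qed

text \<open>
  In the variable u = \<nu> t the two exponents differ by u^m (h (u / \<nu>) - h 0), independently of s, which
  tends to 0 uniformly for |u| \<le> A.
\<close>

lemma middle_convergence:
  assumes "A > 0" "\<epsilon> > 0"
  obtains N where "N > 0" "A / N < r"
    "\<And>\<nu> s. \<nu> \<ge> N \<Longrightarrow>
      cmod (integral {- (A / \<nu>)..A / \<nu>} (\<lambda>t. exp (phase \<nu> s (of_real t))) - integral {- A..A} (kernel (- s / \<nu>)) / of_real \<nu>)
        \<le> \<epsilon> / \<nu>"
proof -
  define \<eta> where "\<eta> = \<epsilon> / (2 * A * A ^ m)"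
  have \<eta>: "\<eta> > 0" using assms by (simp add: \<eta>_def)
  obtain d where d: "d > 0" "\<And>z. cmod z < d \<Longrightarrow> cmod (h z - h 0) < \<eta>"
    using isCont_h_0 \<eta> by (auto simp: continuous_at_eps_delta dist_norm)
  define N where "N = A / (min d r / 2)"
  have N: "N > 0" "A / N = min d r / 2" using assms d r_pos by (auto simp: N_def)
  show ?thesis
  proof (rule that[OF N(1)])
    show "A / N < r" unfolding N(2) using d r_pos by simp
    fix \<nu> s :: real assume "\<nu> \<ge> N"
    then have \<nu>: "\<nu> > 0" using N by simp
    have "A / \<nu> \<le> A / N" using \<open>\<nu> \<ge> N\<close> N(1) assms by (intro divide_left_mono) auto
    moreover have "min d r / 2 < r" "min d r / 2 < d" using d r_pos by auto
    ultimately have A\<nu>: "A / \<nu> < r" "A / \<nu> < d" unfolding N(2) by linarith+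
    define f where "f = (\<lambda>u. exp (phase \<nu> s (of_real (u / \<nu>))))"
    have small: "\<bar>u / \<nu>\<bar> < r" "\<bar>u / \<nu>\<bar> < d" if "u \<in> {- A..A}" for u
    proof -
      have "\<bar>u / \<nu>\<bar> \<le> A / \<nu>" using that \<nu> by (auto simp: abs_le_iff divide_right_mono field_simps)
      then show "\<bar>u / \<nu>\<bar> < r" "\<bar>u / \<nu>\<bar> < d" using A\<nu> by auto
    qed
    have "continuous_on ((\<lambda>u. u / \<nu>) ` {- A..A}) (\<lambda>t. exp (phase \<nu> s (of_real t)))"
      by (rule continuous_on_phase) (use small in auto)
    then have cf: "continuous_on {- A..A} f" unfolding f_def
      by (rule continuous_on_compose2) (use \<nu> in \<open>auto intro!: continuous_intros\<close>)
    have "integral {- (A / \<nu>)..A / \<nu>} (\<lambda>t. exp (phase \<nu> s (of_real t))) = integral {- A..A} f / of_real \<nu>"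
      using integral_scale[OF \<nu>, of "- A" A f] \<nu> by (simp add: f_def)
    then have "integral {- (A / \<nu>)..A / \<nu>} (\<lambda>t. exp (phase \<nu> s (of_real t))) - integral {- A..A} (kernel (- s / \<nu>)) / of_real \<nu>
        = integral {- A..A} (\<lambda>u. f u - kernel (- s / \<nu>) u) / of_real \<nu>"
      using cf by (subst Henstock_Kurzweil_Integration.integral_diff)
        (auto intro!: integrable_continuous_real continuous_on_kernel simp: diff_divide_distrib)
    moreover have "cmod (integral {- A..A} (\<lambda>u. f u - kernel (- s / \<nu>) u)) \<le> integral {- A..A} (\<lambda>u. A ^ m * \<eta>)"
    proof (rule integral_norm_bound_integral)
      show "(\<lambda>u. f u - kernel (- s / \<nu>) u) integrable_on {- A..A}"
        by (intro integrable_continuous_real continuous_intros cf continuous_on_kernel)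
      fix u assume u: "u \<in> {- A..A}"
      have "phase \<nu> s (of_real (u / \<nu>)) - (- \<i> * of_real (- s / \<nu>) * of_real u + - \<beta> * of_real u ^ m)
          = of_real u ^ m * (h (of_real (u / \<nu>)) - h 0)"
        using \<nu> by (simp add: phase_def h_0 algebra_simps)
      then have "cmod (phase \<nu> s (of_real (u / \<nu>)) - (- \<i> * of_real (- s / \<nu>) * of_real u + - \<beta> * of_real u ^ m))
          = \<bar>u\<bar> ^ m * cmod (h (of_real (u / \<nu>)) - h 0)"
        by (simp add: norm_mult norm_power)
      also have "\<dots> \<le> A ^ m * \<eta>"
        using u small(2)[OF u] d(2)[of "of_real (u / \<nu>)"]
        by (intro mult_mono power_mono) (auto simp: abs_le_iff less_imp_le simp del: of_real_divide)
      finally have "cmod (phase \<nu> s (of_real (u / \<nu>)) - (- \<i> * of_real (- s / \<nu>) * of_real u + - \<beta> * of_real u ^ m))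
          \<le> A ^ m * \<eta>" .
      moreover have "Re (- \<i> * of_real (- s / \<nu>) * of_real u + - \<beta> * of_real u ^ m) \<le> 0"
        using Re_model_nonpos[of u] by simp
      ultimately show "cmod (f u - kernel (- s / \<nu>) u) \<le> A ^ m * \<eta>"
        unfolding f_def kernel_def mult_exp_exp
        by (intro order_trans[OF cmod_exp_diff_le] Re_phase_nonpos small(1)[OF u] less_imp_le[OF \<nu>])
    qed auto
    ultimately show "cmod (integral {- (A / \<nu>)..A / \<nu>} (\<lambda>t. exp (phase \<nu> s (of_real t))) - integral {- A..A} (kernel (- s / \<nu>)) / of_real \<nu>)
        \<le> \<epsilon> / \<nu>"
      using assms \<nu> by (simp add: norm_divide \<eta>_def divide_right_mono)
  qed
qed

lemma local_asymptotics:
  assumes "m > 2 \<or> Re \<beta> > 0"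
  obtains \<delta>0 where "0 < \<delta>0" "\<delta>0 < r"
    "\<And>\<delta> \<epsilon>. 0 < \<delta> \<Longrightarrow> \<delta> \<le> \<delta>0 \<Longrightarrow> \<epsilon> > 0 \<Longrightarrow> \<exists>N>0. \<forall>\<nu>\<ge>N. \<forall>s.
      cmod (integral {- \<delta>..\<delta>} (\<lambda>t. exp (phase \<nu> s (of_real t))) - 2 * of_real pi * H m \<beta> (- s / \<nu>) / of_real \<nu>) \<le> \<epsilon> / \<nu>"
proof -
  obtain \<delta>0 C where *: "0 < \<delta>0" "\<delta>0 < r" "0 < C"
    "\<And>\<nu> A b s. 0 < \<nu> \<Longrightarrow> 1 \<le> A \<Longrightarrow> A / \<nu> \<le> b \<Longrightarrow> b \<le> \<delta>0 \<Longrightarrow>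
       cmod (integral {A / \<nu>..b} (\<lambda>t. exp (phase \<nu> s (of_real t)))) \<le> C * tail_rate m \<beta> A / \<nu> \<and>
       cmod (integral {- b..- (A / \<nu>)} (\<lambda>t. exp (phase \<nu> s (of_real t)))) \<le> C * tail_rate m \<beta> A / \<nu>"
    using two_sided_tail by blast
  obtain D where D: "D > 0"
    "\<And>A y. 1 \<le> A \<Longrightarrow> cmod (2 * of_real pi * H m \<beta> y - integral {- A..A} (kernel y)) \<le> D * tail_rate m \<beta> A"
    using H_truncation[OF assms(1)] by blast
  show ?thesis
  proof (rule that[OF *(1,2)])
    fix \<delta> \<epsilon> :: real assume \<delta>: "0 < \<delta>" "\<delta> \<le> \<delta>0" and \<epsilon>: "\<epsilon> > 0"
    have lim: "((\<lambda>A. (2 * C + D) * tail_rate m \<beta> A) \<longlongrightarrow> 0) at_top"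
      using tendsto_mult_right_zero[OF tail_rate_tendsto_0[OF assms(1)]] by blast
    have "\<forall>\<^sub>F A in at_top. 1 \<le> A \<and> (2 * C + D) * tail_rate m \<beta> A < \<epsilon> / 2"
      by (rule eventually_conj[OF eventually_ge_at_top order_tendstoD(2)[OF lim]]) (use \<epsilon> in simp)
    then obtain A where A: "1 \<le> A" "(2 * C + D) * tail_rate m \<beta> A < \<epsilon> / 2"
      using eventually_happens'[OF trivial_limit_at_top_linorder] by blast
    obtain N where N: "N > 0" "A / N < r"
      "\<And>\<nu> s. \<nu> \<ge> N \<Longrightarrow>
        cmod (integral {- (A / \<nu>)..A / \<nu>} (\<lambda>t. exp (phase \<nu> s (of_real t))) - integral {- A..A} (kernel (- s / \<nu>)) / of_real \<nu>)
        \<le> (\<epsilon> / 2) / \<nu>"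
      by (rule middle_convergence[of A "\<epsilon> / 2"]) (use A \<epsilon> in auto)
    have "cmod (integral {- \<delta>..\<delta>} (\<lambda>t. exp (phase \<nu> s (of_real t))) - 2 * of_real pi * H m \<beta> (- s / \<nu>) / of_real \<nu>) \<le> \<epsilon> / \<nu>"
      if \<nu>: "\<nu> \<ge> max N (A / \<delta>)" for \<nu> s
    proof -
      have \<nu>0: "\<nu> > 0" using \<nu> N(1) by simp
      have A\<nu>: "0 < A / \<nu>" "A / \<nu> \<le> \<delta>" using \<nu> \<nu>0 A \<delta> by (auto simp: field_simps)
      let ?f = "\<lambda>t. exp (phase \<nu> s (of_real t))" and ?T = "tail_rate m \<beta> A"
      let ?K = "integral {- A..A} (kernel (- s / \<nu>))"
      have "integral {- \<delta>..\<delta>} ?f - 2 * of_real pi * H m \<beta> (- s / \<nu>) / of_real \<nu> =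
          integral {- \<delta>..- (A / \<nu>)} ?f + (integral {- (A / \<nu>)..A / \<nu>} ?f - ?K / of_real \<nu>) + integral {A / \<nu>..\<delta>} ?f
          + (?K - 2 * of_real pi * H m \<beta> (- s / \<nu>)) / of_real \<nu>"
        using integral_split[OF A\<nu> order_le_less_trans[OF \<delta>(2) *(2)]] by (simp add: diff_divide_distrib)
      also have "cmod \<dots> \<le> C * ?T / \<nu> + (\<epsilon> / 2) / \<nu> + C * ?T / \<nu> + D * ?T / \<nu>"
        using *(4)[of \<nu> A \<delta> s] A A\<nu> \<delta> \<nu>0 N(3)[of \<nu> s] \<nu> D(2)[OF A(1), of "- s / \<nu>"]
        by (intro norm_triangle_mono) (auto simp: norm_divide norm_minus_commute divide_right_mono)
      also have "\<dots> = ((2 * C + D) * ?T + \<epsilon> / 2) / \<nu>" by (simp add: algebra_simps add_divide_distrib)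
      also have "\<dots> \<le> \<epsilon> / \<nu>" using A(2) \<nu>0 by (intro divide_right_mono) auto
      finally show ?thesis .
    qed
    then show "\<exists>N>0. \<forall>\<nu>\<ge>N. \<forall>s.
      cmod (integral {- \<delta>..\<delta>} (\<lambda>t. exp (phase \<nu> s (of_real t))) - 2 * of_real pi * H m \<beta> (- s / \<nu>) / of_real \<nu>) \<le> \<epsilon> / \<nu>"
      using N(1) by (intro exI[of _ "max N (A / \<delta>)"]) auto
  qed
qed

end

section \<open>Fourier inversion and the expansions of the symbol\<close>

abbreviation supp :: "(int \<Rightarrow> complex) \<Rightarrow> int set" where
  "supp \<phi> \<equiv> {x. \<phi> x \<noteq> 0}"

text \<open>
  The entire function that extends the Fourier transform from the real line.
\<close>

definition fourier_ext :: "(int \<Rightarrow> complex) \<Rightarrow> complex \<Rightarrow> complex" where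
  "fourier_ext \<phi> z = (\<Sum>x\<in>supp \<phi>. \<phi> x * exp (\<i> * of_int x * z))"

lemma fourier_eq_ext:
  assumes "finite (supp \<phi>)"
  shows "fourier \<phi> \<xi> = fourier_ext \<phi> (of_real \<xi>)"
proof -
  have "fourier \<phi> \<xi> = infsum (\<lambda>x. \<phi> x * exp (\<i> * of_int x * of_real \<xi>)) (supp \<phi>)"
    unfolding fourier_def by (intro infsum_cong_neutral) auto
  then show ?thesis using assms by (simp add: fourier_ext_def)
qed

lemma holomorphic_fourier_ext: "fourier_ext \<phi> holomorphic_on S"
  unfolding fourier_ext_def[abs_def] by (intro holomorphic_intros)

lemma has_integral_character:
  "((\<lambda>\<xi>. exp (\<i> * of_int k * of_real \<xi>)) has_integral (if k = 0 then 2 * of_real pi else 0)) {a..a + 2 * pi}"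
proof (cases "k = 0")
  case True
  then show ?thesis using has_integral_const_real[of "1::complex" a "a + 2 * pi"] pi_gt_zero
    by (simp add: scaleR_conv_of_real)
next
  case False
  have d: "((\<lambda>\<xi>. exp (\<i> * of_int k * of_real \<xi>) / (\<i> * of_int k)) has_vector_derivative exp (\<i> * of_int k * of_real \<xi>))
      (at \<xi> within S)" for \<xi> S
  proof -
    have "((\<lambda>z. exp (\<i> * of_int k * z) / (\<i> * of_int k)) has_field_derivative exp (\<i> * of_int k * of_real \<xi>)) (at (of_real \<xi>))"
      using False by (auto intro!: derivative_eq_intros)
    from has_vector_derivative_real_field[OF this] show ?thesis .
  qed
  have "exp (\<i> * of_int k * of_real (a + 2 * pi)) = exp (\<i> * of_int k * of_real a) * exp (2 * of_int k * of_real pi * \<i>)"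
    by (simp add: algebra_simps flip: exp_add)
  also have "exp (2 * of_int k * of_real pi * \<i>) = 1" using exp_integer_2pi[of "of_int k"] by simp
  finally have "exp (\<i> * of_int k * of_real (a + 2 * pi)) = exp (\<i> * of_int k * of_real a)" by simp
  with fundamental_theorem_of_calculus[OF _ d, of a "a + 2 * pi"] False pi_gt_zero show ?thesis by simp
qed

lemma conv_power_Suc:
  assumes "finite (supp \<phi>)"
  shows "conv_power \<phi> (Suc n) x = (\<Sum>y\<in>supp \<phi>. conv_power \<phi> n (x - y) * \<phi> y)"
proof (cases n)
  case 0
  have "(\<Sum>y\<in>supp \<phi>. conv_power \<phi> 0 (x - y) * \<phi> y) = (\<Sum>y\<in>supp \<phi>. if y = x then \<phi> y else 0)"
    by (intro sum.cong) auto
  then show ?thesis using 0 assms by simp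
next
  case (Suc k)
  have "conv_power \<phi> (Suc n) x = infsum (\<lambda>y. conv_power \<phi> n (x - y) * \<phi> y) (supp \<phi>)"
    unfolding Suc conv_power.simps by (intro infsum_cong_neutral) auto
  then show ?thesis using assms by simp
qed

lemma finite_supp_conv_power:
  assumes "finite (supp \<phi>)"
  shows "finite (supp (conv_power \<phi> n))"
proof (induction n)
  case 0
  have "supp (conv_power \<phi> 0) = {0}" by auto
  then show ?case by simp
next
  case (Suc n)
  have "supp (conv_power \<phi> (Suc n)) \<subseteq> (\<lambda>(y, z). y + z) ` (supp \<phi> \<times> supp (conv_power \<phi> n))"
  proof
    fix x assume "x \<in> supp (conv_power \<phi> (Suc n))"
    then obtain y where "y \<in> supp \<phi>" "conv_power \<phi> n (x - y) * \<phi> y \<noteq> 0"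
      unfolding mem_Collect_eq conv_power_Suc[OF assms] by (elim sum.not_neutral_contains_not_neutral) blast
    then show "x \<in> (\<lambda>(y, z). y + z) ` (supp \<phi> \<times> supp (conv_power \<phi> n))"
      by (intro image_eqI[of _ _ "(y, x - y)"]) auto
  qed
  then show ?case by (rule finite_subset) (intro finite_imageI finite_cartesian_product assms Suc)
qed

text \<open>
  Fourier inversion over an arbitrary period; the freedom in a is used to keep the points of \<Omega> away
  from the ends of the interval, and later to centre it at a single point.
\<close>

lemma conv_power_integral:
  assumes "finite (supp \<phi>)"
  shows "((\<lambda>\<xi>. fourier \<phi> \<xi> ^ n * exp (- \<i> * of_int x * of_real \<xi>)) has_integral
    (2 * of_real pi * conv_power \<phi> n x)) {a..a + 2 * pi}"
proof (induction n arbitrary: x)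
  case 0
  show ?case using has_integral_character[of "- x" a] by (cases "x = 0") simp_all
next
  case (Suc n)
  have "((\<lambda>\<xi>. \<Sum>y\<in>supp \<phi>. \<phi> y * (fourier \<phi> \<xi> ^ n * exp (- \<i> * of_int (x - y) * of_real \<xi>))) has_integral
    (\<Sum>y\<in>supp \<phi>. \<phi> y * (2 * of_real pi * conv_power \<phi> n (x - y)))) {a..a + 2 * pi}"
    by (rule has_integral_sum[OF assms has_integral_mult_right[OF Suc]])
  moreover have "(\<Sum>y\<in>supp \<phi>. \<phi> y * (fourier \<phi> \<xi> ^ n * exp (- \<i> * of_int (x - y) * of_real \<xi>))) =
      fourier \<phi> \<xi> ^ Suc n * exp (- \<i> * of_int x * of_real \<xi>)" for \<xi>
  proof -
    have "exp (- \<i> * of_int (x - y) * of_real \<xi>) = exp (\<i> * of_int y * of_real \<xi>) * exp (- \<i> * of_int x * of_real \<xi>)" for y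
      by (simp add: mult_exp_exp algebra_simps)
    then have "(\<Sum>y\<in>supp \<phi>. \<phi> y * (fourier \<phi> \<xi> ^ n * exp (- \<i> * of_int (x - y) * of_real \<xi>)))
        = (\<Sum>y\<in>supp \<phi>. (\<phi> y * exp (\<i> * of_int y * of_real \<xi>)) * (fourier \<phi> \<xi> ^ n * exp (- \<i> * of_int x * of_real \<xi>)))"
      by (intro sum.cong refl) (simp only: mult_ac)
    also have "\<dots> = fourier \<phi> \<xi> * (fourier \<phi> \<xi> ^ n * exp (- \<i> * of_int x * of_real \<xi>))"
      unfolding sum_distrib_right[symmetric] by (simp add: fourier_eq_ext[OF assms, of \<xi>] fourier_ext_def)
    finally show ?thesis by simp
  qed
  moreover have "(\<Sum>y\<in>supp \<phi>. \<phi> y * (2 * of_real pi * conv_power \<phi> n (x - y))) = 2 * of_real pi * conv_power \<phi> (Suc n) x"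
    unfolding conv_power_Suc[OF assms] by (simp add: sum_distrib_left mult_ac)
  ultimately show ?case by simp
qed

text \<open>
  Both \<alpha> and \<beta> are limits of quantities that are determined by the symbol, which gives uniqueness
  below.
\<close>

lemma log_expansion_limits:
  assumes "log_expansion \<phi> \<xi>0 m \<alpha> \<beta>"
    and E: "E = (\<lambda>\<xi>. Ln (fourier \<phi> (\<xi> + \<xi>0) / fourier \<phi> \<xi>0))"
  shows "((\<lambda>\<xi>. (E \<xi> - \<i> * of_real \<alpha> * of_real \<xi>) / of_real \<xi> ^ m) \<longlongrightarrow> - \<beta>) (at 0)"
    and "((\<lambda>\<xi>. E \<xi> / of_real \<xi>) \<longlongrightarrow> \<i> * of_real \<alpha>) (at 0)"
proof -
  have m: "m \<ge> 2" using assms(1) by (simp add: log_expansion_def)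
  have nz: "\<forall>\<^sub>F \<xi> in at (0::real). \<xi> \<noteq> 0" by (simp add: eventually_at_filter)
  have "((\<lambda>\<xi>. (E \<xi> - (\<i> * of_real \<alpha> * of_real \<xi> - \<beta> * of_real \<xi> ^ m)) / of_real \<xi> ^ m) \<longlongrightarrow> 0) (at 0)"
    using assms(1) unfolding log_expansion_def E by (intro smalloD_tendsto) auto
  then have "((\<lambda>\<xi>. (E \<xi> - (\<i> * of_real \<alpha> * of_real \<xi> - \<beta> * of_real \<xi> ^ m)) / of_real \<xi> ^ m - \<beta>) \<longlongrightarrow> 0 - \<beta>) (at 0)"
    by (intro tendsto_diff tendsto_const)
  then have "((\<lambda>\<xi>. (E \<xi> - (\<i> * of_real \<alpha> * of_real \<xi> - \<beta> * of_real \<xi> ^ m)) / of_real \<xi> ^ m - \<beta>) \<longlongrightarrow> - \<beta>) (at 0)"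
    unfolding diff_0 .
  then show *: "((\<lambda>\<xi>. (E \<xi> - \<i> * of_real \<alpha> * of_real \<xi>) / of_real \<xi> ^ m) \<longlongrightarrow> - \<beta>) (at 0)"
  proof (rule Lim_transform_eventually)
    show "\<forall>\<^sub>F \<xi> in at 0. (E \<xi> - (\<i> * of_real \<alpha> * of_real \<xi> - \<beta> * of_real \<xi> ^ m)) / of_real \<xi> ^ m - \<beta>
        = (E \<xi> - \<i> * of_real \<alpha> * of_real \<xi>) / of_real \<xi> ^ m"
      using nz by eventually_elim (simp add: diff_divide_distrib)
  qed
  have "((\<lambda>\<xi>. of_real \<xi> ^ (m - 1) * ((E \<xi> - \<i> * of_real \<alpha> * of_real \<xi>) / of_real \<xi> ^ m) + \<i> * of_real \<alpha>)
      \<longlongrightarrow> of_real 0 ^ (m - 1) * (- \<beta>) + \<i> * of_real \<alpha>) (at (0::real))"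
    by (rule tendsto_add[OF tendsto_mult[OF tendsto_power[OF tendsto_of_real[OF tendsto_ident_at]] *] tendsto_const])
  then have "((\<lambda>\<xi>. of_real \<xi> ^ (m - 1) * ((E \<xi> - \<i> * of_real \<alpha> * of_real \<xi>) / of_real \<xi> ^ m) + \<i> * of_real \<alpha>)
      \<longlongrightarrow> \<i> * of_real \<alpha>) (at (0::real))" using m by (simp add: power_0_left)
  then show "((\<lambda>\<xi>. E \<xi> / of_real \<xi>) \<longlongrightarrow> \<i> * of_real \<alpha>) (at 0)"
  proof (rule Lim_transform_eventually)
    obtain j where j: "m = Suc j" using m by (cases m) auto
    show "\<forall>\<^sub>F \<xi> in at 0. of_real \<xi> ^ (m - 1) * ((E \<xi> - \<i> * of_real \<alpha> * of_real \<xi>) / of_real \<xi> ^ m) + \<i> * of_real \<alpha> = E \<xi> / of_real \<xi>"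
      by (rule eventually_mono[OF nz]) (simp add: j field_simps)
  qed
qed

lemma log_expansion_unique:
  assumes 1: "log_expansion \<phi> \<xi>0 m \<alpha> \<beta>" and 2: "log_expansion \<phi> \<xi>0 m' \<alpha>' \<beta>'"
  shows "m' = m \<and> \<alpha>' = \<alpha> \<and> \<beta>' = \<beta>"
proof -
  define E where "E = (\<lambda>\<xi>. Ln (fourier \<phi> (\<xi> + \<xi>0) / fourier \<phi> \<xi>0))"
  note lim = log_expansion_limits[OF _ E_def]
  have \<alpha>: "\<alpha>' = \<alpha>" using LIM_unique[OF lim(2)[OF 1] lim(2)[OF 2]] by simp
  have not_less: "\<not> p < q" if "log_expansion \<phi> \<xi>0 p \<alpha> b" "log_expansion \<phi> \<xi>0 q \<alpha> b'" for p q b b'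
  proof
    assume "p < q"
    have "((\<lambda>\<xi>. of_real \<xi> ^ (q - p) * ((E \<xi> - \<i> * of_real \<alpha> * of_real \<xi>) / of_real \<xi> ^ q)) \<longlongrightarrow> of_real 0 ^ (q - p) * - b') (at (0::real))"
      by (rule tendsto_mult[OF tendsto_power[OF tendsto_of_real[OF tendsto_ident_at]] lim(1)[OF that(2)]])
    moreover have zero: "of_real 0 ^ (q - p) * - b' = 0" using \<open>p < q\<close> by simp
    ultimately have "((\<lambda>\<xi>. of_real \<xi> ^ (q - p) * ((E \<xi> - \<i> * of_real \<alpha> * of_real \<xi>) / of_real \<xi> ^ q)) \<longlongrightarrow> 0) (at (0::real))"
      by (simp only: zero)
    then have "((\<lambda>\<xi>. (E \<xi> - \<i> * of_real \<alpha> * of_real \<xi>) / of_real \<xi> ^ p) \<longlongrightarrow> 0) (at (0::real))"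
    proof (rule Lim_transform_eventually)
      have nz: "\<forall>\<^sub>F \<xi> in at (0::real). \<xi> \<noteq> 0" by (simp add: eventually_at_filter)
      have q: "of_real \<xi> ^ q = of_real \<xi> ^ (q - p) * (of_real \<xi> ^ p :: complex)" for \<xi> :: real
        using \<open>p < q\<close> by (simp flip: power_add)
      show "\<forall>\<^sub>F \<xi> in at 0. of_real \<xi> ^ (q - p) * ((E \<xi> - \<i> * of_real \<alpha> * of_real \<xi>) / of_real \<xi> ^ q)
          = (E \<xi> - \<i> * of_real \<alpha> * of_real \<xi>) / of_real \<xi> ^ p"
        by (rule eventually_mono[OF nz]) (simp add: q)
    qed
    from LIM_unique[OF this lim(1)[OF that(1)]] that(1) show False by (simp add: log_expansion_def)
  qed
  have "m' = m" using not_less[OF 1 2[unfolded \<alpha>]] not_less[OF 2[unfolded \<alpha>] 1] by simp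
  from LIM_unique[OF lim(1)[OF 1] lim(1)[OF 2[unfolded \<alpha> \<open>m' = m\<close>]]] have "\<beta>' = \<beta>" by simp
  with \<alpha> \<open>m' = m\<close> show ?thesis by simp
qed

lemma expansion_data_eq:
  assumes "log_expansion \<phi> \<xi>0 m \<alpha> \<beta>"
  shows "expansion_data \<phi> \<xi>0 = (m, \<alpha>, \<beta>)"
  unfolding expansion_data_def
proof (rule the_equality)
  show "case (m, \<alpha>, \<beta>) of (m, \<alpha>, \<beta>) \<Rightarrow> log_expansion \<phi> \<xi>0 m \<alpha> \<beta>" using assms by simp
  fix p assume *: "case p of (m, \<alpha>, \<beta>) \<Rightarrow> log_expansion \<phi> \<xi>0 m \<alpha> \<beta>"
  obtain m' \<alpha>' \<beta>' where p: "p = (m', \<alpha>', \<beta>')" by (cases p)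
  from * have "log_expansion \<phi> \<xi>0 m' \<alpha>' \<beta>'" by (simp add: p)
  from log_expansion_unique[OF assms this] show "p = (m, \<alpha>, \<beta>)" by (simp add: p)
qed

lemma expansion_at_eq:
  assumes "log_expansion \<phi> \<xi>0 m \<alpha> \<beta>"
  shows "m_at \<phi> \<xi>0 = m" "alpha_at \<phi> \<xi>0 = \<alpha>" "beta_at \<phi> \<xi>0 = \<beta>"
  using expansion_data_eq[OF assms] by (simp_all add: m_at_def alpha_at_def beta_at_def)

locale normalized_symbol =
  fixes \<phi> :: "int \<Rightarrow> complex"
  assumes admissible: "admissible_support \<phi>"
    and sup_eq_1: "(SUP \<xi>. cmod (fourier \<phi> \<xi>)) = 1"
begin

lemma finite_supp: "finite (supp \<phi>)"
  using admissible by (simp add: admissible_support_def)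

lemma fourier_ext: "fourier \<phi> \<xi> = fourier_ext \<phi> (of_real \<xi>)"
  by (rule fourier_eq_ext[OF finite_supp])

lemma continuous_on_fourier: "continuous_on S (fourier \<phi>)"
  unfolding fourier_ext fourier_ext_def by (intro continuous_intros)

lemma cmod_fourier_le_1: "cmod (fourier \<phi> \<xi>) \<le> 1"
proof -
  have "cmod (fourier \<phi> \<xi>) \<le> (\<Sum>x\<in>supp \<phi>. cmod (\<phi> x))" for \<xi>
    unfolding fourier_ext fourier_ext_def by (rule norm_sum[THEN order_trans]) (simp add: norm_mult)
  then have "bdd_above (range (\<lambda>\<xi>. cmod (fourier \<phi> \<xi>)))" by (auto intro!: bdd_aboveI)
  then show ?thesis using cSUP_upper[of \<xi> UNIV "\<lambda>\<xi>. cmod (fourier \<phi> \<xi>)"] sup_eq_1 by simp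
qed

lemma fourier_periodic: "fourier \<phi> (\<xi> + 2 * pi * of_int k) = fourier \<phi> \<xi>"
proof -
  have "exp (\<i> * of_int x * of_real (\<xi> + 2 * pi * of_int k)) = exp (\<i> * of_int x * of_real \<xi>)" for x
  proof -
    have "exp (\<i> * of_int x * of_real (\<xi> + 2 * pi * of_int k)) = exp (\<i> * of_int x * of_real \<xi>) * exp (2 * of_int (x * k) * of_real pi * \<i>)"
      by (simp add: algebra_simps flip: exp_add)
    moreover have "exp (2 * of_int (x * k) * of_real pi * \<i>) = 1"
      using exp_integer_2pi[of "of_int (x * k)"] by simp
    ultimately show ?thesis by simp
  qed
  then show ?thesis unfolding fourier_ext fourier_ext_def by simp
qed

text \<open>
  The supremum over the line is attained on a closed period; if this happens only at the left end
  point -\<pi>, the point \<pi> takes its place.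
\<close>

lemma Omega_nonempty: "Omega \<phi> \<noteq> {}"
proof -
  have "continuous_on {-pi..pi} (\<lambda>\<xi>. cmod (fourier \<phi> \<xi>))" by (intro continuous_intros continuous_on_fourier)
  from continuous_attains_sup[OF compact_Icc _ this] pi_gt_zero
  obtain \<xi>1 where \<xi>1: "\<xi>1 \<in> {-pi..pi}" "\<And>\<xi>. \<xi> \<in> {-pi..pi} \<Longrightarrow> cmod (fourier \<phi> \<xi>) \<le> cmod (fourier \<phi> \<xi>1)"
    by (auto simp del: atLeastAtMost_iff)
  have "cmod (fourier \<phi> \<xi>) \<le> cmod (fourier \<phi> \<xi>1)" for \<xi>
  proof -
    \<comment> \<open>The number of periods by which \<xi> has to be shifted into the half-open interval.\<close>
    define k where "k = \<lceil>(\<xi> - pi) / (2 * pi)\<rceil>"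
    have "(\<xi> - pi) / (2 * pi) \<le> of_int k" "of_int k < (\<xi> - pi) / (2 * pi) + 1"
      unfolding k_def by linarith+
    then have "\<xi> + 2 * pi * of_int (- k) \<in> {-pi..pi}"
      using pi_gt_zero by (auto simp: field_simps)
    from \<xi>1(2)[OF this] show ?thesis unfolding fourier_periodic .
  qed
  then have "cmod (fourier \<phi> \<xi>1) \<ge> 1" unfolding sup_eq_1[symmetric] by (intro cSUP_least) auto
  then have *: "cmod (fourier \<phi> \<xi>1) = 1" using cmod_fourier_le_1[of \<xi>1] by simp
  show ?thesis
  proof (cases "\<xi>1 = - pi")
    case True
    then have "pi \<in> Omega \<phi>" using fourier_periodic[of "- pi" 1] * pi_gt_zero by (simp add: Omega_def)
    then show ?thesis by blast
  next
    case False
    then have "\<xi>1 \<in> Omega \<phi>" using \<xi>1 * by (simp add: Omega_def)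
    then show ?thesis by blast
  qed
qed

lemma fourier_square:
  "of_real ((cmod (fourier \<phi> \<xi>))\<^sup>2) =
     (\<Sum>(x, y)\<in>supp \<phi> \<times> supp \<phi>. \<phi> x * cnj (\<phi> y) * exp (\<i> * of_int (x - y) * of_real \<xi>))"
proof -
  have "of_real ((cmod (fourier \<phi> \<xi>))\<^sup>2) = fourier \<phi> \<xi> * cnj (fourier \<phi> \<xi>)" by (rule complex_norm_square)
  also have "\<dots> = (\<Sum>(x, y)\<in>supp \<phi> \<times> supp \<phi>. \<phi> x * cnj (\<phi> y) * exp (\<i> * of_int (x - y) * of_real \<xi>))"
    unfolding fourier_ext fourier_ext_def cnj_sum sum_product sum.cartesian_product
    by (intro sum.cong) (auto simp: exp_cnj mult_exp_exp algebra_simps)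
  finally show ?thesis .
qed

text \<open>
  The Fourier coefficient of |F|^2 at the largest frequency difference M - L is \<phi>(M) times the
  conjugate of \<phi>(L), where L < M are the extreme points of the support. It does not vanish, so |F|^2
  is not constant.
\<close>

lemma cmod_fourier_not_constant: "\<exists>\<xi>. cmod (fourier \<phi> \<xi>) \<noteq> 1"
proof (rule ccontr)
  assume "\<not> ?thesis"
  then have one: "cmod (fourier \<phi> \<xi>) = 1" for \<xi> by blast
  define M where "M = Max (supp \<phi>)"
  define L where "L = Min (supp \<phi>)"
  have card: "card (supp \<phi>) > 1" using admissible by (simp add: admissible_support_def)
  then have ne: "supp \<phi> \<noteq> {}" using card.empty by (metis not_less_zero)
  have M: "M \<in> supp \<phi>" and L: "L \<in> supp \<phi>" unfolding M_def L_def using Max_in[OF finite_supp ne] Min_in[OF finite_supp ne] by blast+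
  have le: "L \<le> x" "x \<le> M" if "x \<in> supp \<phi>" for x unfolding M_def L_def using finite_supp that by auto
  have "L \<noteq> M"
  proof
    assume "L = M"
    then have "supp \<phi> \<subseteq> {M}" using le by force
    then show False using card card_mono[of "{M}" "supp \<phi>"] by simp
  qed
  define D where "D = M - L"
  have sq: "(\<Sum>(x, y)\<in>supp \<phi> \<times> supp \<phi>. \<phi> x * cnj (\<phi> y) * exp (\<i> * of_int (x - y - D) * of_real \<xi>))
      = exp (\<i> * of_int (- D) * of_real \<xi>)" for \<xi>
  proof -
    have "1 = (\<Sum>(x, y)\<in>supp \<phi> \<times> supp \<phi>. \<phi> x * cnj (\<phi> y) * exp (\<i> * of_int (x - y) * of_real \<xi>))"
      using one[of \<xi>] fourier_square[of \<xi>] by simp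
    then have "exp (\<i> * of_int (- D) * of_real \<xi>) = exp (\<i> * of_int (- D) * of_real \<xi>) *
      (\<Sum>(x, y)\<in>supp \<phi> \<times> supp \<phi>. \<phi> x * cnj (\<phi> y) * exp (\<i> * of_int (x - y) * of_real \<xi>))" by simp
    also have "\<dots> = (\<Sum>(x, y)\<in>supp \<phi> \<times> supp \<phi>. \<phi> x * cnj (\<phi> y) * exp (\<i> * of_int (x - y - D) * of_real \<xi>))"
      unfolding sum_distrib_left
      by (intro sum.cong) (auto simp: mult_exp_exp algebra_simps)
    finally show ?thesis by simp
  qed
  have "((\<lambda>\<xi>. \<Sum>(x, y)\<in>supp \<phi> \<times> supp \<phi>. \<phi> x * cnj (\<phi> y) * exp (\<i> * of_int (x - y - D) * of_real \<xi>)) has_integral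
    (\<Sum>(x, y)\<in>supp \<phi> \<times> supp \<phi>. \<phi> x * cnj (\<phi> y) * (if x - y - D = 0 then 2 * of_real pi else 0))) {0..0 + 2 * pi}"
    unfolding split_beta
    by (rule has_integral_sum[OF finite_cartesian_product[OF finite_supp finite_supp]
          has_integral_mult_right[OF has_integral_character]])
  then have "((\<lambda>\<xi>. exp (\<i> * of_int (- D) * of_real \<xi>)) has_integral
    (\<Sum>(x, y)\<in>supp \<phi> \<times> supp \<phi>. \<phi> x * cnj (\<phi> y) * (if x - y - D = 0 then 2 * of_real pi else 0))) {0..0 + 2 * pi}"
    unfolding sq .
  from has_integral_unique[OF this has_integral_character]
  have "(\<Sum>(x, y)\<in>supp \<phi> \<times> supp \<phi>. \<phi> x * cnj (\<phi> y) * (if x - y - D = 0 then 2 * of_real pi else 0)) = 0"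
    using \<open>L \<noteq> M\<close> by (simp add: D_def)
  also have "(\<Sum>(x, y)\<in>supp \<phi> \<times> supp \<phi>. \<phi> x * cnj (\<phi> y) * (if x - y - D = 0 then 2 * of_real pi else 0))
      = (\<Sum>p\<in>supp \<phi> \<times> supp \<phi>. if p = (M, L) then \<phi> M * cnj (\<phi> L) * (2 * of_real pi) else 0)"
  proof (intro sum.cong refl)
    fix p assume p: "p \<in> supp \<phi> \<times> supp \<phi>"
    obtain x y where xy: "p = (x, y)" by fastforce
    have "x - y - D = 0 \<longleftrightarrow> x = M \<and> y = L"
      using le[of x] le[of y] p unfolding xy D_def by auto
    then show "(case p of (x, y) \<Rightarrow> \<phi> x * cnj (\<phi> y) * (if x - y - D = 0 then 2 * of_real pi else 0))
        = (if p = (M, L) then \<phi> M * cnj (\<phi> L) * (2 * of_real pi) else 0)" unfolding xy by auto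
  qed
  also have "\<dots> = \<phi> M * cnj (\<phi> L) * (2 * of_real pi)"
    using M L finite_supp by (simp add: sum.delta')
  finally show False using M L by simp
qed

text \<open>
  |F|^2 - 1 extends to an entire function Q, and an accumulation point of zeros would force Q = 0.
\<close>

lemma finite_Omega: "finite (Omega \<phi>)"
proof (rule ccontr)
  assume inf: "infinite (Omega \<phi>)"
  define Q where "Q = (\<lambda>z. (\<Sum>(x, y)\<in>supp \<phi> \<times> supp \<phi>. \<phi> x * cnj (\<phi> y) * exp (\<i> * of_int (x - y) * z)) - 1)"
  have Q: "Q (of_real \<xi>) = of_real ((cmod (fourier \<phi> \<xi>))\<^sup>2) - 1" for \<xi>
    unfolding Q_def fourier_square ..
  have "Q holomorphic_on UNIV" unfolding Q_def split_beta by (intro holomorphic_intros)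
  moreover obtain \<xi> where "\<xi> islimpt (of_real ` Omega \<phi> :: complex set)"
  proof -
    have "infinite (of_real ` Omega \<phi> :: complex set)"
      using inf by (simp add: finite_image_iff inj_on_def)
    moreover have "of_real ` Omega \<phi> \<subseteq> cball (0::complex) pi" by (auto simp: Omega_def)
    ultimately show ?thesis using that compact_cball[of "0::complex" pi] unfolding compact_eq_Bolzano_Weierstrass by blast
  qed
  moreover have "Q z = 0" if "z \<in> of_real ` Omega \<phi>" for z
    using that Q by (auto simp: Omega_def)
  ultimately have "Q w = 0" for w
    using analytic_continuation[of Q UNIV "of_real ` Omega \<phi>" \<xi> w] by auto
  then have "(cmod (fourier \<phi> \<xi>))\<^sup>2 = 1" for \<xi> using Q[of \<xi>] by (metis eq_iff_diff_eq_0 of_real_eq_1_iff)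
  then have "cmod (fourier \<phi> \<xi>) = 1" for \<xi> by (metis norm_ge_zero power2_eq_1_iff neg_0_le_iff_le not_one_le_zero)
  then show False using cmod_fourier_not_constant by blast
qed

text \<open>
  Let G be the logarithm of the normalised symbol and a z its linear part. Since Re G has a maximum
  at 0 along the real axis, a is purely imaginary. If g(z) = G(z) - a z vanished identically,
  |F| would be 1 on an interval, contrary to the finiteness of \<Omega>; so g(z) = z^m h(z) with h(0) \<noteq> 0,
  and m \<ge> 2 because the linear part has been removed.
\<close>

lemma expansion_exists:
  assumes "\<xi>0 \<in> Omega \<phi>"
  obtains m \<alpha> \<beta> h r where "boundary_phase m \<beta> h r" "log_expansion \<phi> \<xi>0 m \<alpha> \<beta>"
    "\<And>t::real. \<bar>t\<bar> < r \<Longrightarrow> fourier \<phi> (\<xi>0 + t) =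
       fourier \<phi> \<xi>0 * exp (\<i> * of_real \<alpha> * of_real t + of_real t ^ m * h (of_real t))"
proof -
  have F1: "cmod (fourier \<phi> \<xi>0) = 1" and \<xi>0: "- pi < \<xi>0" "\<xi>0 \<le> pi" using assms by (auto simp: Omega_def)
  then have F0: "fourier \<phi> \<xi>0 \<noteq> 0" by auto
  define q where "q = (\<lambda>z. fourier_ext \<phi> (z + of_real \<xi>0) / fourier \<phi> \<xi>0)"
  have q_real: "q (of_real t) = fourier \<phi> (\<xi>0 + t) / fourier \<phi> \<xi>0" for t
    by (simp add: q_def fourier_ext add.commute)
  have q0: "q 0 = 1" using F0 by (simp add: q_def fourier_ext)
  have q_le: "cmod (q (of_real t)) \<le> 1" for t
    using cmod_fourier_le_1[of "\<xi>0 + t"] by (simp add: q_real norm_divide F1)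
  have holq: "q holomorphic_on S" for S
  proof -
    have "fourier_ext \<phi> \<circ> (\<lambda>z. z + of_real \<xi>0) holomorphic_on S"
      by (intro holomorphic_on_compose holomorphic_intros holomorphic_fourier_ext)
    then show ?thesis unfolding q_def using F0 by (intro holomorphic_intros) (auto simp: o_def)
  qed
  have "isCont q 0" using holomorphic_on_imp_continuous_on[OF holq[of UNIV]] by (simp add: continuous_on_eq_continuous_at)
  from this[unfolded continuous_at_eps_delta dist_norm, rule_format, of 1]
  obtain r0 where r0: "r0 > 0" "\<And>z. cmod z < r0 \<Longrightarrow> cmod (q z - q 0) < 1" by auto
  have Re_q: "Re (q z) > 0" if "cmod z < r0" for z
  proof -
    have "\<bar>Re (q z - 1)\<bar> < 1" using r0(2)[OF that] abs_Re_le_cmod[of "q z - 1"] unfolding q0 by linarith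
    then show ?thesis by simp
  qed
  define G where "G = (\<lambda>z. Ln (q z))"
  have holG: "G holomorphic_on ball 0 r0"
    unfolding G_def
    by (rule holomorphic_on_Ln'[OF _ holq]) (use Re_q in \<open>fastforce simp: complex_nonpos_Reals_iff\<close>)
  have expG: "exp (G z) = q z" if "cmod z < r0" for z
    unfolding G_def using Re_q[OF that] by (intro exp_Ln) auto
  have G0: "G 0 = 0" by (simp add: G_def q0)
  have ReG: "Re (G (of_real t)) \<le> 0" if "\<bar>t\<bar> < r0" for t
  proof -
    have "exp (Re (G (of_real t))) = cmod (exp (G (of_real t)))" by simp
    also have "\<dots> \<le> 1" using q_le[of t] expG[of "of_real t"] that by simp
    finally show ?thesis by simp
  qed
  define a where "a = deriv G 0"
  have dG: "(G has_field_derivative a) (at 0)"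
    unfolding a_def using holG r0 by (intro holomorphic_derivI[of G "ball 0 r0"]) auto
  have Rea: "Re a = 0"
  proof -
    have "((\<lambda>t. G (of_real t)) has_vector_derivative a) (at 0)"
      using has_vector_derivative_real_field[of G a 0 UNIV] dG by simp
    from bounded_linear.has_vector_derivative[OF bounded_linear_Re this]
    have "((\<lambda>t. Re (G (of_real t))) has_field_derivative Re a) (at 0)"
      by (simp add: has_real_derivative_iff_has_vector_derivative)
    then show ?thesis by (rule DERIV_local_max[OF _ r0(1)]) (use ReG G0 in auto)
  qed
  define \<alpha> where "\<alpha> = Im a"
  have a: "a = \<i> * of_real \<alpha>" using Rea by (simp add: complex_eq_iff \<alpha>_def)
  define g where "g = (\<lambda>z. G z - a * z)"
  have holg: "g holomorphic_on ball 0 r0" unfolding g_def by (intro holomorphic_intros holG)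
  have dg: "(g has_field_derivative 0) (at 0)" unfolding g_def by (auto intro!: derivative_eq_intros dG)
  have g0: "g 0 = 0" by (simp add: g_def G0)
  have nonconst: "\<not> g constant_on ball 0 r0"
  proof
    assume "g constant_on ball 0 r0"
    then obtain c where c: "\<And>z. z \<in> ball 0 r0 \<Longrightarrow> g z = c" unfolding constant_on_def by blast
    have "g z = 0" if "cmod z < r0" for z using c[of z] c[of 0] that g0 r0(1) by simp
    then have G_lin: "G z = a * z" if "cmod z < r0" for z using that by (simp add: g_def)
    have *: "cmod (fourier \<phi> (\<xi>0 + t)) = 1" if "\<bar>t\<bar> < r0" for t
    proof -
      have "cmod (q (of_real t)) = cmod (exp (G (of_real t)))" using expG[of "of_real t"] that by simp
      also have "\<dots> = 1" using G_lin[of "of_real t"] that Rea by simp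
      finally show ?thesis by (simp add: q_real norm_divide F1)
    qed
    \<comment> \<open>Left of \<open>\<xi>0\<close>, since \<open>\<xi>0\<close> may be the right end point \<open>\<pi>\<close> of the period.\<close>
    have "{max (\<xi>0 - r0) (- pi)<..<\<xi>0} \<subseteq> Omega \<phi>"
    proof
      fix \<xi> assume "\<xi> \<in> {max (\<xi>0 - r0) (- pi)<..<\<xi>0}"
      then show "\<xi> \<in> Omega \<phi>" using *[of "\<xi> - \<xi>0"] \<xi>0 by (auto simp: Omega_def)
    qed
    moreover have "infinite {max (\<xi>0 - r0) (- pi)<..<\<xi>0}" using r0 \<xi>0 by (intro infinite_Ioo) auto
    ultimately show False using finite_Omega infinite_super by blast
  qed
  have z: "0 \<in> ball 0 r0" using r0(1) by simp
  obtain h r m where mh: "0 < m" "0 < r" "ball (0::complex) r \<subseteq> ball 0 r0" "h holomorphic_on ball 0 r"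
    "\<And>w. w \<in> ball 0 r \<Longrightarrow> g w = (w - 0) ^ m * h w" "\<And>w. w \<in> ball 0 r \<Longrightarrow> h w \<noteq> 0"
  proof (rule holomorphic_factor_zero_nonconstant[OF holg open_ball connected_ball z g0 nonconst])
    fix h r m
    assume "0 < m" "0 < r" "ball (0::complex) r \<subseteq> ball 0 r0" "h holomorphic_on ball 0 r"
      "\<And>w. w \<in> ball 0 r \<Longrightarrow> g w = (w - 0) ^ m * h w" "\<And>w. w \<in> ball 0 r \<Longrightarrow> h w \<noteq> 0"
    then show thesis by (rule that)
  qed
  have r_le: "r \<le> r0" using mh(2,3) by (simp add: ball_subset_ball_iff)
  have conth: "isCont h 0"
    using mh(2,4) by (metis centre_in_ball continuous_on_interior holomorphic_on_imp_continuous_on interior_ball)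
  have "m \<noteq> 1"
  proof
    assume "m = 1"
    have "(\<lambda>w. (g w - g 0) / (w - 0)) \<midarrow>0\<rightarrow> 0" using dg by (simp add: has_field_derivative_iff)
    moreover have "(\<lambda>w. (g w - g 0) / (w - 0)) \<midarrow>0\<rightarrow> h 0"
    proof (rule Lim_transform_eventually)
      show "(h \<longlongrightarrow> h 0) (at 0)" using conth by (simp add: isCont_def)
      have "\<forall>\<^sub>F w in at 0. w \<in> ball 0 r - {0}" using mh(2) by (intro eventually_at_in_open) auto
      then show "\<forall>\<^sub>F w in at 0. h w = (g w - g 0) / (w - 0)"
        by eventually_elim (use mh(5) g0 \<open>m = 1\<close> in auto)
    qed
    ultimately have "h 0 = 0" by (rule LIM_unique[symmetric])
    then show False using mh(2,6) by auto
  qed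
  then have m2: "m \<ge> 2" using mh(1) by simp
  define \<beta> where "\<beta> = - h 0"
  have G_eq: "G (of_real t) = \<i> * of_real \<alpha> * of_real t + of_real t ^ m * h (of_real t)" if "\<bar>t\<bar> < r" for t
    using mh(5)[of "of_real t"] that by (simp add: g_def a algebra_simps)
  have bp: "boundary_phase m \<beta> h r"
  proof
    show "Re (of_real t ^ m * h (of_real t)) \<le> 0" if "\<bar>t\<bar> < r" for t
      using ReG[of t] G_eq[OF that] that r_le by simp
  qed (use m2 mh in \<open>auto simp: \<beta>_def\<close>)
  have exp: "fourier \<phi> (\<xi>0 + t) =
       fourier \<phi> \<xi>0 * exp (\<i> * of_real \<alpha> * of_real t + of_real t ^ m * h (of_real t))" if "\<bar>t\<bar> < r" for t
    using expG[of "of_real t"] G_eq[OF that] q_real[of t] F0 that r_le by (simp add: field_simps)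
  have "(\<lambda>\<xi>. Ln (fourier \<phi> (\<xi> + \<xi>0) / fourier \<phi> \<xi>0)
            - (\<i> * of_real \<alpha> * of_real \<xi> - \<beta> * of_real \<xi> ^ m)) \<in> o[at 0](\<lambda>\<xi>. of_real \<xi> ^ m)"
  proof (rule smalloI_tendsto)
    have small: "\<forall>\<^sub>F \<xi> in at (0::real). \<xi> \<in> {-r<..<r} - {0}" using mh(2) by (intro eventually_at_in_open) auto
    then show "\<forall>\<^sub>F \<xi> in at (0::real). of_real \<xi> ^ m \<noteq> (0::complex)" by eventually_elim auto
    have "((\<lambda>\<xi>. h (of_real \<xi>) - h 0) \<longlongrightarrow> - \<beta> - h 0) (at (0::real))"
      by (intro tendsto_intros boundary_phase.tendsto_h_0[OF bp])
    then have "((\<lambda>\<xi>. h (of_real \<xi>) - h 0) \<longlongrightarrow> 0) (at (0::real))" by (simp add: \<beta>_def)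
    then show "((\<lambda>\<xi>. (Ln (fourier \<phi> (\<xi> + \<xi>0) / fourier \<phi> \<xi>0)
            - (\<i> * of_real \<alpha> * of_real \<xi> - \<beta> * of_real \<xi> ^ m)) / of_real \<xi> ^ m) \<longlongrightarrow> 0) (at 0)"
    proof (rule Lim_transform_eventually)
      show "\<forall>\<^sub>F \<xi> in at 0. h (of_real \<xi>) - h 0 = (Ln (fourier \<phi> (\<xi> + \<xi>0) / fourier \<phi> \<xi>0)
            - (\<i> * of_real \<alpha> * of_real \<xi> - \<beta> * of_real \<xi> ^ m)) / of_real \<xi> ^ m"
        using small
      proof eventually_elim
        case (elim \<xi>)
        then have "Ln (fourier \<phi> (\<xi> + \<xi>0) / fourier \<phi> \<xi>0) = \<i> * of_real \<alpha> * of_real \<xi> + of_real \<xi> ^ m * h (of_real \<xi>)"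
          using G_eq[of \<xi>] q_real[of \<xi>] by (auto simp: G_def add.commute)
        then show ?case using elim by (simp add: \<beta>_def field_simps)
      qed
    qed
  qed
  then have "log_expansion \<phi> \<xi>0 m \<alpha> \<beta>"
    using m2 boundary_phase.Re_beta_nonneg[OF bp] boundary_phase.Re_beta_odd[OF bp] boundary_phase.beta_nonzero[OF bp]
    by (simp add: log_expansion_def)
  with bp exp show ?thesis using that by blast
qed

lemma local_expansion:
  assumes "\<xi>0 \<in> Omega \<phi>"
  obtains h r where "boundary_phase (m_at \<phi> \<xi>0) (beta_at \<phi> \<xi>0) h r"
    "\<And>t::real. \<bar>t\<bar> < r \<Longrightarrow> fourier \<phi> (\<xi>0 + t) =
       fourier \<phi> \<xi>0 * exp (\<i> * of_real (alpha_at \<phi> \<xi>0) * of_real t + of_real t ^ m_at \<phi> \<xi>0 * h (of_real t))"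
  using expansion_exists[OF assms] expansion_at_eq by (metis (lifting))

end

section \<open>Localization at the points of Omega\<close>

lemma root_powr:
  assumes "n \<ge> 1" "m \<ge> 1"
  shows "0 < real n powr (1 / real m)" "(real n powr (1 / real m)) ^ m = real n"
    "1 \<le> real n powr (1 / real m)" "real n powr (- 1 / real m) = 1 / real n powr (1 / real m)"
proof -
  show "0 < real n powr (1 / real m)" using assms by simp
  show "(real n powr (1 / real m)) ^ m = real n"
    using assms by (simp add: powr_powr flip: powr_realpow)
  show "1 \<le> real n powr (1 / real m)" using assms by (intro ge_one_powr_ge_zero) auto
  show "real n powr (- 1 / real m) = 1 / real n powr (1 / real m)"
    using powr_minus_divide[of "real n" "1 / real m"] by simp
qed

lemma filterlim_root_powr:
  assumes "m \<ge> 1"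
  shows "filterlim (\<lambda>n. real n powr (1 / real m)) at_top sequentially"
  by (rule filterlim_compose[OF real_powr_at_top filterlim_real_sequentially]) (use assms in auto)

lemma powr_gap_tendsto_0:
  assumes "1 \<le> p" "p < q"
  shows "(\<lambda>n. real n powr (- 1 / real p) / real n powr (- 1 / real q)) \<longlonglongrightarrow> 0"
proof -
  have "1 / real q - 1 / real p < 0" using assms by (simp add: frac_less2)
  then have "(\<lambda>n. real n powr (1 / real q - 1 / real p)) \<longlonglongrightarrow> 0"
    by (rule tendsto_neg_powr[OF _ filterlim_real_sequentially])
  then show ?thesis by (simp flip: powr_diff)
qed

lemma geometric_powr_tendsto_0:
  assumes "0 \<le> \<rho>" "\<rho> < 1" "1 \<le> m"
  shows "(\<lambda>n. \<rho> ^ n / real n powr (- 1 / real m)) \<longlonglongrightarrow> 0"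
proof (rule tendsto_sandwich[of "\<lambda>_. 0"])
  show "(\<lambda>n. real n * \<rho> ^ n) \<longlonglongrightarrow> 0" using powser_times_n_limit_0[of \<rho>] assms by simp
  show "\<forall>\<^sub>F n in sequentially. \<rho> ^ n / real n powr (- 1 / real m) \<le> real n * \<rho> ^ n"
    using eventually_ge_at_top[of 1]
  proof eventually_elim
    case (elim n)
    have "real n powr (1 / real m) \<le> real n powr 1" using elim assms by (intro powr_mono) auto
    then have "\<rho> ^ n * real n powr (1 / real m) \<le> \<rho> ^ n * real n" using assms elim by (intro mult_left_mono) auto
    then show ?case using root_powr(4)[OF elim assms(3)] by (simp add: mult.commute)
  qed
qed (use assms in auto)

context normalized_symbol
begin

definition integrand :: "nat \<Rightarrow> int \<Rightarrow> real \<Rightarrow> complex" where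
  "integrand n x \<xi> = fourier \<phi> \<xi> ^ n * exp (- \<i> * of_int x * of_real \<xi>)"

text \<open>
  The contribution of the interval of radius \<delta> around \<xi> to 2 \<pi> \<phi>^(n)(x).
\<close>

definition peak :: "real \<Rightarrow> real \<Rightarrow> nat \<Rightarrow> int \<Rightarrow> complex" where
  "peak \<delta> \<xi> n x = integral {\<xi> - \<delta>..\<xi> + \<delta>} (integrand n x)"

text \<open>
  The main term of the asymptotic formula that belongs to \<xi>.
\<close>

definition attractor :: "real \<Rightarrow> nat \<Rightarrow> int \<Rightarrow> complex" where
  "attractor \<xi> n x = of_real (real n powr (- 1 / real (m_max \<phi>)))
      * exp (- \<i> * of_int x * of_real \<xi>) * fourier \<phi> \<xi> ^ n
      * H (m_max \<phi>) (beta_at \<phi> \<xi>)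
          ((real_of_int x - alpha_at \<phi> \<xi> * real n) / real n powr (1 / real (m_max \<phi>)))"

lemma continuous_on_integrand: "continuous_on S (integrand n x)"
  unfolding integrand_def[abs_def] by (intro continuous_intros continuous_on_fourier)

lemma integrable_integrand: "integrand n x integrable_on {a..b}"
  by (intro integrable_continuous_real continuous_on_integrand)

lemma cmod_integrand: "cmod (integrand n x \<xi>) = cmod (fourier \<phi> \<xi>) ^ n"
  by (simp add: integrand_def norm_mult norm_power)

lemma integrand_near_peak:
  assumes bp: "boundary_phase m \<beta> h r"
    and F: "fourier \<phi> (\<xi>0 + t) = fourier \<phi> \<xi>0 * exp (\<i> * of_real \<alpha> * of_real t + of_real t ^ m * h (of_real t))"
    and \<nu>: "\<nu> ^ m = real n"
  shows "integrand n x (\<xi>0 + t) = (exp (- \<i> * of_int x * of_real \<xi>0) * fourier \<phi> \<xi>0 ^ n) *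
     exp (boundary_phase.phase m h \<nu> (\<alpha> * real n - of_int x) (of_real t))"
proof -
  have \<nu>': "(of_real \<nu> :: complex) ^ m = of_nat n" using \<nu> by (metis of_real_of_nat_eq of_real_power)
  have "integrand n x (\<xi>0 + t) = fourier \<phi> \<xi>0 ^ n * exp (of_nat n * (\<i> * of_real \<alpha> * of_real t + of_real t ^ m * h (of_real t)))
      * exp (- \<i> * of_int x * of_real (\<xi>0 + t))"
    unfolding integrand_def F by (simp add: power_mult_distrib exp_of_nat_mult)
  also have "\<dots> = fourier \<phi> \<xi>0 ^ n * exp (of_nat n * (\<i> * of_real \<alpha> * of_real t + of_real t ^ m * h (of_real t))
      - \<i> * of_int x * of_real (\<xi>0 + t))"
    by (simp add: mult_exp_exp)
  also have "of_nat n * (\<i> * of_real \<alpha> * of_real t + of_real t ^ m * h (of_real t)) - \<i> * of_int x * of_real (\<xi>0 + t)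
      = - \<i> * of_int x * of_real \<xi>0 + boundary_phase.phase m h \<nu> (\<alpha> * real n - of_int x) (of_real t)"
    unfolding boundary_phase.phase_def[OF bp] power_mult_distrib \<nu>' by (simp add: algebra_simps)
  finally show ?thesis by (simp only: exp_add mult_ac)
qed

lemma peak_eq:
  assumes bp: "boundary_phase m \<beta> h r"
    and F: "\<And>t::real. \<bar>t\<bar> < r \<Longrightarrow> fourier \<phi> (\<xi>0 + t) =
       fourier \<phi> \<xi>0 * exp (\<i> * of_real \<alpha> * of_real t + of_real t ^ m * h (of_real t))"
    and \<nu>: "\<nu> ^ m = real n" and \<delta>: "\<delta> < r"
  shows "peak \<delta> \<xi>0 n x = (exp (- \<i> * of_int x * of_real \<xi>0) * fourier \<phi> \<xi>0 ^ n) *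
     integral {- \<delta>..\<delta>} (\<lambda>t. exp (boundary_phase.phase m h \<nu> (\<alpha> * real n - of_int x) (of_real t)))"
proof -
  have "peak \<delta> \<xi>0 n x = integral {- \<delta>..\<delta>} (\<lambda>t. integrand n x (\<xi>0 + t))"
    using integral_shift_real_ivl[of "\<xi>0 - \<delta>" \<xi>0 "\<xi>0 + \<delta>" "integrand n x"] by (simp add: peak_def add.commute)
  also have "\<dots> = integral {- \<delta>..\<delta>} (\<lambda>t. (exp (- \<i> * of_int x * of_real \<xi>0) * fourier \<phi> \<xi>0 ^ n) *
     exp (boundary_phase.phase m h \<nu> (\<alpha> * real n - of_int x) (of_real t)))"
    by (rule Henstock_Kurzweil_Integration.integral_cong, rule integrand_near_peak[OF bp F \<nu>]) (use \<delta> in auto)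
  finally show ?thesis by simp
qed

lemma peak_bound:
  assumes \<xi>0: "\<xi>0 \<in> Omega \<phi>"
  obtains \<delta>0 C where "0 < \<delta>0" "0 < C"
    "\<And>\<delta> n x. 0 < \<delta> \<Longrightarrow> \<delta> \<le> \<delta>0 \<Longrightarrow> 1 \<le> n \<Longrightarrow> cmod (peak \<delta> \<xi>0 n x) \<le> C * real n powr (- 1 / real (m_at \<phi> \<xi>0))"
proof -
  have F1: "cmod (fourier \<phi> \<xi>0) = 1" using \<xi>0 by (simp add: Omega_def)
  obtain h r where bp: "boundary_phase (m_at \<phi> \<xi>0) (beta_at \<phi> \<xi>0) h r" and
    F: "\<And>t::real. \<bar>t\<bar> < r \<Longrightarrow> fourier \<phi> (\<xi>0 + t) =
       fourier \<phi> \<xi>0 * exp (\<i> * of_real (alpha_at \<phi> \<xi>0) * of_real t + of_real t ^ m_at \<phi> \<xi>0 * h (of_real t))"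
    using local_expansion[OF \<xi>0] by blast
  interpret boundary_phase "m_at \<phi> \<xi>0" "beta_at \<phi> \<xi>0" h r by (rule bp)
  obtain \<delta>0 C where *: "0 < \<delta>0" "\<delta>0 < r" "C > 0"
    "\<And>\<delta> \<nu> s. 0 < \<delta> \<Longrightarrow> \<delta> \<le> \<delta>0 \<Longrightarrow> 0 < \<nu> \<Longrightarrow>
      cmod (integral {- \<delta>..\<delta>} (\<lambda>t. exp (phase \<nu> s (of_real t)))) \<le> C / \<nu>"
    using local_bound by blast
  show ?thesis
  proof (rule that[OF *(1,3)])
    fix \<delta> n x assume a: "0 < \<delta>" "\<delta> \<le> \<delta>0" "1 \<le> (n::nat)"
    note rp = root_powr[OF a(3), of "m_at \<phi> \<xi>0"]
    have m: "m_at \<phi> \<xi>0 \<ge> 1" using m_ge_2 by simp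
    have pe: "peak \<delta> \<xi>0 n x = (exp (- \<i> * of_int x * of_real \<xi>0) * fourier \<phi> \<xi>0 ^ n) *
       integral {- \<delta>..\<delta>} (\<lambda>t. exp (phase (real n powr (1 / real (m_at \<phi> \<xi>0))) (alpha_at \<phi> \<xi>0 * real n - of_int x) (of_real t)))"
      by (rule peak_eq[OF bp _ rp(2)[OF m] order_le_less_trans[OF a(2) *(2)]]) (rule F)
    show "cmod (peak \<delta> \<xi>0 n x) \<le> C * real n powr (- 1 / real (m_at \<phi> \<xi>0))"
      using *(4)[OF a(1,2) rp(1)[OF m], of "alpha_at \<phi> \<xi>0 * real n - of_int x"] *(2) a(2)
      unfolding rp(4)[OF m] pe
      by (simp add: norm_mult norm_power F1)
  qed
qed

lemma peak_asymptotics_max: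
  assumes \<xi>0: "\<xi>0 \<in> max_points \<phi>" and nondeg: "m_max \<phi> > 2 \<or> Re (beta_at \<phi> \<xi>0) > 0"
  obtains \<delta>0 where "0 < \<delta>0"
    "\<And>\<delta> \<epsilon>. 0 < \<delta> \<Longrightarrow> \<delta> \<le> \<delta>0 \<Longrightarrow> 0 < \<epsilon> \<Longrightarrow> \<forall>\<^sub>F n in sequentially. \<forall>x.
       cmod (peak \<delta> \<xi>0 n x - 2 * of_real pi * attractor \<xi>0 n x) \<le> \<epsilon> * real n powr (- 1 / real (m_max \<phi>))"
proof -
  have \<xi>0': "\<xi>0 \<in> Omega \<phi>" and m_eq: "m_at \<phi> \<xi>0 = m_max \<phi>" using \<xi>0 by (auto simp: max_points_def)
  have F1: "cmod (fourier \<phi> \<xi>0) = 1" using \<xi>0' by (simp add: Omega_def)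
  define m where "m = m_max \<phi>"
  define \<beta> where "\<beta> = beta_at \<phi> \<xi>0"
  define \<alpha> where "\<alpha> = alpha_at \<phi> \<xi>0"
  obtain h r where bp: "boundary_phase m \<beta> h r" and
    F: "\<And>t::real. \<bar>t\<bar> < r \<Longrightarrow> fourier \<phi> (\<xi>0 + t) =
       fourier \<phi> \<xi>0 * exp (\<i> * of_real \<alpha> * of_real t + of_real t ^ m * h (of_real t))"
    using local_expansion[OF \<xi>0'] unfolding m_eq m_def[symmetric] \<beta>_def[symmetric] \<alpha>_def[symmetric] by blast
  interpret boundary_phase m \<beta> h r by (rule bp)
  have m: "m \<ge> 1" using m_ge_2 by simp
  obtain \<delta>0 where *: "0 < \<delta>0" "\<delta>0 < r"
    "\<And>\<delta> \<epsilon>. 0 < \<delta> \<Longrightarrow> \<delta> \<le> \<delta>0 \<Longrightarrow> \<epsilon> > 0 \<Longrightarrow> \<exists>N>0. \<forall>\<nu>\<ge>N. \<forall>s.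
      cmod (integral {- \<delta>..\<delta>} (\<lambda>t. exp (phase \<nu> s (of_real t))) - 2 * of_real pi * H m \<beta> (- s / \<nu>) / of_real \<nu>) \<le> \<epsilon> / \<nu>"
    using local_asymptotics[OF nondeg[folded m_def \<beta>_def]] by blast
  show ?thesis
  proof (rule that[OF *(1)])
    fix \<delta> \<epsilon> :: real assume a: "0 < \<delta>" "\<delta> \<le> \<delta>0" "0 < \<epsilon>"
    obtain N where N: "\<And>\<nu> s. \<nu> \<ge> N \<Longrightarrow>
      cmod (integral {- \<delta>..\<delta>} (\<lambda>t. exp (phase \<nu> s (of_real t))) - 2 * of_real pi * H m \<beta> (- s / \<nu>) / of_real \<nu>) \<le> \<epsilon> / \<nu>"
      using *(3)[OF a] by blast
    have "\<forall>\<^sub>F n in sequentially. N \<le> real n powr (1 / real m)"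
      using filterlim_root_powr[OF m] by (simp add: filterlim_at_top)
    then have "\<forall>\<^sub>F n in sequentially. \<forall>x.
       cmod (peak \<delta> \<xi>0 n x - 2 * of_real pi * attractor \<xi>0 n x) \<le> \<epsilon> * real n powr (- 1 / real m)"
      using eventually_ge_at_top[of 1]
    proof eventually_elim
      case (elim n)
      define \<nu> where "\<nu> = real n powr (1 / real m)"
      note rp = root_powr[OF elim(2) m, folded \<nu>_def]
      show ?case
      proof
        fix x
        define E where "E = exp (- \<i> * of_int x * of_real \<xi>0) * fourier \<phi> \<xi>0 ^ n"
        define s where "s = \<alpha> * real n - of_int x"
        have E: "cmod E = 1" by (simp add: E_def norm_mult norm_power F1)
        have "attractor \<xi>0 n x = E * (H m \<beta> (- s / \<nu>) / of_real \<nu>)"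
          unfolding attractor_def m_def[symmetric] \<alpha>_def[symmetric] \<beta>_def[symmetric] rp(4) E_def s_def
          by (simp add: \<nu>_def mult_ac divide_inverse)
        moreover have "peak \<delta> \<xi>0 n x = E * integral {- \<delta>..\<delta>} (\<lambda>t. exp (phase \<nu> s (of_real t)))"
          unfolding E_def s_def by (rule peak_eq[OF bp _ rp(2) order_le_less_trans[OF a(2) *(2)]]) (rule F)
        ultimately have "peak \<delta> \<xi>0 n x - 2 * of_real pi * attractor \<xi>0 n x =
            E * (integral {- \<delta>..\<delta>} (\<lambda>t. exp (phase \<nu> s (of_real t))) - 2 * of_real pi * H m \<beta> (- s / \<nu>) / of_real \<nu>)"
          by (simp add: algebra_simps)
        then show "cmod (peak \<delta> \<xi>0 n x - 2 * of_real pi * attractor \<xi>0 n x) \<le> \<epsilon> * real n powr (- 1 / real m)"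
          using N[of \<nu> s] elim(1) unfolding rp(4) by (simp add: norm_mult E \<nu>_def)
      qed
    qed
    then show "\<forall>\<^sub>F n in sequentially. \<forall>x.
       cmod (peak \<delta> \<xi>0 n x - 2 * of_real pi * attractor \<xi>0 n x) \<le> \<epsilon> * real n powr (- 1 / real (m_max \<phi>))"
      by (simp add: m_def)
  qed
qed

lemma m_at_le_max: "\<xi> \<in> Omega \<phi> \<Longrightarrow> m_at \<phi> \<xi> \<le> m_max \<phi>"
  unfolding m_max_def using finite_Omega by simp

lemma m_at_ge_2: "\<xi> \<in> Omega \<phi> \<Longrightarrow> 2 \<le> m_at \<phi> \<xi>"
  by (rule local_expansion, assumption) (erule boundary_phase.m_ge_2)

lemma max_points_nonempty: "max_points \<phi> \<noteq> {}"
proof -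
  have "m_max \<phi> \<in> m_at \<phi> ` Omega \<phi>"
    unfolding m_max_def using finite_Omega Omega_nonempty by (intro Max_in) auto
  then show ?thesis by (auto simp: max_points_def)
qed

lemma finite_max_points: "finite (max_points \<phi>)"
  using finite_Omega by (simp add: max_points_def)

lemma m_max_ge_2: "2 \<le> m_max \<phi>"
proof -
  obtain \<xi> where "\<xi> \<in> Omega \<phi>" "m_at \<phi> \<xi> = m_max \<phi>"
    using max_points_nonempty by (auto simp: max_points_def)
  then show ?thesis using m_at_ge_2[of \<xi>] by simp
qed

text \<open>
  Points of \<Omega> outside max_points have a smaller order, so their contribution is of strictly smaller
  size than n^(-1/m) for the maximal m.
\<close>

lemma peak_asymptotics:
  assumes \<xi>0: "\<xi>0 \<in> Omega \<phi>" and nondeg: "m_max \<phi> > 2 \<or> (\<forall>\<xi>\<in>max_points \<phi>. Re (beta_at \<phi> \<xi>) > 0)"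
  shows "\<exists>\<delta>0>0. \<forall>\<delta> \<epsilon>. 0 < \<delta> \<longrightarrow> \<delta> \<le> \<delta>0 \<longrightarrow> 0 < \<epsilon> \<longrightarrow> (\<forall>\<^sub>F n in sequentially. \<forall>x.
       cmod (peak \<delta> \<xi>0 n x - (if \<xi>0 \<in> max_points \<phi> then 2 * of_real pi * attractor \<xi>0 n x else 0))
         \<le> \<epsilon> * real n powr (- 1 / real (m_max \<phi>)))"
proof (cases "\<xi>0 \<in> max_points \<phi>")
  case True
  then obtain \<delta>0 where "0 < \<delta>0"
    "\<And>\<delta> \<epsilon>. 0 < \<delta> \<Longrightarrow> \<delta> \<le> \<delta>0 \<Longrightarrow> 0 < \<epsilon> \<Longrightarrow> \<forall>\<^sub>F n in sequentially. \<forall>x.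
       cmod (peak \<delta> \<xi>0 n x - 2 * of_real pi * attractor \<xi>0 n x) \<le> \<epsilon> * real n powr (- 1 / real (m_max \<phi>))"
    using peak_asymptotics_max nondeg by blast
  with True show ?thesis by auto
next
  case False
  obtain \<delta>0 C where *: "0 < \<delta>0" "0 < C"
    "\<And>\<delta> n x. 0 < \<delta> \<Longrightarrow> \<delta> \<le> \<delta>0 \<Longrightarrow> 1 \<le> n \<Longrightarrow> cmod (peak \<delta> \<xi>0 n x) \<le> C * real n powr (- 1 / real (m_at \<phi> \<xi>0))"
    using peak_bound[OF \<xi>0] by blast
  have less: "m_at \<phi> \<xi>0 < m_max \<phi>" using False m_at_le_max[OF \<xi>0] \<xi>0 by (auto simp: max_points_def)
  have lim: "(\<lambda>n. real n powr (- 1 / real (m_at \<phi> \<xi>0)) / real n powr (- 1 / real (m_max \<phi>))) \<longlonglongrightarrow> 0"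
    using powr_gap_tendsto_0[OF _ less] m_at_ge_2[OF \<xi>0] by simp
  have "\<forall>\<^sub>F n in sequentially. \<forall>x. cmod (peak \<delta> \<xi>0 n x) \<le> \<epsilon> * real n powr (- 1 / real (m_max \<phi>))"
    if "0 < \<delta>" "\<delta> \<le> \<delta>0" "0 < \<epsilon>" for \<delta> \<epsilon>
    using order_tendstoD(2)[OF lim divide_pos_pos[OF that(3) *(2)]] eventually_ge_at_top[of 1]
  proof eventually_elim
    case (elim n)
    have "real n powr (- 1 / real (m_max \<phi>)) > 0" using elim by simp
    with elim(1) *(2) have "C * real n powr (- 1 / real (m_at \<phi> \<xi>0)) \<le> \<epsilon> * real n powr (- 1 / real (m_max \<phi>))"
      by (simp add: field_simps)
    then show ?case using *(3)[OF that(1,2) elim(2)] order_trans by blast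
  qed
  then show ?thesis using False *(1) by auto
qed

text \<open>
  With radius d the intervals around the points of \<Omega> are disjoint, and they lie in the window
  [-\<pi> + d, \<pi> + d], even if \<pi> is one of the points.
\<close>

lemma isolating_radius:
  obtains d where "0 < d" "\<And>\<xi>. \<xi> \<in> Omega \<phi> \<Longrightarrow> - pi + 2 * d \<le> \<xi>"
    "\<And>\<xi> \<xi>'. \<xi> \<in> Omega \<phi> \<Longrightarrow> \<xi>' \<in> Omega \<phi> \<Longrightarrow> \<xi> \<noteq> \<xi>' \<Longrightarrow> 2 * d < \<bar>\<xi> - \<xi>'\<bar>"
proof -
  define G where "G = insert 1 ((\<lambda>\<xi>. \<xi> + pi) ` Omega \<phi> \<union> (\<lambda>(\<xi>, \<xi>'). \<bar>\<xi> - \<xi>'\<bar>) ` {(\<xi>, \<xi>') \<in> Omega \<phi> \<times> Omega \<phi>. \<xi> \<noteq> \<xi>'})"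
  have fin: "finite G" unfolding G_def
    by (intro finite.insertI finite_UnI finite_imageI finite_Omega
        finite_subset[OF _ finite_cartesian_product[OF finite_Omega finite_Omega]]) auto
  have pos: "0 < g" if "g \<in> G" for g using that unfolding G_def by (auto simp: Omega_def)
  \<comment> \<open>One third rather than one half makes the separation strict.\<close>
  define d where "d = Min G / 3"
  have ne: "G \<noteq> {}" by (simp add: G_def)
  have d: "d > 0" using pos[OF Min_in[OF fin ne]] by (simp add: d_def)
  have le: "3 * d \<le> g" if "g \<in> G" for g using Min_le[OF fin that] by (simp add: d_def)
  show ?thesis
  proof (rule that[OF d])
    show "- pi + 2 * d \<le> \<xi>" if "\<xi> \<in> Omega \<phi>" for \<xi>
      using le[of "\<xi> + pi"] that d by (simp add: G_def)
    show "2 * d < \<bar>\<xi> - \<xi>'\<bar>" if "\<xi> \<in> Omega \<phi>" "\<xi>' \<in> Omega \<phi>" "\<xi> \<noteq> \<xi>'" for \<xi> \<xi>'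
    proof -
      have "\<bar>\<xi> - \<xi>'\<bar> \<in> G" unfolding G_def using that by (auto intro!: image_eqI[of _ _ "(\<xi>, \<xi>')"])
      from le[OF this] d show ?thesis by simp
    qed
  qed
qed

lemma away_from_peaks:
  assumes "0 < \<delta>" and low: "\<And>\<xi>. \<xi> \<in> Omega \<phi> \<Longrightarrow> - pi + 2 * \<delta> \<le> \<xi>"
  obtains \<rho> where "0 \<le> \<rho>" "\<rho> < 1"
    "\<And>\<eta>. \<eta> \<in> {- pi + \<delta>..pi + \<delta>} \<Longrightarrow> (\<And>\<xi>. \<xi> \<in> Omega \<phi> \<Longrightarrow> \<eta> \<notin> {\<xi> - \<delta>..\<xi> + \<delta>}) \<Longrightarrow> cmod (fourier \<phi> \<eta>) \<le> \<rho>"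
proof -
  define W where "W = {- pi + \<delta>..pi + \<delta>} - (\<Union>\<xi>\<in>Omega \<phi>. {\<xi> - \<delta><..<\<xi> + \<delta>})"
  have "compact W" unfolding W_def by (intro compact_diff compact_Icc open_UN) auto
  have less: "cmod (fourier \<phi> \<eta>) < 1" if "\<eta> \<in> W" for \<eta>
  proof (rule ccontr)
    assume "\<not> ?thesis"
    then have one: "cmod (fourier \<phi> \<eta>) = 1" using cmod_fourier_le_1[of \<eta>] by simp
    show False
    proof (cases "\<eta> \<le> pi")
      case True
      then have "\<eta> \<in> Omega \<phi>" using one that assms(1) by (auto simp: Omega_def W_def)
      then show False using that assms(1) by (auto simp: W_def)
    next
      case False
      \<comment> \<open>Shifted back by one period, \<eta> would be a point of \<Omega> too close to \<open>-\<pi>\<close>.\<close>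
      have "cmod (fourier \<phi> (\<eta> - 2 * pi)) = 1" using fourier_periodic[of \<eta> "-1"] one by simp
      moreover obtain \<xi> where \<xi>: "\<xi> \<in> Omega \<phi>" using Omega_nonempty by blast
      then have "\<delta> \<le> pi" using low[OF \<xi>] by (simp add: Omega_def)
      then have "- pi < \<eta> - 2 * pi" "\<eta> - 2 * pi \<le> pi" using False that by (auto simp: W_def)
      ultimately have "\<eta> - 2 * pi \<in> Omega \<phi>" by (simp add: Omega_def)
      from low[OF this] that assms(1) show False by (auto simp: W_def)
    qed
  qed
  show ?thesis
  proof (cases "W = {}")
    case True
    show ?thesis
    proof (rule that[of 0])
      fix \<eta> assume "\<eta> \<in> {- pi + \<delta>..pi + \<delta>}" "\<And>\<xi>. \<xi> \<in> Omega \<phi> \<Longrightarrow> \<eta> \<notin> {\<xi> - \<delta>..\<xi> + \<delta>}"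
      then have "\<eta> \<in> W" unfolding W_def by fastforce
      with True show "cmod (fourier \<phi> \<eta>) \<le> 0" by simp
    qed auto
  next
    case False
    have "continuous_on W (\<lambda>\<xi>. cmod (fourier \<phi> \<xi>))" by (intro continuous_intros continuous_on_fourier)
    from continuous_attains_sup[OF \<open>compact W\<close> False this]
    obtain \<eta>0 where \<eta>0: "\<eta>0 \<in> W" "\<And>\<eta>. \<eta> \<in> W \<Longrightarrow> cmod (fourier \<phi> \<eta>) \<le> cmod (fourier \<phi> \<eta>0)" by auto
    show ?thesis
    proof (rule that[of "cmod (fourier \<phi> \<eta>0)"])
      fix \<eta> assume "\<eta> \<in> {- pi + \<delta>..pi + \<delta>}" "\<And>\<xi>. \<xi> \<in> Omega \<phi> \<Longrightarrow> \<eta> \<notin> {\<xi> - \<delta>..\<xi> + \<delta>}"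
      then have "\<eta> \<in> W" unfolding W_def by fastforce
      then show "cmod (fourier \<phi> \<eta>) \<le> cmod (fourier \<phi> \<eta>0)" by (rule \<eta>0)
    qed (use less[OF \<eta>0(1)] in auto)
  qed
qed

text \<open>
  Subtract from the integral over the window the integrals over the peaks. What remains is an integrand
  that vanishes on the peaks and is bounded by \<rho>^n elsewhere.
\<close>

lemma conv_power_peaks:
  assumes \<delta>: "0 < \<delta>" and low: "\<And>\<xi>. \<xi> \<in> Omega \<phi> \<Longrightarrow> - pi + 2 * \<delta> \<le> \<xi>"
    and sep: "\<And>\<xi> \<xi>'. \<xi> \<in> Omega \<phi> \<Longrightarrow> \<xi>' \<in> Omega \<phi> \<Longrightarrow> \<xi> \<noteq> \<xi>' \<Longrightarrow> 2 * \<delta> < \<bar>\<xi> - \<xi>'\<bar>"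
  obtains \<rho> where "0 \<le> \<rho>" "\<rho> < 1"
    "\<And>n x. cmod (2 * of_real pi * conv_power \<phi> n x - (\<Sum>\<xi>\<in>Omega \<phi>. peak \<delta> \<xi> n x)) \<le> 2 * pi * \<rho> ^ n"
proof -
  obtain \<rho> where \<rho>: "0 \<le> \<rho>" "\<rho> < 1"
    "\<And>\<eta>. \<eta> \<in> {- pi + \<delta>..pi + \<delta>} \<Longrightarrow> (\<And>\<xi>. \<xi> \<in> Omega \<phi> \<Longrightarrow> \<eta> \<notin> {\<xi> - \<delta>..\<xi> + \<delta>}) \<Longrightarrow> cmod (fourier \<phi> \<eta>) \<le> \<rho>"
    using away_from_peaks[OF \<delta> low] by blast
  show ?thesis
  proof (rule that[OF \<rho>(1,2)])
    fix n x
    define f where "f = integrand n x"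
    define g where "g = (\<lambda>\<eta>. f \<eta> - (\<Sum>\<xi>\<in>Omega \<phi>. if \<eta> \<in> {\<xi> - \<delta>..\<xi> + \<delta>} then f \<eta> else 0))"
    have win: "- pi + \<delta> + 2 * pi = pi + \<delta>" by simp
    have f: "(f has_integral 2 * of_real pi * conv_power \<phi> n x) {- pi + \<delta>..pi + \<delta>}"
      using conv_power_integral[OF finite_supp, of n x "- pi + \<delta>"] unfolding win
      by (simp add: f_def integrand_def[abs_def])
    have p: "((\<lambda>\<eta>. if \<eta> \<in> {\<xi> - \<delta>..\<xi> + \<delta>} then f \<eta> else 0) has_integral peak \<delta> \<xi> n x) {- pi + \<delta>..pi + \<delta>}"
      if "\<xi> \<in> Omega \<phi>" for \<xi>
    proof -
      have "{\<xi> - \<delta>..\<xi> + \<delta>} \<subseteq> {- pi + \<delta>..pi + \<delta>}" using low[OF that] that by (auto simp: Omega_def)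
      then show ?thesis unfolding has_integral_restrict[OF \<open>{\<xi> - \<delta>..\<xi> + \<delta>} \<subseteq> {- pi + \<delta>..pi + \<delta>}\<close>]
        unfolding peak_def f_def by (intro integrable_integral integrable_integrand)
    qed
    have "(g has_integral (2 * of_real pi * conv_power \<phi> n x - (\<Sum>\<xi>\<in>Omega \<phi>. peak \<delta> \<xi> n x))) {- pi + \<delta>..pi + \<delta>}"
      unfolding g_def by (rule has_integral_diff[OF f has_integral_sum[OF finite_Omega p]])
    moreover have "cmod (g \<eta>) \<le> \<rho> ^ n" if \<eta>: "\<eta> \<in> {- pi + \<delta>..pi + \<delta>}" for \<eta>
    proof (cases "\<exists>\<xi>\<in>Omega \<phi>. \<eta> \<in> {\<xi> - \<delta>..\<xi> + \<delta>}")
      case True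
      then obtain \<xi> where \<xi>: "\<xi> \<in> Omega \<phi>" "\<eta> \<in> {\<xi> - \<delta>..\<xi> + \<delta>}" by blast
      have iff: "\<eta> \<in> {\<xi>' - \<delta>..\<xi>' + \<delta>} \<longleftrightarrow> \<xi>' = \<xi>" if "\<xi>' \<in> Omega \<phi>" for \<xi>'
      proof (cases "\<xi>' = \<xi>")
        case False
        then show ?thesis using sep[OF that \<xi>(1) False] \<xi>(2) by (auto simp: abs_if split: if_splits)
      qed (use \<xi>(2) in simp)
      have "(\<Sum>\<xi>'\<in>Omega \<phi>. if \<eta> \<in> {\<xi>' - \<delta>..\<xi>' + \<delta>} then f \<eta> else 0) = (\<Sum>\<xi>'\<in>Omega \<phi>. if \<xi>' = \<xi> then f \<eta> else 0)"
        by (intro sum.cong refl) (simp only: iff)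
      also have "\<dots> = f \<eta>" using \<xi>(1) finite_Omega by simp
      finally have "g \<eta> = 0" by (simp add: g_def)
      then show ?thesis using \<rho>(1) by simp
    next
      case False
      then have "(\<Sum>\<xi>'\<in>Omega \<phi>. if \<eta> \<in> {\<xi>' - \<delta>..\<xi>' + \<delta>} then f \<eta> else 0) = 0"
        by (intro sum.neutral) auto
      then have "cmod (g \<eta>) = cmod (fourier \<phi> \<eta>) ^ n" by (simp add: g_def f_def cmod_integrand)
      also have "\<dots> \<le> \<rho> ^ n" using \<rho>(3)[OF \<eta>] False by (intro power_mono) auto
      finally show ?thesis .
    qed
    ultimately have "cmod (2 * of_real pi * conv_power \<phi> n x - (\<Sum>\<xi>\<in>Omega \<phi>. peak \<delta> \<xi> n x))
        \<le> \<rho> ^ n * measure lborel (cbox (- pi + \<delta>) (pi + \<delta>))"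
      using has_integral_bound[of "\<rho> ^ n" g _ "- pi + \<delta>" "pi + \<delta>"] \<rho>(1) by simp
    then show "cmod (2 * of_real pi * conv_power \<phi> n x - (\<Sum>\<xi>\<in>Omega \<phi>. peak \<delta> \<xi> n x)) \<le> 2 * pi * \<rho> ^ n"
      using pi_gt_zero by (simp add: mult.commute)
  qed
qed

lemma conv_power_asymptotics:
  assumes nondeg: "m_max \<phi> > 2 \<or> (\<forall>\<xi>\<in>max_points \<phi>. Re (beta_at \<phi> \<xi>) > 0)" and \<epsilon>: "\<epsilon> > 0"
  shows "\<forall>\<^sub>F n in sequentially. \<forall>x. cmod (conv_power \<phi> n x - (\<Sum>\<xi>\<in>max_points \<phi>. attractor \<xi> n x))
    \<le> \<epsilon> * real n powr (- 1 / real (m_max \<phi>))"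
proof -
  let ?p = "\<lambda>n::nat. real n powr (- 1 / real (m_max \<phi>))"
  let ?t = "\<lambda>\<xi> n x. if \<xi> \<in> max_points \<phi> then 2 * of_real pi * attractor \<xi> n x else 0"
  obtain d where d: "0 < d" "\<And>\<xi>. \<xi> \<in> Omega \<phi> \<Longrightarrow> - pi + 2 * d \<le> \<xi>"
    "\<And>\<xi> \<xi>'. \<xi> \<in> Omega \<phi> \<Longrightarrow> \<xi>' \<in> Omega \<phi> \<Longrightarrow> \<xi> \<noteq> \<xi>' \<Longrightarrow> 2 * d < \<bar>\<xi> - \<xi>'\<bar>"
    using isolating_radius by blast
  have "\<forall>\<xi>\<in>Omega \<phi>. \<exists>\<delta>0. \<delta>0 > 0 \<and> (\<forall>\<delta> \<epsilon>. 0 < \<delta> \<longrightarrow> \<delta> \<le> \<delta>0 \<longrightarrow> 0 < \<epsilon> \<longrightarrow> (\<forall>\<^sub>F n in sequentially. \<forall>x.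
       cmod (peak \<delta> \<xi> n x - ?t \<xi> n x) \<le> \<epsilon> * ?p n))"
    using peak_asymptotics[OF _ nondeg] by simp
  from bchoice[OF this] obtain D where D: "\<And>\<xi>. \<xi> \<in> Omega \<phi> \<Longrightarrow> D \<xi> > 0"
    "\<And>\<xi> \<delta> \<epsilon>. \<xi> \<in> Omega \<phi> \<Longrightarrow> 0 < \<delta> \<Longrightarrow> \<delta> \<le> D \<xi> \<Longrightarrow> 0 < \<epsilon> \<Longrightarrow> (\<forall>\<^sub>F n in sequentially. \<forall>x.
       cmod (peak \<delta> \<xi> n x - ?t \<xi> n x) \<le> \<epsilon> * ?p n)" by auto
  define \<delta> where "\<delta> = Min (insert d (D ` Omega \<phi>))"
  have \<delta>_le: "\<delta> \<le> d" "\<And>\<xi>. \<xi> \<in> Omega \<phi> \<Longrightarrow> \<delta> \<le> D \<xi>"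
    unfolding \<delta>_def using finite_Omega by (auto intro: Min_le)
  have \<delta>: "\<delta> > 0" unfolding \<delta>_def using finite_Omega d(1) D(1) by (subst Min_gr_iff) auto
  obtain \<rho> where \<rho>: "0 \<le> \<rho>" "\<rho> < 1"
    "\<And>n x. cmod (2 * of_real pi * conv_power \<phi> n x - (\<Sum>\<xi>\<in>Omega \<phi>. peak \<delta> \<xi> n x)) \<le> 2 * pi * \<rho> ^ n"
  proof (rule conv_power_peaks[OF \<delta>])
    show "- pi + 2 * \<delta> \<le> \<xi>" if "\<xi> \<in> Omega \<phi>" for \<xi> using d(2)[OF that] \<delta>_le(1) by simp
    show "2 * \<delta> < \<bar>\<xi> - \<xi>'\<bar>" if "\<xi> \<in> Omega \<phi>" "\<xi>' \<in> Omega \<phi>" "\<xi> \<noteq> \<xi>'" for \<xi> \<xi>'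
      using d(3)[OF that] \<delta>_le(1) by linarith
  qed (rule that; assumption)
  define c where "c = real (card (Omega \<phi>))"
  have c: "c > 0" using finite_Omega Omega_nonempty by (simp add: c_def card_gt_0_iff)
  have ev1: "\<forall>\<^sub>F n in sequentially. \<forall>\<xi>\<in>Omega \<phi>. \<forall>x. cmod (peak \<delta> \<xi> n x - ?t \<xi> n x) \<le> (\<epsilon> / c) * ?p n"
  proof (rule eventually_ball_finite[OF finite_Omega], rule ballI)
    fix \<xi> assume "\<xi> \<in> Omega \<phi>"
    from D(2)[OF this \<delta> \<delta>_le(2)[OF this] divide_pos_pos[OF \<epsilon> c]]
    show "\<forall>\<^sub>F n in sequentially. \<forall>x. cmod (peak \<delta> \<xi> n x - ?t \<xi> n x) \<le> (\<epsilon> / c) * ?p n" .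
  qed
  have m1: "1 \<le> m_max \<phi>" using m_max_ge_2 by simp
  have ev2: "\<forall>\<^sub>F n in sequentially. \<rho> ^ n / ?p n < \<epsilon> / 2"
    by (rule order_tendstoD(2)[OF geometric_powr_tendsto_0[OF \<rho>(1,2) m1]]) (use \<epsilon> in simp)
  show ?thesis
    using ev1 ev2 eventually_ge_at_top[of 1]
  proof eventually_elim
    case (elim n)
    show ?case
    proof
      fix x
      have p: "?p n > 0" using elim(3) by simp
      have \<rho>n: "\<rho> ^ n \<le> \<epsilon> / 2 * ?p n" using elim(2) p by (simp add: divide_less_eq)
      have sum_t: "(\<Sum>\<xi>\<in>Omega \<phi>. ?t \<xi> n x) = 2 * of_real pi * (\<Sum>\<xi>\<in>max_points \<phi>. attractor \<xi> n x)"
      proof -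
        have "(\<Sum>\<xi>\<in>Omega \<phi>. ?t \<xi> n x) = (\<Sum>\<xi>\<in>Omega \<phi> \<inter> max_points \<phi>. 2 * of_real pi * attractor \<xi> n x)"
          using finite_Omega by (simp add: sum.inter_restrict)
        also have "Omega \<phi> \<inter> max_points \<phi> = max_points \<phi>" by (auto simp: max_points_def)
        finally show ?thesis by (simp add: sum_distrib_left)
      qed
      have "2 * of_real pi * (conv_power \<phi> n x - (\<Sum>\<xi>\<in>max_points \<phi>. attractor \<xi> n x)) =
          (2 * of_real pi * conv_power \<phi> n x - (\<Sum>\<xi>\<in>Omega \<phi>. peak \<delta> \<xi> n x)) + (\<Sum>\<xi>\<in>Omega \<phi>. peak \<delta> \<xi> n x - ?t \<xi> n x)"
        unfolding sum_subtractf sum_t by (simp add: algebra_simps)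
      also have "cmod \<dots> \<le> 2 * pi * \<rho> ^ n + (\<Sum>\<xi>\<in>Omega \<phi>. (\<epsilon> / c) * ?p n)"
        by (intro norm_triangle_mono \<rho>(3) sum_norm_le) (use elim(1) in blast)
      also have "(\<Sum>\<xi>\<in>Omega \<phi>. (\<epsilon> / c) * ?p n) = \<epsilon> * ?p n" using c by (simp add: c_def)
      also have "2 * pi * \<rho> ^ n + \<epsilon> * ?p n \<le> 2 * pi * (\<epsilon> / 2 * ?p n) + pi * (\<epsilon> * ?p n)"
        using \<rho>n pi_gt_zero pi_gt3 \<epsilon> p mult_right_mono[of 1 pi "\<epsilon> * ?p n"]
        by (intro add_mono mult_left_mono) auto
      also have "\<dots> = 2 * pi * (\<epsilon> * ?p n)" by simp
      finally have "2 * pi * cmod (conv_power \<phi> n x - (\<Sum>\<xi>\<in>max_points \<phi>. attractor \<xi> n x)) \<le> 2 * pi * (\<epsilon> * ?p n)"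
        using pi_gt_zero by (simp add: norm_mult)
      then show "cmod (conv_power \<phi> n x - (\<Sum>\<xi>\<in>max_points \<phi>. attractor \<xi> n x)) \<le> \<epsilon> * ?p n"
        using pi_gt_zero by (subst (asm) mult_le_cancel_left_pos) auto
    qed
  qed
qed

end

section \<open>A lower bound for the supremum\<close>

definition dirichlet :: "nat \<Rightarrow> real \<Rightarrow> complex" where
  "dirichlet N \<eta> = (\<Sum>j<N. exp (\<i> * of_nat j * of_real \<eta>))"

text \<open>
  From |sin y - y| \<le> |y|^3 / 6 and y^2 \<le> 3.
\<close>

lemma abs_sin_ge_half:
  assumes "\<bar>y\<bar> \<le> pi / 2"
  shows "\<bar>y\<bar> / 2 \<le> \<bar>sin y\<bar>"
proof -
  have "(\<Sum>m<3. sin_coeff m * y ^ m) = y"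
    by (simp add: sin_coeff_def numeral_3_eq_3)
  then have 1: "\<bar>sin y - y\<bar> \<le> \<bar>y\<bar> ^ 3 / 6"
    using Maclaurin_sin_bound[of y 3] by (simp add: fact_numeral)
  have "\<bar>y\<bar> \<le> 17 / 10" using assms pi_less_4 pi_approx by simp
  then have "\<bar>y\<bar> * \<bar>y\<bar> \<le> (17 / 10) * (17 / 10)" by (intro mult_mono) auto
  then have "\<bar>y\<bar> * (\<bar>y\<bar> * \<bar>y\<bar>) \<le> \<bar>y\<bar> * 3" by (intro mult_left_mono) auto
  then have "\<bar>y\<bar> ^ 3 / 6 \<le> \<bar>y\<bar> / 2" by (simp add: power3_eq_cube mult_ac)
  with 1 show ?thesis by linarith
qed

text \<open>
  Summing the geometric progression and using |exp (i \<eta>) - 1| = 2 |sin (\<eta> / 2)| \<ge> |\<eta>| / 2.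
\<close>

lemma dirichlet_bound:
  assumes "\<bar>\<eta>\<bar> \<le> pi"
  shows "(cmod (dirichlet N \<eta>))\<^sup>2 * \<eta>\<^sup>2 \<le> 16"
proof -
  define z where "z = exp (\<i> * of_real \<eta>)"
  have "dirichlet N \<eta> = (\<Sum>j<N. z ^ j)"
    unfolding dirichlet_def z_def by (intro sum.cong refl) (simp add: mult_ac flip: exp_of_nat_mult)
  then have "dirichlet N \<eta> * (z - 1) = z ^ N - 1"
    using power_diff_1_eq[of z N] by (simp add: mult.commute)
  then have "cmod (dirichlet N \<eta>) * cmod (z - 1) = cmod (z ^ N - 1)" by (metis norm_mult)
  also have "\<dots> \<le> cmod (z ^ N) + cmod 1" by (rule norm_triangle_ineq4)
  also have "\<dots> = 2" by (simp add: z_def norm_power)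
  finally have 1: "cmod (dirichlet N \<eta>) * cmod (z - 1) \<le> 2" .
  have "\<bar>\<eta>\<bar> / 2 \<le> cmod (z - 1)"
    using abs_sin_ge_half[of "\<eta> / 2"] assms unfolding z_def dist_exp_i_1 by simp
  then have "cmod (dirichlet N \<eta>) * (\<bar>\<eta>\<bar> / 2) \<le> cmod (dirichlet N \<eta>) * cmod (z - 1)"
    by (intro mult_left_mono) auto
  with 1 have "cmod (dirichlet N \<eta>) * \<bar>\<eta>\<bar> \<le> 4" by simp
  then have "(cmod (dirichlet N \<eta>) * \<bar>\<eta>\<bar>)\<^sup>2 \<le> 4\<^sup>2" by (intro power_mono) auto
  then show ?thesis by (simp add: power_mult_distrib)
qed

lemma dirichlet_square:
  "of_real ((cmod (dirichlet N \<eta>))\<^sup>2) = (\<Sum>(j, k)\<in>{..<N} \<times> {..<N}. exp (\<i> * of_int (int j - int k) * of_real \<eta>))"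
proof -
  have "of_real ((cmod (dirichlet N \<eta>))\<^sup>2) = dirichlet N \<eta> * cnj (dirichlet N \<eta>)" by (rule complex_norm_square)
  also have "\<dots> = (\<Sum>(j, k)\<in>{..<N} \<times> {..<N}. exp (\<i> * of_int (int j - int k) * of_real \<eta>))"
    unfolding dirichlet_def cnj_sum sum_product sum.cartesian_product
    by (intro sum.cong) (auto simp: exp_cnj mult_exp_exp algebra_simps)
  finally show ?thesis .
qed

lemma dirichlet_integral:
  "((\<lambda>\<xi>. (cmod (dirichlet N (\<xi> - \<xi>0)))\<^sup>2) has_integral 2 * pi * N) {a..a + 2 * pi}"
proof -
  have "((\<lambda>\<xi>. \<Sum>(j, k)\<in>{..<N} \<times> {..<N}. exp (- \<i> * of_int (int j - int k) * of_real \<xi>0) * exp (\<i> * of_int (int j - int k) * of_real \<xi>))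
     has_integral (\<Sum>(j, k)\<in>{..<N} \<times> {..<N}. exp (- \<i> * of_int (int j - int k) * of_real \<xi>0)
        * (if int j - int k = 0 then 2 * of_real pi else 0))) {a..a + 2 * pi}"
    unfolding split_beta
    by (rule has_integral_sum[OF _ has_integral_mult_right[OF has_integral_character]]) simp
  moreover have "(\<Sum>(j, k)\<in>{..<N} \<times> {..<N}. exp (- \<i> * of_int (int j - int k) * of_real \<xi>0) * exp (\<i> * of_int (int j - int k) * of_real \<xi>))
      = of_real ((cmod (dirichlet N (\<xi> - \<xi>0)))\<^sup>2)" for \<xi>
    unfolding dirichlet_square by (intro sum.cong) (auto simp: mult_exp_exp algebra_simps)
  moreover have "(\<Sum>(j, k)\<in>{..<N} \<times> {..<N}. exp (- \<i> * of_int (int j - int k) * of_real \<xi>0)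
        * (if int j - int k = 0 then 2 * of_real pi else 0)) = of_real (2 * pi * N)"
  proof -
    have "(\<Sum>(j, k)\<in>{..<N} \<times> {..<N}. exp (- \<i> * of_int (int j - int k) * of_real \<xi>0)
        * (if int j - int k = 0 then 2 * of_real pi else 0)) = (\<Sum>j<N. \<Sum>k<N. if j = k then 2 * of_real pi else 0)"
      unfolding sum.cartesian_product by (intro sum.cong) auto
    also have "\<dots> = of_real (2 * pi * N)" by (simp add: mult.commute)
    finally show ?thesis .
  qed
  ultimately have "((\<lambda>\<xi>. complex_of_real ((cmod (dirichlet N (\<xi> - \<xi>0)))\<^sup>2)) has_integral of_real (2 * pi * N)) {a..a + 2 * pi}"
    by simp
  from has_integral_linear[OF this bounded_linear_Re] show ?thesis by (simp add: o_def)
qed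

lemma cauchy_kernel_integral:
  assumes "\<rho> > 0" "a \<le> b"
  obtains I where "((\<lambda>\<xi>. 1 / ((\<xi> - \<xi>0)\<^sup>2 + \<rho>\<^sup>2)) has_integral I) {a..b}" "I \<le> pi / \<rho>"
proof -
  have "((\<lambda>\<xi>. arctan ((\<xi> - \<xi>0) / \<rho>) / \<rho>) has_vector_derivative (1 / ((\<xi> - \<xi>0)\<^sup>2 + \<rho>\<^sup>2))) (at \<xi> within {a..b})" for \<xi>
  proof -
    have "1 + ((\<xi> - \<xi>0) / \<rho>)\<^sup>2 = ((\<xi> - \<xi>0)\<^sup>2 + \<rho>\<^sup>2) / \<rho>\<^sup>2"
      using assms by (simp add: power_divide add_divide_distrib)
    then have eq: "(1 / \<rho>) * inverse (1 + ((\<xi> - \<xi>0) / \<rho>)\<^sup>2) / \<rho> = 1 / ((\<xi> - \<xi>0)\<^sup>2 + \<rho>\<^sup>2)"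
      using assms by (simp add: power2_eq_square divide_inverse)
    have "((\<lambda>\<xi>. arctan ((\<xi> - \<xi>0) / \<rho>) / \<rho>) has_field_derivative ((1 / \<rho>) * inverse (1 + ((\<xi> - \<xi>0) / \<rho>)\<^sup>2) / \<rho>)) (at \<xi> within {a..b})"
      using assms by (auto intro!: derivative_eq_intros)
    then show ?thesis unfolding eq by (simp add: has_real_derivative_iff_has_vector_derivative)
  qed
  from fundamental_theorem_of_calculus[OF assms(2) this]
  have "((\<lambda>\<xi>. 1 / ((\<xi> - \<xi>0)\<^sup>2 + \<rho>\<^sup>2)) has_integral (arctan ((b - \<xi>0) / \<rho>) / \<rho> - arctan ((a - \<xi>0) / \<rho>) / \<rho>)) {a..b}" .
  moreover have "arctan ((b - \<xi>0) / \<rho>) - arctan ((a - \<xi>0) / \<rho>) \<le> pi"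
    using arctan_ubound[of "(b - \<xi>0) / \<rho>"] arctan_lbound[of "(a - \<xi>0) / \<rho>"] by linarith
  then have "arctan ((b - \<xi>0) / \<rho>) / \<rho> - arctan ((a - \<xi>0) / \<rho>) / \<rho> \<le> pi / \<rho>"
    using assms(1) by (simp add: diff_divide_distrib[symmetric] divide_right_mono)
  ultimately show ?thesis using that by blast
qed

context boundary_phase
begin

text \<open>
  On |t| \<le> \<theta> / \<nu> with a small constant \<theta> the phase has not yet moved away from 0, uniformly in \<nu>.
\<close>

lemma phase_near_0:
  obtains \<theta> where "0 < \<theta>" "\<theta> < r"
    "\<And>\<nu> s t. 1 \<le> \<nu> \<Longrightarrow> \<bar>s\<bar> \<le> 1 \<Longrightarrow> \<bar>t\<bar> \<le> \<theta> / \<nu> \<Longrightarrow> cmod (exp (phase \<nu> s (of_real t)) - 1) \<le> 1 / 8"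
proof -
  obtain d where d: "d > 0" "\<And>z. cmod z < d \<Longrightarrow> cmod (h z - h 0) < 1"
    using isCont_h_0 by (auto simp: continuous_at_eps_delta dist_norm elim: allE[of _ 1])
  define B where "B = cmod (h 0) + 1"
  have B: "B > 0" by (simp add: B_def add_nonneg_pos)
  have hB: "cmod (h z) \<le> B" if "cmod z < d" for z
    using d(2)[OF that] norm_triangle_ineq2[of "h z" "h 0"] by (simp add: B_def)
  define \<theta> where "\<theta> = min 1 (min (1 / (8 * (B + 1))) (min (d / 2) (r / 2)))"
  have "\<theta> \<le> d / 2" "\<theta> \<le> r / 2" unfolding \<theta>_def by (meson min.cobounded1 min.cobounded2 order_trans)+
  moreover have "0 < \<theta>" unfolding \<theta>_def using d(1) r_pos B by simp
  moreover have "\<theta> \<le> 1" "\<theta> \<le> 1 / (8 * (B + 1))"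
    unfolding \<theta>_def by (meson min.cobounded1 min.cobounded2 order_trans)+
  ultimately have \<theta>: "0 < \<theta>" "\<theta> \<le> 1" "\<theta> < d" "\<theta> < r" "\<theta> \<le> 1 / (8 * (B + 1))"
    using d(1) r_pos by auto
  have \<theta>B: "\<theta> * (B + 1) \<le> 1 / 8" using \<theta>(5) B by (simp add: field_simps)
  show ?thesis
  proof (rule that[OF \<theta>(1,4)])
    fix \<nu> s t :: real assume a: "1 \<le> \<nu>" "\<bar>s\<bar> \<le> 1" "\<bar>t\<bar> \<le> \<theta> / \<nu>"
    have "\<theta> / \<nu> \<le> \<theta> / 1" using a \<theta> by (intro divide_left_mono) auto
    then have t: "\<bar>t\<bar> \<le> \<theta>" using a(3) by simp
    have \<nu>t: "\<nu> * \<bar>t\<bar> \<le> \<theta>" using a by (simp add: field_simps)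
    have "(\<nu> * \<bar>t\<bar>) ^ m \<le> \<theta> ^ m" using \<nu>t a by (intro power_mono) auto
    also have "\<dots> \<le> \<theta> ^ 1" using \<theta> m_ge_2 by (intro power_decreasing) auto
    finally have p: "(\<nu> * \<bar>t\<bar>) ^ m \<le> \<theta>" by simp
    have "cmod (exp (phase \<nu> s (of_real t)) - exp 0) \<le> cmod (phase \<nu> s (of_real t) - 0)"
      by (intro cmod_exp_diff_le Re_phase_nonpos) (use t \<theta> a in auto)
    also have "\<dots> \<le> cmod ((of_real \<nu> * of_real t) ^ m * h (of_real t)) + cmod (\<i> * of_real s * of_real t)"
      unfolding phase_def by (simp add: norm_triangle_ineq)
    also have "\<dots> = (\<nu> * \<bar>t\<bar>) ^ m * cmod (h (of_real t)) + \<bar>s\<bar> * \<bar>t\<bar>"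
      using a by (simp add: norm_mult norm_power)
    also have "\<dots> \<le> \<theta> * B + 1 * \<theta>"
      using p hB[of "of_real t"] t \<theta> a by (intro add_mono mult_mono) auto
    also have "\<dots> \<le> 1 / 8" using \<theta>B by (simp add: algebra_simps)
    finally show "cmod (exp (phase \<nu> s (of_real t)) - 1) \<le> 1 / 8" by simp
  qed
qed

end

context normalized_symbol
begin

text \<open>
  The squared Dirichlet kernel, N times the Fejer kernel, has coefficients supported in |j - k| < N.
  So an average of the transform against it is a combination of N^2 values of \<phi>^(n), each with a
  coefficient of modulus one.
\<close>

lemma dirichlet_average:
  "((\<lambda>\<xi>. integrand n x0 \<xi> * of_real ((cmod (dirichlet N (\<xi> - \<xi>0)))\<^sup>2)) has_integral
     2 * of_real pi * (\<Sum>(j, k)\<in>{..<N} \<times> {..<N}. exp (\<i> * of_int (int k - int j) * of_real \<xi>0) * conv_power \<phi> n (x0 + int k - int j)))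
   {a..a + 2 * pi}"
proof -
  have "((\<lambda>\<xi>. \<Sum>(j, k)\<in>{..<N} \<times> {..<N}. exp (\<i> * of_int (int k - int j) * of_real \<xi>0) *
      (fourier \<phi> \<xi> ^ n * exp (- \<i> * of_int (x0 + int k - int j) * of_real \<xi>)))
    has_integral (\<Sum>(j, k)\<in>{..<N} \<times> {..<N}. exp (\<i> * of_int (int k - int j) * of_real \<xi>0) *
      (2 * of_real pi * conv_power \<phi> n (x0 + int k - int j)))) {a..a + 2 * pi}"
    unfolding split_beta
    by (rule has_integral_sum[OF _ has_integral_mult_right[OF conv_power_integral[OF finite_supp]]]) simp
  moreover have "(\<Sum>(j, k)\<in>{..<N} \<times> {..<N}. exp (\<i> * of_int (int k - int j) * of_real \<xi>0) *
      (fourier \<phi> \<xi> ^ n * exp (- \<i> * of_int (x0 + int k - int j) * of_real \<xi>)))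
      = integrand n x0 \<xi> * of_real ((cmod (dirichlet N (\<xi> - \<xi>0)))\<^sup>2)" for \<xi>
  proof -
    have "exp (\<i> * of_int (int k - int j) * of_real \<xi>0) * exp (- \<i> * of_int (x0 + int k - int j) * of_real \<xi>)
        = exp (- \<i> * of_int x0 * of_real \<xi>) * exp (\<i> * of_int (int j - int k) * of_real (\<xi> - \<xi>0))" for j k
      by (simp add: mult_exp_exp algebra_simps)
    moreover have "exp (\<i> * of_int (int k - int j) * of_real \<xi>0) * (fourier \<phi> \<xi> ^ n * exp (- \<i> * of_int (x0 + int k - int j) * of_real \<xi>))
        = fourier \<phi> \<xi> ^ n * (exp (\<i> * of_int (int k - int j) * of_real \<xi>0) * exp (- \<i> * of_int (x0 + int k - int j) * of_real \<xi>))" for j k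
      by (rule mult.left_commute)
    ultimately have "exp (\<i> * of_int (int k - int j) * of_real \<xi>0) * (fourier \<phi> \<xi> ^ n * exp (- \<i> * of_int (x0 + int k - int j) * of_real \<xi>))
        = integrand n x0 \<xi> * exp (\<i> * of_int (int j - int k) * of_real (\<xi> - \<xi>0))" for j k
      unfolding integrand_def by (simp only: mult.assoc[of "fourier \<phi> \<xi> ^ n"])
    then show ?thesis unfolding dirichlet_square sum_distrib_left
      by (intro sum.cong refl) (simp only: split_beta)
  qed
  moreover have "(\<Sum>(j, k)\<in>{..<N} \<times> {..<N}. exp (\<i> * of_int (int k - int j) * of_real \<xi>0) *
      (2 * of_real pi * conv_power \<phi> n (x0 + int k - int j))) =
      2 * of_real pi * (\<Sum>(j, k)\<in>{..<N} \<times> {..<N}. exp (\<i> * of_int (int k - int j) * of_real \<xi>0) * conv_power \<phi> n (x0 + int k - int j))"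
    unfolding sum_distrib_left by (intro sum.cong refl) (simp only: split_beta mult.left_commute)
  ultimately show ?thesis by simp
qed

text \<open>
  If F^n, rotated by the phase of x0, is close to the constant E on |\<xi> - \<xi>0| \<le> \<rho>, then its average
  against the squared Dirichlet kernel of total mass 2 \<pi> N is close to 2 \<pi> N E: off this interval the
  kernel is at most 16 / (\<xi> - \<xi>0)^2, of total mass O(1 / \<rho>), hence negligible for N a large
  multiple of 1 / \<rho>. As the average is a sum of N^2 values of \<phi>^(n), one of them is at least of order 1 / N.
\<close>

lemma some_value_large:
  assumes \<rho>: "0 < \<rho>" and N: "256 / \<rho> \<le> real N"
    and E: "cmod E = 1" and near: "\<And>t. \<bar>t\<bar> \<le> \<rho> \<Longrightarrow> cmod (integrand n x0 (\<xi>0 + t) - E) \<le> 1 / 8"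
  shows "\<exists>y. 1 / (2 * real N) \<le> cmod (conv_power \<phi> n y)"
proof (rule ccontr)
  assume "\<not> ?thesis"
  then have small: "cmod (conv_power \<phi> n y) < 1 / (2 * real N)" for y by (simp add: not_le)
  have "256 / \<rho> > 0" using \<rho> by simp
  then have N0: "real N > 0" using N by linarith
  define S where "S = (\<Sum>(j, k)\<in>{..<N} \<times> {..<N}. exp (\<i> * of_int (int k - int j) * of_real \<xi>0) * conv_power \<phi> n (x0 + int k - int j))"
  define D where "D = (\<lambda>\<xi>. (cmod (dirichlet N (\<xi> - \<xi>0)))\<^sup>2)"
  define a where "a = \<xi>0 - pi"
  obtain I where I: "((\<lambda>\<xi>. 1 / ((\<xi> - \<xi>0)\<^sup>2 + \<rho>\<^sup>2)) has_integral I) {a..a + 2 * pi}" "I \<le> pi / \<rho>"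
    using cauchy_kernel_integral[OF \<rho>, of a "a + 2 * pi" \<xi>0] pi_gt_zero by auto
  have D: "(D has_integral 2 * pi * N) {a..a + 2 * pi}" unfolding D_def by (rule dirichlet_integral)
  have ED: "((\<lambda>\<xi>. E * of_real (D \<xi>)) has_integral E * of_real (2 * pi * N)) {a..a + 2 * pi}"
    by (intro has_integral_mult_right has_integral_of_real D)
  have SD: "((\<lambda>\<xi>. integrand n x0 \<xi> * of_real (D \<xi>)) has_integral 2 * of_real pi * S) {a..a + 2 * pi}"
    unfolding D_def S_def by (rule dirichlet_average)
  have diff: "((\<lambda>\<xi>. (integrand n x0 \<xi> - E) * of_real (D \<xi>)) has_integral (2 * of_real pi * S - E * of_real (2 * pi * N))) {a..a + 2 * pi}"
    using has_integral_diff[OF SD ED] by (simp add: left_diff_distrib)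
  have bnd: "((\<lambda>\<xi>. 1 / 8 * D \<xi> + 64 * (1 / ((\<xi> - \<xi>0)\<^sup>2 + \<rho>\<^sup>2))) has_integral (1 / 8 * (2 * pi * N) + 64 * I)) {a..a + 2 * pi}"
    by (intro has_integral_add has_integral_mult_right D I)
  \<comment> \<open>The second term is a smooth majorant of the tail of the kernel, integrable by an arctangent.\<close>
  have ptw: "cmod ((integrand n x0 \<xi> - E) * of_real (D \<xi>)) \<le> 1 / 8 * D \<xi> + 64 * (1 / ((\<xi> - \<xi>0)\<^sup>2 + \<rho>\<^sup>2))"
    if \<xi>: "\<xi> \<in> {a..a + 2 * pi}" for \<xi>
  proof -
    have D0: "D \<xi> \<ge> 0" by (simp add: D_def)
    have sq: "(\<xi> - \<xi>0)\<^sup>2 + \<rho>\<^sup>2 > 0" using \<rho> by (intro add_nonneg_pos) auto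
    show ?thesis
    proof (cases "\<bar>\<xi> - \<xi>0\<bar> \<le> \<rho>")
      case True
      then have "cmod (integrand n x0 \<xi> - E) * D \<xi> \<le> 1 / 8 * D \<xi>"
        using near[of "\<xi> - \<xi>0"] D0 by (intro mult_right_mono) auto
      moreover have "64 * (1 / ((\<xi> - \<xi>0)\<^sup>2 + \<rho>\<^sup>2)) \<ge> 0" using sq by simp
      ultimately show ?thesis unfolding norm_mult norm_of_real abs_of_nonneg[OF D0] by linarith
    next
      case False
      have "cmod (fourier \<phi> \<xi>) ^ n \<le> 1" by (intro power_le_one cmod_fourier_le_1) auto
      then have "cmod (integrand n x0 \<xi> - E) \<le> 2"
        using norm_triangle_ineq4[of "integrand n x0 \<xi>" E] E by (simp add: cmod_integrand)
      then have "cmod (integrand n x0 \<xi> - E) * D \<xi> \<le> 2 * D \<xi>" using D0 by (intro mult_right_mono)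
      also have "D \<xi> \<le> 32 / ((\<xi> - \<xi>0)\<^sup>2 + \<rho>\<^sup>2)"
      proof -
        have "\<bar>\<rho>\<bar> \<le> \<bar>\<xi> - \<xi>0\<bar>" using False \<rho> by simp
        then have "\<rho>\<^sup>2 \<le> (\<xi> - \<xi>0)\<^sup>2" by (simp only: abs_le_square_iff)
        then have "D \<xi> * ((\<xi> - \<xi>0)\<^sup>2 + \<rho>\<^sup>2) \<le> D \<xi> * (2 * (\<xi> - \<xi>0)\<^sup>2)" using D0 by (intro mult_left_mono) auto
        also have "\<dots> \<le> 32" using dirichlet_bound[of "\<xi> - \<xi>0" N] \<xi> by (auto simp: D_def a_def abs_le_iff mult.commute)
        finally show ?thesis using sq by (simp add: field_simps)
      qed
      finally have "cmod (integrand n x0 \<xi> - E) * D \<xi> \<le> 64 * (1 / ((\<xi> - \<xi>0)\<^sup>2 + \<rho>\<^sup>2))" by simp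
      moreover have "1 / 8 * D \<xi> \<ge> 0" using D0 by simp
      ultimately show ?thesis unfolding norm_mult norm_of_real abs_of_nonneg[OF D0] by linarith
    qed
  qed
  have "cmod (2 * of_real pi * S - E * of_real (2 * pi * N)) \<le> 1 / 8 * (2 * pi * N) + 64 * I"
    using integral_norm_bound_integral[OF has_integral_integrable[OF diff] has_integral_integrable[OF bnd] ptw]
    unfolding integral_unique[OF diff] integral_unique[OF bnd] .
  also have "64 * I \<le> pi / 4 * (256 / \<rho>)" using I(2) by simp
  also have "pi / 4 * (256 / \<rho>) \<le> pi / 4 * N" using N pi_gt_zero by (intro mult_left_mono) auto
  finally have 1: "cmod (2 * of_real pi * S - E * of_real (2 * pi * N)) \<le> pi / 2 * N" by simp
  have "2 * pi * N = cmod (E * of_real (2 * pi * N))" using E N0 pi_gt_zero by (simp add: norm_mult)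
  also have "\<dots> \<le> cmod (2 * of_real pi * S) + pi / 2 * N"
    using 1 norm_triangle_sub[of "E * of_real (2 * pi * N)" "2 * of_real pi * S"] by (simp add: norm_minus_commute)
  also have "cmod (2 * of_real pi * S) = 2 * pi * cmod S" using pi_gt_zero by (simp add: norm_mult)
  finally have "2 * pi * N \<le> 2 * pi * cmod S + pi / 2 * N" .
  moreover have "0 \<le> pi * N" by simp
  ultimately have "pi * N \<le> pi * (2 * cmod S)" by linarith
  then have 2: "N \<le> 2 * cmod S" using pi_gt_zero by (rule mult_left_le_imp_le)
  have "cmod S < real N * real N * (1 / (2 * real N))"
  proof -
    have "cmod S \<le> (\<Sum>p\<in>{..<N} \<times> {..<N}. cmod (conv_power \<phi> n (x0 + int (snd p) - int (fst p))))"
      unfolding S_def split_beta by (rule norm_sum[THEN order_trans]) (simp add: norm_mult)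
    also have "\<dots> < (\<Sum>p\<in>{..<N} \<times> {..<N}. 1 / (2 * real N))"
      using N0 small by (intro sum_strict_mono) auto
    also have "\<dots> = real N * real N * (1 / (2 * real N))" by simp
    finally show ?thesis .
  qed
  then show False using 2 N0 by simp
qed

text \<open>
  The previous lemma at the scale \<rho> = \<theta> n^(-1/m), with the integer x0 next to \<alpha> n, so that the linear
  part of the phase is at most |t|.
\<close>

lemma conv_power_lower_bound:
  assumes \<xi>0: "\<xi>0 \<in> Omega \<phi>"
  obtains c where "c > 0"
    "\<And>n. 1 \<le> n \<Longrightarrow> \<exists>y. c * real n powr (- 1 / real (m_at \<phi> \<xi>0)) \<le> cmod (conv_power \<phi> n y)"
proof -
  have F1: "cmod (fourier \<phi> \<xi>0) = 1" using \<xi>0 by (simp add: Omega_def)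
  obtain h r where bp: "boundary_phase (m_at \<phi> \<xi>0) (beta_at \<phi> \<xi>0) h r" and
    F: "\<And>t::real. \<bar>t\<bar> < r \<Longrightarrow> fourier \<phi> (\<xi>0 + t) =
       fourier \<phi> \<xi>0 * exp (\<i> * of_real (alpha_at \<phi> \<xi>0) * of_real t + of_real t ^ m_at \<phi> \<xi>0 * h (of_real t))"
    using local_expansion[OF \<xi>0] by blast
  interpret boundary_phase "m_at \<phi> \<xi>0" "beta_at \<phi> \<xi>0" h r by (rule bp)
  have m: "m_at \<phi> \<xi>0 \<ge> 1" using m_ge_2 by simp
  obtain \<theta> where \<theta>: "0 < \<theta>" "\<theta> < r"
    "\<And>\<nu> s t. 1 \<le> \<nu> \<Longrightarrow> \<bar>s\<bar> \<le> 1 \<Longrightarrow> \<bar>t\<bar> \<le> \<theta> / \<nu> \<Longrightarrow> cmod (exp (phase \<nu> s (of_real t)) - 1) \<le> 1 / 8"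
    using phase_near_0 by blast
  define C where "C = 256 / \<theta> + 1"
  have C: "C > 0" using \<theta>(1) by (simp add: C_def add_pos_pos)
  show ?thesis
  proof (rule that[of "1 / (2 * C)"])
    fix n :: nat assume n: "1 \<le> n"
    define \<nu> where "\<nu> = real n powr (1 / real (m_at \<phi> \<xi>0))"
    note rp = root_powr[OF n m, folded \<nu>_def]
    define x0 where "x0 = \<lfloor>alpha_at \<phi> \<xi>0 * real n\<rfloor>"
    define E where "E = exp (- \<i> * of_int x0 * of_real \<xi>0) * fourier \<phi> \<xi>0 ^ n"
    define \<rho> where "\<rho> = \<theta> / \<nu>"
    define N where "N = nat \<lceil>256 / \<rho>\<rceil>"
    have \<rho>: "0 < \<rho>" using \<theta> rp(1) by (simp add: \<rho>_def)
    have E: "cmod E = 1" by (simp add: E_def norm_mult norm_power F1)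
    have N: "256 / \<rho> \<le> real N" unfolding N_def by linarith
    have "256 / \<rho> > 0" using \<rho> by simp
    then have N0: "real N > 0" using N by linarith
    have "\<exists>y. 1 / (2 * real N) \<le> cmod (conv_power \<phi> n y)"
    proof (rule some_value_large[OF \<rho> N E])
      fix t assume t: "\<bar>t\<bar> \<le> \<rho>"
      have "\<theta> / \<nu> \<le> \<theta> / 1" using rp(1,3) \<theta>(1) by (intro divide_left_mono) auto
      then have tr: "\<bar>t\<bar> < r" using t \<theta>(2) by (simp add: \<rho>_def)
      have "integrand n x0 (\<xi>0 + t) - E = E * (exp (phase \<nu> (alpha_at \<phi> \<xi>0 * real n - of_int x0) (of_real t)) - 1)"
        unfolding integrand_near_peak[OF bp F[OF tr] rp(2)] E_def by (simp add: algebra_simps)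
      moreover have "cmod (exp (phase \<nu> (alpha_at \<phi> \<xi>0 * real n - of_int x0) (of_real t)) - 1) \<le> 1 / 8"
        by (rule \<theta>(3)[OF rp(3) _ t[unfolded \<rho>_def]]) (unfold x0_def, linarith)
      ultimately show "cmod (integrand n x0 (\<xi>0 + t) - E) \<le> 1 / 8" by (simp add: norm_mult E)
    qed
    moreover have "1 / (2 * C) * real n powr (- 1 / real (m_at \<phi> \<xi>0)) \<le> 1 / (2 * real N)"
    proof -
      have "real N \<le> 256 / \<rho> + 1" using \<open>256 / \<rho> > 0\<close> unfolding N_def by linarith
      also have "\<dots> \<le> C * \<nu>" using rp(3) \<theta>(1) by (simp add: C_def \<rho>_def field_simps)
      finally have "1 / (2 * (C * \<nu>)) \<le> 1 / (2 * real N)" using N0 by (intro divide_left_mono) (auto simp: C rp(1))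
      then show ?thesis unfolding rp(4) by (simp add: mult_ac)
    qed
    ultimately show "\<exists>y. 1 / (2 * C) * real n powr (- 1 / real (m_at \<phi> \<xi>0)) \<le> cmod (conv_power \<phi> n y)"
      using order_trans by blast
  qed (use C in simp)
qed

section \<open>The location of the maximum\<close>

lemma finite_range_conv_power: "finite (range (\<lambda>y. cmod (conv_power \<phi> n y)))"
proof (rule finite_subset)
  show "range (\<lambda>y. cmod (conv_power \<phi> n y)) \<subseteq> insert 0 ((\<lambda>y. cmod (conv_power \<phi> n y)) ` supp (conv_power \<phi> n))"
    by auto
  show "finite (insert 0 ((\<lambda>y. cmod (conv_power \<phi> n y)) ` supp (conv_power \<phi> n)))"
    by (intro finite.insertI finite_imageI finite_supp_conv_power finite_supp)
qed

lemma sup_conv_power_attained: "\<exists>x. cmod (conv_power \<phi> n x) = (SUP y. cmod (conv_power \<phi> n y))"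
proof -
  have "(SUP y. cmod (conv_power \<phi> n y)) \<in> range (\<lambda>y. cmod (conv_power \<phi> n y))"
    using Max_in[OF finite_range_conv_power] cSup_eq_Max[OF finite_range_conv_power] by auto
  then show ?thesis by force
qed

lemma conv_power_le_sup: "cmod (conv_power \<phi> n x) \<le> (SUP y. cmod (conv_power \<phi> n y))"
  by (rule cSUP_upper) (auto intro: bdd_above_finite finite_range_conv_power)

text \<open>
  Far from all \<alpha>_q n every main term is at most a small multiple of n^(-1/m) by the decay of H, which
  contradicts the lower bound for the supremum.
\<close>

lemma maximum_location:
  assumes nondeg: "m_max \<phi> > 2 \<or> (\<forall>\<xi>\<in>max_points \<phi>. Re (beta_at \<phi> \<xi>) > 0)"
  obtains M where "\<forall>\<^sub>F n in sequentially. \<forall>x. cmod (conv_power \<phi> n x) = (SUP y. cmod (conv_power \<phi> n y)) \<longrightarrow>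
     (\<exists>\<xi>\<in>max_points \<phi>. \<bar>real_of_int x - alpha_at \<phi> \<xi> * real n\<bar> \<le> M * real n powr (1 / real (m_max \<phi>)))"
proof -
  let ?p = "\<lambda>n::nat. real n powr (- 1 / real (m_max \<phi>))"
  have m1: "1 \<le> m_max \<phi>" using m_max_ge_2 by simp
  obtain \<xi>0 where \<xi>0: "\<xi>0 \<in> max_points \<phi>" using max_points_nonempty by blast
  then have \<xi>0': "\<xi>0 \<in> Omega \<phi>" "m_at \<phi> \<xi>0 = m_max \<phi>" by (auto simp: max_points_def)
  obtain c where c: "c > 0" "\<And>n. 1 \<le> n \<Longrightarrow> \<exists>y. c * ?p n \<le> cmod (conv_power \<phi> n y)"
    using conv_power_lower_bound[OF \<xi>0'(1)] unfolding \<xi>0'(2) by blast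
  define R where "R = real (card (max_points \<phi>))"
  have R: "R > 0" using finite_max_points max_points_nonempty by (simp add: R_def card_gt_0_iff)
  have "\<forall>\<xi>\<in>max_points \<phi>. \<exists>M. \<forall>y. \<bar>y\<bar> > M \<longrightarrow> cmod (H (m_max \<phi>) (beta_at \<phi> \<xi>) y) \<le> c / 4 / R"
  proof
    fix \<xi> assume \<xi>: "\<xi> \<in> max_points \<phi>"
    then have \<xi>': "\<xi> \<in> Omega \<phi>" "m_at \<phi> \<xi> = m_max \<phi>" by (auto simp: max_points_def)
    obtain h r where bp: "boundary_phase (m_max \<phi>) (beta_at \<phi> \<xi>) h r"
      using local_expansion[OF \<xi>'(1)] unfolding \<xi>'(2) by blast
    have "m_max \<phi> > 2 \<or> Re (beta_at \<phi> \<xi>) > 0" using nondeg \<xi> by blast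
    moreover have "c / 4 / R > 0" using c(1) R by simp
    ultimately show "\<exists>M. \<forall>y. \<bar>y\<bar> > M \<longrightarrow> cmod (H (m_max \<phi>) (beta_at \<phi> \<xi>) y) \<le> c / 4 / R"
      using boundary_phase.H_decay[OF bp] by blast
  qed
  from bchoice[OF this] obtain Mf where Mf:
    "\<And>\<xi> y. \<xi> \<in> max_points \<phi> \<Longrightarrow> \<bar>y\<bar> > Mf \<xi> \<Longrightarrow> cmod (H (m_max \<phi>) (beta_at \<phi> \<xi>) y) \<le> c / 4 / R" by blast
  define M where "M = Max (Mf ` max_points \<phi>)"
  have M: "Mf \<xi> \<le> M" if "\<xi> \<in> max_points \<phi>" for \<xi> unfolding M_def using finite_max_points that by simp
  have "c / 4 > 0" using c(1) by simp
  have "\<forall>\<^sub>F n in sequentially. \<forall>x. cmod (conv_power \<phi> n x) = (SUP y. cmod (conv_power \<phi> n y)) \<longrightarrow>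
     (\<exists>\<xi>\<in>max_points \<phi>. \<bar>real_of_int x - alpha_at \<phi> \<xi> * real n\<bar> \<le> M * real n powr (1 / real (m_max \<phi>)))"
    using conv_power_asymptotics[OF nondeg \<open>c / 4 > 0\<close>] eventually_ge_at_top[of 1]
  proof eventually_elim
    case (elim n)
    show ?case
    proof (intro allI impI, rule ccontr)
      fix x assume x: "cmod (conv_power \<phi> n x) = (SUP y. cmod (conv_power \<phi> n y))"
        and "\<not> (\<exists>\<xi>\<in>max_points \<phi>. \<bar>real_of_int x - alpha_at \<phi> \<xi> * real n\<bar> \<le> M * real n powr (1 / real (m_max \<phi>)))"
      then have far: "\<bar>real_of_int x - alpha_at \<phi> \<xi> * real n\<bar> > M * real n powr (1 / real (m_max \<phi>))"
        if "\<xi> \<in> max_points \<phi>" for \<xi> using that by force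
      have n: "1 \<le> n" by (rule elim(2))
      note rp = root_powr[OF n m1]
      have p: "?p n > 0" using n by simp
      have "cmod (attractor \<xi> n x) \<le> ?p n * (c / 4 / R)" if \<xi>: "\<xi> \<in> max_points \<phi>" for \<xi>
      proof -
        have "cmod (fourier \<phi> \<xi>) = 1" using \<xi> by (simp add: max_points_def Omega_def)
        then have "cmod (attractor \<xi> n x) = ?p n * cmod (H (m_max \<phi>) (beta_at \<phi> \<xi>)
          ((real_of_int x - alpha_at \<phi> \<xi> * real n) / real n powr (1 / real (m_max \<phi>))))"
          by (simp add: attractor_def norm_mult norm_power)
        moreover have "Mf \<xi> < \<bar>(real_of_int x - alpha_at \<phi> \<xi> * real n) / real n powr (1 / real (m_max \<phi>))\<bar>"
        proof -
          have "Mf \<xi> * real n powr (1 / real (m_max \<phi>)) \<le> M * real n powr (1 / real (m_max \<phi>))"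
            using M[OF \<xi>] by (intro mult_right_mono) auto
          with far[OF \<xi>] have "Mf \<xi> * real n powr (1 / real (m_max \<phi>)) < \<bar>real_of_int x - alpha_at \<phi> \<xi> * real n\<bar>" by linarith
          then show ?thesis using rp(1) by (simp add: pos_less_divide_eq abs_divide)
        qed
        ultimately show ?thesis using Mf[OF \<xi>] p by (simp only: mult_le_cancel_left_pos)
      qed
      then have "cmod (\<Sum>\<xi>\<in>max_points \<phi>. attractor \<xi> n x) \<le> (\<Sum>\<xi>\<in>max_points \<phi>. ?p n * (c / 4 / R))"
        by (intro sum_norm_le) blast
      also have "\<dots> = c / 4 * ?p n" using R by (simp add: R_def)
      finally have s: "cmod (\<Sum>\<xi>\<in>max_points \<phi>. attractor \<xi> n x) \<le> c / 4 * ?p n" .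
      have "cmod (conv_power \<phi> n x - (\<Sum>\<xi>\<in>max_points \<phi>. attractor \<xi> n x)) \<le> c / 4 * ?p n"
        using elim(1) by blast
      then have "cmod (conv_power \<phi> n x) \<le> c / 2 * ?p n"
        using s norm_triangle_sub[of "conv_power \<phi> n x" "\<Sum>\<xi>\<in>max_points \<phi>. attractor \<xi> n x"] by simp
      moreover obtain y where "c * ?p n \<le> cmod (conv_power \<phi> n y)" using c(2)[OF n] by blast
      then have "c * ?p n \<le> cmod (conv_power \<phi> n x)" using conv_power_le_sup[of n y] x by linarith
      moreover have "c / 2 * ?p n < c * ?p n" using c(1) p by simp
      ultimately show False by linarith
    qed
  qed
  then show ?thesis using that by blast
qed

text \<open>
  For each of the finitely many n below the threshold, enlarging K captures one maximiser.
\<close>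

lemma maximum_location_compact:
  assumes nondeg: "m_max \<phi> > 2 \<or> (\<forall>\<xi>\<in>max_points \<phi>. Re (beta_at \<phi> \<xi>) > 0)"
  shows "\<exists>K::real set. compact K \<and>
      (\<forall>n\<ge>1. \<exists>x::int.
         real_of_int x \<in> (\<Union>\<xi>\<in>max_points \<phi>.
           (\<lambda>k. alpha_at \<phi> \<xi> * real n + k * real n powr (1 / real (m_max \<phi>))) ` K) \<and>
         cmod (conv_power \<phi> n x) = (SUP y. cmod (conv_power \<phi> n y)))"
proof -
  let ?q = "\<lambda>n::nat. real n powr (1 / real (m_max \<phi>))"
  have m1: "1 \<le> m_max \<phi>" using m_max_ge_2 by simp
  obtain M where "\<forall>\<^sub>F n in sequentially. \<forall>x. cmod (conv_power \<phi> n x) = (SUP y. cmod (conv_power \<phi> n y)) \<longrightarrow>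
     (\<exists>\<xi>\<in>max_points \<phi>. \<bar>real_of_int x - alpha_at \<phi> \<xi> * real n\<bar> \<le> M * ?q n)"
    by (rule maximum_location[OF nondeg])
  then obtain N where "\<forall>n\<ge>N. \<forall>x. cmod (conv_power \<phi> n x) = (SUP y. cmod (conv_power \<phi> n y)) \<longrightarrow>
     (\<exists>\<xi>\<in>max_points \<phi>. \<bar>real_of_int x - alpha_at \<phi> \<xi> * real n\<bar> \<le> M * ?q n)"
    unfolding eventually_sequentially by (elim exE)
  note MN = this[rule_format]
  obtain \<xi>0 where \<xi>0: "\<xi>0 \<in> max_points \<phi>" using max_points_nonempty by blast
  obtain X where X: "\<And>n. cmod (conv_power \<phi> n (X n)) = (SUP y. cmod (conv_power \<phi> n y))"
  proof -
    have "\<forall>n. \<exists>x. cmod (conv_power \<phi> n x) = (SUP y. cmod (conv_power \<phi> n y))"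
      by (rule allI, rule sup_conv_power_attained)
    from choice[OF this] show ?thesis using that by (elim exE) (rule that, erule spec)
  qed
  define L where "L = Max (insert M ((\<lambda>n. \<bar>real_of_int (X n) - alpha_at \<phi> \<xi>0 * real n\<bar> / ?q n) ` {..<N}))"
  have M_le_L: "M \<le> L" unfolding L_def by (intro Max_ge) auto
  have XL: "\<bar>real_of_int (X n) - alpha_at \<phi> \<xi>0 * real n\<bar> / ?q n \<le> L" if "n < N" for n
    unfolding L_def using that by (intro Max_ge) auto
  have near: "\<exists>\<xi>\<in>max_points \<phi>. \<bar>real_of_int (X n) - alpha_at \<phi> \<xi> * real n\<bar> \<le> L * ?q n" if n: "1 \<le> n" for n
  proof (cases "n < N")
    case True
    have "\<bar>real_of_int (X n) - alpha_at \<phi> \<xi>0 * real n\<bar> \<le> L * ?q n"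
      using XL[OF True] root_powr(1)[OF n m1] by (simp only: pos_divide_le_eq)
    then show ?thesis using \<xi>0 by (rule bexI)
  next
    case False
    then have "N \<le> n" by simp
    from MN[OF this X] obtain \<xi> where \<xi>: "\<xi> \<in> max_points \<phi>"
      "\<bar>real_of_int (X n) - alpha_at \<phi> \<xi> * real n\<bar> \<le> M * ?q n" by (elim bexE)
    have "M * ?q n \<le> L * ?q n" using M_le_L by (intro mult_right_mono) auto
    with \<xi>(2) have "\<bar>real_of_int (X n) - alpha_at \<phi> \<xi> * real n\<bar> \<le> L * ?q n" by (rule order_trans)
    then show ?thesis using \<xi>(1) by (rule bexI)
  qed
  have loc: "real_of_int (X n) \<in> (\<Union>\<xi>\<in>max_points \<phi>. (\<lambda>k. alpha_at \<phi> \<xi> * real n + k * ?q n) ` {-L..L})" if n: "1 \<le> n" for n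
  proof -
    obtain \<xi> where \<xi>: "\<xi> \<in> max_points \<phi>" "\<bar>real_of_int (X n) - alpha_at \<phi> \<xi> * real n\<bar> \<le> L * ?q n"
      using near[OF n] by blast
    have q: "?q n > 0" by (rule root_powr(1)[OF n m1])
    have "\<bar>(real_of_int (X n) - alpha_at \<phi> \<xi> * real n) / ?q n\<bar> \<le> L"
      using \<xi>(2) q by (simp only: abs_divide abs_of_pos pos_divide_le_eq)
    then have "(real_of_int (X n) - alpha_at \<phi> \<xi> * real n) / ?q n \<in> {-L..L}" unfolding abs_le_iff atLeastAtMost_iff by linarith
    moreover have "real_of_int (X n) = alpha_at \<phi> \<xi> * real n + (real_of_int (X n) - alpha_at \<phi> \<xi> * real n) / ?q n * ?q n"
      using q by simp
    ultimately show ?thesis by (intro UN_I[OF \<xi>(1)] image_eqI)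
  qed
  show ?thesis
  proof (intro exI[of _ "{-L..L}"] conjI compact_Icc allI impI)
    fix n :: nat assume n: "1 \<le> n"
    show "\<exists>x::int. real_of_int x \<in> (\<Union>\<xi>\<in>max_points \<phi>. (\<lambda>k. alpha_at \<phi> \<xi> * real n + k * ?q n) ` {-L..L}) \<and>
         cmod (conv_power \<phi> n x) = (SUP y. cmod (conv_power \<phi> n y))"
      by (rule exI[of _ "X n"], rule conjI[OF loc[OF n] X])
  qed
qed

end

theorem theorem1p2:
  fixes \<phi> :: "int \<Rightarrow> complex"
  assumes "admissible_support \<phi>"
    and "(SUP \<xi>. cmod (fourier \<phi> \<xi>)) = 1"
    and "m_max \<phi> > 2 \<or> (\<forall>\<xi>\<in>max_points \<phi>. Re (beta_at \<phi> \<xi>) > 0)"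
  shows "\<exists>K::real set. compact K \<and>
      (\<forall>n\<ge>1. \<exists>x::int.
         real_of_int x \<in> (\<Union>\<xi>\<in>max_points \<phi>.
           (\<lambda>k. alpha_at \<phi> \<xi> * real n + k * real n powr (1 / real (m_max \<phi>))) ` K) \<and>
         cmod (conv_power \<phi> n x) = (SUP y. cmod (conv_power \<phi> n y))) \<and>
      (\<forall>\<epsilon>>0. \<forall>\<^sub>F n in sequentially. \<forall>x::int.
         cmod (conv_power \<phi> n x -
           (\<Sum>\<xi>\<in>max_points \<phi>.
              of_real (real n powr (- 1 / real (m_max \<phi>)))
              * exp (- \<i> * of_int x * of_real \<xi>) * fourier \<phi> \<xi> ^ n
              * H (m_max \<phi>) (beta_at \<phi> \<xi>)
                  ((real_of_int x - alpha_at \<phi> \<xi> * real n)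
                     / real n powr (1 / real (m_max \<phi>)))))
         \<le> \<epsilon> * real n powr (- 1 / real (m_max \<phi>)))"
proof -
  interpret normalized_symbol \<phi> using assms(1,2) by unfold_locales
  obtain K where K: "compact K" "\<forall>n\<ge>1. \<exists>x::int.
         real_of_int x \<in> (\<Union>\<xi>\<in>max_points \<phi>.
           (\<lambda>k. alpha_at \<phi> \<xi> * real n + k * real n powr (1 / real (m_max \<phi>))) ` K) \<and>
         cmod (conv_power \<phi> n x) = (SUP y. cmod (conv_power \<phi> n y))"
    using maximum_location_compact[OF assms(3)] by blast
  show ?thesis
    using K conv_power_asymptotics[OF assms(3)] unfolding attractor_def by blast
qed

end
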